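(* Let $\Sigma_{SE(2)}$ be the linear control system on $SE(2)$ $$\dot g=\mathcal{X}(g)+u\,Y^L(g),\qquad g=(t,v)\in SE(2),\ u\in\Omega=[u^-,u^+],\ u^-<0<u^+,$$ with linear vector field $\mathcal{X}=(\xi,A)$, i.e. $\mathcal{X}(t,v)=(0,Av+\Lambda_t\xi)$, and left-invariant vector field $Y^L(t,v)=(\alpha,\rho_t\eta)$, $(\alpha,\eta)\in\mathbb{R}\times\mathbb{R}^2$. Since $A\theta=\theta A$, write $A=\begin{pmatrix}\lambda&-\mu\\\mu&\lambda\end{pmatrix}$. Assume that $\Sigma_{SE(2)}$ satisfies the Lie algebra rank condition. Then: 1. If $\det A=0$, then $\Sigma_{SE(2)}$ admits an infinite number of control sets with empty interior. 2. If $\det A\neq0$, then: 2.1. if $\operatorname{tr}A=0$, the system is controllable; 2.2. if $\operatorname{tr}A<0$, the system admits a unique compact control set $\mathcal{C}_{SE(2)}$ with nonempty interior; 2.3. if $\operatorname{tr}A>0$, the system admits a unique open control set $\mathcal{C}_{SE(2)}$ with nonempty interior. Moreover, suppose that $\mu\in\Omega$. If $\mu\neq0$, then $\mathcal{C}_{SE(2)}$ admits a periodic orbit in its boundary, which is a control set. If $\mu=0$, then any singularity of the drift $\mathcal{X}$ (i.e. any point $g$ with $\mathcal{X}(g)=0$) is a one-point control set on the boundary of $\mathcal{C}_{SE(2)}$.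
   Context: $S^1=\mathbb{R}/2\pi\mathbb{Z}$; $\theta=\begin{pmatrix}0&-1\\1&0\end{pmatrix}$; $\rho_t=e^{t\theta}$ is the counter-clockwise rotation of $\mathbb{R}^2$ by angle $t$. $SE(2)$ is the Lie group with underlying manifold $S^1\times\mathbb{R}^2$ and product $(t_1,v_1)*(t_2,v_2)=(t_1+t_2,\,v_1+\rho_{t_1}v_2)$. A linear vector field on $SE(2)$ is a vector field of the form $\mathcal{X}(t,v)=(0,Av+\Lambda_t\xi)$, where $\xi\in\mathbb{R}^2$, $A$ is a real $2\times2$ matrix with $A\theta=\theta A$, and $\Lambda_t\xi:=(I-\rho_t)\theta\xi$; it is denoted $\mathcal{X}=(\xi,A)$. A left-invariant vector field on $SE(2)$ has the form $Y^L(t,v)=(\alpha,\rho_t\eta)$. The admissible controls $\mathcal{U}$ are the piecewise constant functions $\mathbf{u}$ with values in $\Omega$, and $\varphi(\cdot,g,\mathbf{u})$ is the solution with control $\mathbf{u}$ and $\varphi(0,g,\mathbf{u})=g$. The positive orbit is $\mathcal{O}^+(g)=\{\varphi(s,g,\mathbf{u}): s\ge0,\ \mathbf{u}\in\mathcal{U}\}$. The system is controllable if $\mathcal{O}^+(g)=SE(2)$ for all $g\in SE(2)$. The system satisfies the Lie algebra rank condition if the Lie algebra $\mathcal{L}$ of vector fields generated by $\mathcal{X}$ and $Y^L$ satisfies $\mathcal{L}(g)=T_gSE(2)$ for all $g$; this is equivalent to $\alpha\neq0$ and $\alpha\xi+A\eta\neq0$. A control set is a set $D\subset SE(2)$ that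 is maximal with respect to set inclusion among the sets satisfying: (1) for every $x\in D$ there is $\mathbf{u}\in\mathcal{U}$ with $\varphi(\mathbb{R}_+,x,\mathbf{u})\subset D$; (2) $D\subset\overline{\mathcal{O}^+(x)}$ for every $x\in D$. A periodic orbit is the image of a nonconstant periodic solution $s\mapsto\varphi(s,g,\mathbf{u})$ for some $\mathbf{u}\in\mathcal{U}$.
   Formalization: In the "Moreover" of 2.3 the condition μ∈Ω is replaced by μ∈αΩ (the same when α=1 or μ=0): for general α≠1 and μ≠0, μ∈Ω alone does not ensure a periodic orbit in the boundary (it fails e.g. for λ=μ=1, Ω=[-1,2] and suitable small α>0). *)

theory Defs
  imports "HOL-Analysis.Analysis"
begin

subsection \<open>The circle and the manifold of SE(2)\<close>

text \<open>\<open>S\<^sup>1 = \<real> / 2\<pi>\<int>\<close> with the quotient topology.\<close>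

definition angle_rel :: "real \<Rightarrow> real \<Rightarrow> bool" where
  "angle_rel s t \<longleftrightarrow> (\<exists>k::int. s - t = 2 * pi * of_int k)"

quotient_type circle = real / angle_rel
proof (rule equivpI)
  show "reflp angle_rel"
    unfolding reflp_def angle_rel_def by (auto intro: exI[of _ 0])
  show "symp angle_rel"
    unfolding symp_def angle_rel_def
  proof (intro allI impI)
    fix x y assume "\<exists>k::int. x - y = 2 * pi * of_int k"
    then obtain k :: int where "x - y = 2 * pi * of_int k" by blast
    then have "y - x = 2 * pi * of_int (- k)" by simp
    then show "\<exists>k::int. y - x = 2 * pi * of_int k" by blast
  qed
  show "transp angle_rel"
    unfolding transp_def angle_rel_def
  proof (intro allI impI)
    fix x y z
    assume "\<exists>k::int. x - y = 2 * pi * of_int k" "\<exists>k::int. y - z = 2 * pi * of_int k"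
    then obtain k l :: int where "x - y = 2 * pi * of_int k" "y - z = 2 * pi * of_int l"
      by blast
    then have "x - z = 2 * pi * of_int (k + l)" by (simp add: algebra_simps)
    then show "\<exists>k::int. x - z = 2 * pi * of_int k" by blast
  qed
qed

instantiation circle :: topological_space
begin

definition open_circle :: "circle set \<Rightarrow> bool" where
  "open_circle U \<longleftrightarrow> open (abs_circle -` U)"

instance
proof
  show "open (UNIV :: circle set)"
    by (simp add: open_circle_def)
  show "open (S \<inter> T)" if "open S" "open T" for S T :: "circle set"
    using that by (simp add: open_circle_def open_Int)
  show "open (\<Union>K)" if "\<forall>S\<in>K. open S" for K :: "circle set set"
    using that by (auto simp: open_circle_def vimage_Union)
qed

end

type_synonym se2 = "circle \<times> (real^2)"

text \<open>The universal covering \<open>\<real> \<times> \<real>\<^sup>2 \<rightarrow> S\<^sup>1 \<times> \<real>\<^sup>2\<close>.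
  It is a local diffeomorphism and it trivialises the tangent bundle, so a vector field is a
  function from \<open>se2\<close> to \<open>real \<times> (real^2)\<close>.\<close>

definition se2_cover :: "real \<times> (real^2) \<Rightarrow> se2" where
  "se2_cover p = (abs_circle (fst p), snd p)"

type_synonym vfield = "se2 \<Rightarrow> real \<times> (real^2)"


subsection \<open>Rotations\<close>

definition rot_gen :: "real^2^2" where
  "rot_gen = vector [vector [0, -1], vector [1, 0]]"

definition rotation :: "real \<Rightarrow> real^2^2" where
  "rotation t = vector [vector [cos t, - sin t], vector [sin t, cos t]]"

text \<open>The next two facts identify \<open>rotation t\<close> with the matrix exponential \<open>e\<^bsup>t\<theta>\<^esup>\<close>, \<open>\<theta> = rot_gen\<close>.\<close>

lemma rotation_0: "rotation 0 = mat 1"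
  by (simp add: rotation_def mat_def vec_eq_iff forall_2)

lemma rotation_has_vector_derivative:
  "(rotation has_vector_derivative (rot_gen ** rotation t)) (at t)"
proof -
  have eq: "rotation = (\<lambda>s. cos s *\<^sub>R mat 1 + sin s *\<^sub>R rot_gen)"
    by (rule ext) (simp add: rotation_def rot_gen_def mat_def vec_eq_iff forall_2)
  have gen: "rot_gen ** rotation t = (- sin t) *\<^sub>R mat 1 + cos t *\<^sub>R rot_gen"
    by (simp add: rotation_def rot_gen_def mat_def vec_eq_iff forall_2
        matrix_matrix_mult_def sum_2)
  show ?thesis
    unfolding gen unfolding eq by (auto intro!: derivative_eq_intros)
qed

lift_definition rho :: "circle \<Rightarrow> real^2^2" is rotation
proof -
  fix s t assume "angle_rel s t"
  then obtain k :: int where "s = t + 2 * pi * of_int k"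
    by (auto simp: angle_rel_def algebra_simps)
  then show "rotation s = rotation t"
    using sin_cos_eq_iff[of s t] by (auto simp: rotation_def)
qed


subsection \<open>The vector fields\<close>

definition linear_field :: "real^2 \<Rightarrow> real^2^2 \<Rightarrow> vfield" where
  "linear_field \<xi> A = (\<lambda>(t, v). (0, A *v v + (mat 1 - rho t) *v (rot_gen *v \<xi>)))"

definition left_invariant_field :: "real \<Rightarrow> real^2 \<Rightarrow> vfield" where
  "left_invariant_field \<alpha> \<eta> = (\<lambda>(t, v). (\<alpha>, rho t *v \<eta>))"


subsection \<open>The Lie algebra rank condition\<close>

text \<open>The derivative of a vector field in the covering coordinates. It does not depend on the
  chosen representative of \<open>fst g\<close>, as lifted fields are periodic.\<close>

definition vfield_deriv :: "vfield \<Rightarrow> se2 \<Rightarrow> real \<times> (real^2) \<Rightarrow> real \<times> (real^2)" where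
  "vfield_deriv Z g = frechet_derivative (Z \<circ> se2_cover) (at (rep_circle (fst g), snd g))"

definition lie_bracket :: "vfield \<Rightarrow> vfield \<Rightarrow> vfield" where
  "lie_bracket Z W = (\<lambda>g. vfield_deriv W g (Z g) - vfield_deriv Z g (W g))"

inductive_set lie_generated :: "vfield set \<Rightarrow> vfield set" for S :: "vfield set" where
  base: "Z \<in> S \<Longrightarrow> Z \<in> lie_generated S"
| add: "Z \<in> lie_generated S \<Longrightarrow> W \<in> lie_generated S \<Longrightarrow> (\<lambda>g. Z g + W g) \<in> lie_generated S"
| scale: "Z \<in> lie_generated S \<Longrightarrow> (\<lambda>g. c *\<^sub>R Z g) \<in> lie_generated S"
| bracket: "Z \<in> lie_generated S \<Longrightarrow> W \<in> lie_generated S \<Longrightarrow> lie_bracket Z W \<in> lie_generated S"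

definition lie_rank_condition :: "vfield \<Rightarrow> vfield \<Rightarrow> bool" where
  "lie_rank_condition X Y \<longleftrightarrow> (\<forall>g. {Z g |Z. Z \<in> lie_generated {X, Y}} = UNIV)"


subsection \<open>Controls, solutions and orbits\<close>

text \<open>Only the values on \<open>[0,\<infinity>)\<close> matter. A piecewise constant control has finitely many
  jumps on every bounded interval; there may be infinitely many on the half-line.\<close>

definition admissible_control :: "real set \<Rightarrow> (real \<Rightarrow> real) \<Rightarrow> bool" where
  "admissible_control \<Omega> u \<longleftrightarrow>
     (\<forall>s\<ge>0. u s \<in> \<Omega>) \<and>
     (\<exists>S. (\<forall>T. finite (S \<inter> {0..T})) \<and>
          (\<forall>a b. 0 \<le> a \<longrightarrow> a < b \<longrightarrow> {a<..<b} \<inter> S = {} \<longrightarrow> u constant_on {a<..<b}))"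

text \<open>Solutions of \<open>g' = X g + u Y g\<close> on \<open>[0,\<infinity>)\<close>: continuous curves that satisfy
  the equation except at a locally finite set of times. Derivatives of curves in \<open>se2\<close> are taken
  on a continuous lift \<open>c\<close> to the covering. For the linear systems below \<open>\<phi>(\<cdot>,g,u)\<close> is the
  unique such \<open>\<gamma>\<close> with \<open>\<gamma> 0 = g\<close>.\<close>

definition is_solution ::
  "vfield \<Rightarrow> vfield \<Rightarrow> (real \<Rightarrow> real) \<Rightarrow> (real \<Rightarrow> se2) \<Rightarrow> bool" where
  "is_solution X Y u \<gamma> \<longleftrightarrow>
     (\<exists>c. continuous_on {0..} c \<and> (\<forall>s\<ge>0. \<gamma> s = se2_cover (c s)) \<and>
        (\<exists>S. (\<forall>T. finite (S \<inter> {0..T})) \<and>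
             (\<forall>s. s > 0 \<longrightarrow> s \<notin> S \<longrightarrow>
                (c has_vector_derivative (X (\<gamma> s) + u s *\<^sub>R Y (\<gamma> s))) (at s))))"

definition positive_orbit :: "vfield \<Rightarrow> vfield \<Rightarrow> real set \<Rightarrow> se2 \<Rightarrow> se2 set" where
  "positive_orbit X Y \<Omega> g =
     {\<gamma> s |\<gamma> s u. admissible_control \<Omega> u \<and> is_solution X Y u \<gamma> \<and> \<gamma> 0 = g \<and> 0 \<le> s}"

definition controllable :: "vfield \<Rightarrow> vfield \<Rightarrow> real set \<Rightarrow> bool" where
  "controllable X Y \<Omega> \<longleftrightarrow> (\<forall>g. positive_orbit X Y \<Omega> g = UNIV)"

definition pre_control_set :: "vfield \<Rightarrow> vfield \<Rightarrow> real set \<Rightarrow> se2 set \<Rightarrow> bool" where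
  "pre_control_set X Y \<Omega> D \<longleftrightarrow>
     (\<forall>x\<in>D. \<exists>u \<gamma>. admissible_control \<Omega> u \<and> is_solution X Y u \<gamma> \<and> \<gamma> 0 = x \<and> \<gamma> ` {0..} \<subseteq> D) \<and>
     (\<forall>x\<in>D. D \<subseteq> closure (positive_orbit X Y \<Omega> x))"

definition control_set :: "vfield \<Rightarrow> vfield \<Rightarrow> real set \<Rightarrow> se2 set \<Rightarrow> bool" where
  "control_set X Y \<Omega> D \<longleftrightarrow>
     pre_control_set X Y \<Omega> D \<and> (\<forall>D'. pre_control_set X Y \<Omega> D' \<longrightarrow> D \<subseteq> D' \<longrightarrow> D' = D)"

definition periodic_orbit :: "vfield \<Rightarrow> vfield \<Rightarrow> real set \<Rightarrow> se2 set \<Rightarrow> bool" where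
  "periodic_orbit X Y \<Omega> P \<longleftrightarrow>
     (\<exists>u \<gamma> T. admissible_control \<Omega> u \<and> is_solution X Y u \<gamma> \<and>
        T > 0 \<and> (\<forall>s\<ge>0. \<gamma> (s + T) = \<gamma> s) \<and> \<not> \<gamma> constant_on {0..} \<and> P = \<gamma> ` {0..})"

text \<open>The angle of a solution obeys \<open>t' = u \<alpha>\<close>, so the speeds available to it are \<open>\<alpha>\<Omega>\<close>.
  The condition \<open>\<mu> \<in> \<Omega>\<close>, usual for systems normalised to \<open>\<alpha> = 1\<close>, asks that the angle can
  rotate with the frequency \<open>\<mu>\<close> of \<open>A\<close>. For general \<open>\<alpha>\<close> that is \<open>\<mu> \<in> \<alpha>\<Omega>\<close>, and \<open>\<mu> \<in> \<Omega>\<close>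
  alone does not give a periodic orbit in the boundary.\<close>

definition angular_speeds :: "real \<Rightarrow> real set \<Rightarrow> real set" where
  "angular_speeds \<alpha> \<Omega> = (\<lambda>u. u * \<alpha>) ` \<Omega>"

lemma angular_speeds_1: "angular_speeds 1 \<Omega> = \<Omega>"
  by (simp add: angular_speeds_def)

end

theory Submission
  imports Defs
begin

text \<open>Identify \<open>\<real>\<^sup>2\<close> with \<open>\<complex>\<close>, so that \<open>\<theta>\<close> is \<open>\<i>\<close> and \<open>A\<close> is multiplication by \<open>a = \<lambda> + \<i>\<mu>\<close>.
  The rank condition says that \<open>\<alpha> \<noteq> 0\<close> and that \<open>\<kappa> = - \<i> (\<xi> + a\<eta>/\<alpha>)\<close> does not vanish. The coordinate
  \<open>z = (v + e\<^bsup>\<i>t\<^esup> \<i>\<eta>/\<alpha>) / \<kappa> + h\<close>, with a suitable constant \<open>h\<close>, then turns the system into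
  \<open>t' = w\<close>, \<open>z' = a z + b + e\<^bsup>\<i>t\<^esup>\<close> with the angular speed \<open>w \<in> \<alpha>\<Omega>\<close> as control, where \<open>b = 0\<close> if
  \<open>a \<noteq> 0\<close> and \<open>b = -1\<close> if \<open>a = 0\<close>. The control acts on \<open>z\<close> only through the angle.

  If \<open>a = 0\<close>, then \<open>(Re z)' = cos t - 1 \<le> 0\<close>, so \<open>Re z\<close> is constant on every control set. Each
  singularity \<open>(0, r)\<close> with \<open>r\<close> real lies in some control set by Zorn's lemma, and these sets are
  distinct and thin.

  If \<open>a \<noteq> 0\<close>, rotations \<open>(t, z) \<mapsto> (t + s, e\<^bsup>\<i>s\<^esup> z)\<close> are symmetries and \<open>W = e\<^bsup>-\<i>t\<^esup> z\<close> obeys the planar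
  system \<open>W' = (a - \<i>w) W + 1\<close>. With constant \<open>w \<noteq> \<mu>\<close> it moves on spirals, or on circles if \<open>\<lambda> = 0\<close>,
  about the equilibrium \<open>m\<^sub>w = -1/(a - \<i>w)\<close>. Waiting at an equilibrium with \<open>w \<noteq> 0\<close> changes the angle
  and nothing else, so reachability in \<open>SE(2)\<close> is reachability in the \<open>W\<close>-plane
  (\<open>reach_any_angle\<close>), provided that the path can pass through such a point.

  Two facts drive the case \<open>\<lambda> \<noteq> 0\<close>. Solutions with the same control and the same angle differ by
  \<open>e\<^bsup>as\<^esup> d\<close>, so the flow contracts or expands all distances at the rate \<open>\<lambda>\<close> (\<open>run_neighbour\<close>).
  And if \<open>w \<noteq> \<mu>\<close> is an inner value, the linearisation at \<open>m = m\<^sub>w\<close> is controllable, so \<open>m\<close> is interior both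
  to the set it reaches and to the set that reaches it (\<open>equilibrium_interior_forward\<close> and
  \<open>equilibrium_interior_backward\<close>, by the open mapping theorem for two constant controls).

  \<^item> \<open>\<lambda> = 0\<close>: the rotations about two different equilibria connect any two points.
  \<^item> \<open>\<lambda> < 0\<close>: every point spirals towards \<open>m\<close> and so reaches it exactly. The closure of the set
    reached from \<open>m\<close> is compact and contains every pre-control set by contraction.
  \<^item> \<open>\<lambda> > 0\<close>: backwards every point spirals towards \<open>m\<close>, so \<open>m\<close> reaches everything. The set \<open>N\<close> of
    points that reach \<open>m\<close> is open, and every pre-control set lies in its closure,
    by contraction in backward time.
  \<^item> \<open>\<lambda> > 0\<close> and \<open>w = \<mu>\<close> allowed: the equilibrium is \<open>-1/\<lambda>\<close>. It is a limit of points of \<open>N\<close>. It does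
    not belong to \<open>N\<close>, because \<open>|W|\<close> cannot decrease once \<open>|W| \<ge> 1/\<lambda>\<close> (\<open>run_norm_ge\<close>), whereas
    \<open>|m| < 1/\<lambda>\<close>. By the same monotonicity a pre-control set that contains a point over it
    stays on the circle \<open>|W| = 1/\<lambda>\<close>, and solutions that stay there rest at \<open>-1/\<lambda>\<close>.
    For \<open>\<mu> \<noteq> 0\<close> the points over it form one periodic orbit. For \<open>\<mu> = 0\<close> they are the
    singularities of the drift, and they are separated from one another by the forward
    invariant half-planes \<open>Re (e\<^bsup>-\<i>s\<^esup> z) \<le> -1/\<lambda>\<close>.\<close>

section \<open>Runs of the system in normal form\<close>

lemma has_vector_derivative_translate_argument:
  assumes "(c has_vector_derivative D) (at (s + T))"
  shows "((\<lambda>s. c (s + T)) has_vector_derivative D) (at s)"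
proof -
  have "((\<lambda>s::real. s + T) has_vector_derivative 1) (at s)"
    by (auto intro!: derivative_eq_intros)
  from vector_diff_chain_at[OF this assms] show ?thesis by (simp add: o_def)
qed

text \<open>Solutions are differentiable only off their switching times, so the mean value theorem is replaced
by the fundamental theorem of calculus with finitely many exceptional points.\<close>

lemma antimono_piecewise_deriv:
  fixes f f' :: "real \<Rightarrow> real"
  assumes "a \<le> b" "finite S" "continuous_on {a..b} f"
    and der: "\<And>x. x \<in> {a<..<b} - S \<Longrightarrow> (f has_real_derivative f' x) (at x)"
    and neg: "\<And>x. x \<in> {a<..<b} - S \<Longrightarrow> f' x \<le> 0"
  shows "f b \<le> f a"
proof -
  \<comment> \<open>the exceptional points carry no sign information, so the integrand is set to 0 there\<close>
  let ?g = "\<lambda>x. if x \<in> {a<..<b} - S then f' x else 0"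
  have "(?g has_integral (f b - f a)) {a..b}"
    by (rule fundamental_theorem_of_calculus_interior_strong[OF assms(2,1) _ assms(3)])
      (use der in \<open>auto simp: has_real_derivative_iff_has_vector_derivative\<close>)
  from has_integral_neg[OF this] have "0 \<le> - (f b - f a)"
    by (rule has_integral_nonneg) (use neg in auto)
  then show ?thesis by simp
qed

definition locally_finite_times :: "real set \<Rightarrow> bool" where
  "locally_finite_times S \<longleftrightarrow> (\<forall>T. finite (S \<inter> {0..T}))"

definition constant_between :: "real set \<Rightarrow> (real \<Rightarrow> real) \<Rightarrow> bool" where
  "constant_between S u \<longleftrightarrow>
     (\<forall>a b. 0 \<le> a \<longrightarrow> a < b \<longrightarrow> {a<..<b} \<inter> S = {} \<longrightarrow> u constant_on {a<..<b})"

lemma locally_finite_times_Un: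
  "locally_finite_times S \<Longrightarrow> locally_finite_times T \<Longrightarrow> locally_finite_times (S \<union> T)"
  by (simp add: locally_finite_times_def Int_Un_distrib2)

lemma locally_finite_times_translate:
  assumes "locally_finite_times S"
  shows "locally_finite_times ((\<lambda>s. s + T) ` (S \<inter> {0..}))"
  unfolding locally_finite_times_def
proof
  fix R
  have "(\<lambda>s. s + T) ` (S \<inter> {0..}) \<inter> {0..R} \<subseteq> (\<lambda>s. s + T) ` (S \<inter> {0..R - T})" by auto
  then show "finite ((\<lambda>s. s + T) ` (S \<inter> {0..}) \<inter> {0..R})"
    using assms unfolding locally_finite_times_def by (meson finite_imageI finite_subset)
qed

lemma constant_between_mono: "constant_between S u \<Longrightarrow> S \<subseteq> T \<Longrightarrow> constant_between T u"
  unfolding constant_between_def by blast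

text \<open>The system \<open>t' = w\<close>, \<open>z' = a z + b + e\<^bsup>\<i>t\<^esup>\<close> with \<open>w \<in> [sm, sp]\<close>, on the universal covering
\<open>\<real> \<times> \<complex>\<close>. The angle is a real number here. The identification modulo \<open>2\<pi>\<close> is made later by a
covering map.\<close>

locale turning_system =
  fixes a b :: complex and sm sp :: real
  assumes sm: "sm < 0" and sp: "0 < sp"
begin

definition velocity :: "real \<Rightarrow> real \<times> complex \<Rightarrow> real \<times> complex" where
  "velocity w p = (w, a * snd p + b + cis (fst p))"

text \<open>A control together with its solution. One set of exceptional times serves both the jumps of \<open>w\<close>
and the corners of \<open>c\<close>.\<close>

definition run :: "(real \<Rightarrow> real) \<Rightarrow> (real \<Rightarrow> real \<times> complex) \<Rightarrow> bool" where
  "run w c \<longleftrightarrow> (\<forall>s\<ge>0. w s \<in> {sm..sp}) \<and> continuous_on {0..} c \<and>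
     (\<exists>S. locally_finite_times S \<and> constant_between S w \<and>
        (\<forall>s>0. s \<notin> S \<longrightarrow> (c has_vector_derivative velocity (w s) (c s)) (at s)))"

lemma runI:
  assumes "\<And>s. 0 \<le> s \<Longrightarrow> w s \<in> {sm..sp}" "continuous_on {0..} c"
    "locally_finite_times S" "constant_between S w"
    "\<And>s. 0 < s \<Longrightarrow> s \<notin> S \<Longrightarrow> (c has_vector_derivative velocity (w s) (c s)) (at s)"
  shows "run w c"
  using assms unfolding run_def by blast

lemma run_constI:
  assumes "w \<in> {sm..sp}" "\<And>s. (c has_vector_derivative velocity w (c s)) (at s)"
  shows "run (\<lambda>_. w) c"
proof (rule runI[where S = "{}"])
  show "continuous_on {0..} c"
    using assms(2) by (meson continuous_at_imp_continuous_on has_vector_derivative_continuous)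
qed (use assms in \<open>auto simp: locally_finite_times_def constant_between_def constant_on_def\<close>)

lemma run_tail:
  assumes "run w c" "0 \<le> T"
  shows "run (\<lambda>s. w (s + T)) (\<lambda>s. c (s + T))"
proof -
  obtain S where S: "locally_finite_times S" "constant_between S w"
    "\<And>s. 0 < s \<Longrightarrow> s \<notin> S \<Longrightarrow> (c has_vector_derivative velocity (w s) (c s)) (at s)"
    and w: "\<And>s. 0 \<le> s \<Longrightarrow> w s \<in> {sm..sp}" and c: "continuous_on {0..} c"
    using assms(1) unfolding run_def by blast
  let ?S = "(\<lambda>s. s + T) -` S"
  show ?thesis
  proof (rule runI[where S = ?S])
    show "w (s + T) \<in> {sm..sp}" if "0 \<le> s" for s using w[of "s + T"] that assms(2) by simp
    show "continuous_on {0..} (\<lambda>s. c (s + T))"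
      by (rule continuous_on_compose2[OF c]) (use assms(2) in \<open>auto intro!: continuous_intros\<close>)
    show "locally_finite_times ?S"
      unfolding locally_finite_times_def
    proof
      fix R
      have "?S \<inter> {0..R} \<subseteq> (\<lambda>s. s - T) ` (S \<inter> {0..R + T})"
        using assms(2) by (force simp: image_iff)
      then show "finite (?S \<inter> {0..R})"
        using S(1) unfolding locally_finite_times_def by (meson finite_imageI finite_subset)
    qed
    show "constant_between ?S (\<lambda>s. w (s + T))"
      unfolding constant_between_def
    proof (intro allI impI)
      fix l r :: real assume lr: "0 \<le> l" "l < r" "{l<..<r} \<inter> ?S = {}"
      have "x \<notin> S" if "x \<in> {l + T<..<r + T}" for x
        using lr(3) that by (auto simp: disjoint_iff dest!: spec[of _ "x - T"])
      then have "w constant_on {l + T<..<r + T}"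
        using S(2) lr(1,2) assms(2) unfolding constant_between_def
        by (metis Int_emptyI add_strict_right_mono add_nonneg_nonneg)
      then obtain k where "\<And>x. x \<in> {l + T<..<r + T} \<Longrightarrow> w x = k" unfolding constant_on_def by blast
      then show "(\<lambda>s. w (s + T)) constant_on {l<..<r}"
        unfolding constant_on_def by (intro exI[of _ k]) auto
    qed
    show "((\<lambda>s. c (s + T)) has_vector_derivative velocity (w (s + T)) (c (s + T))) (at s)"
      if "0 < s" "s \<notin> ?S" for s
    proof -
      have "(c has_vector_derivative velocity (w (s + T)) (c (s + T))) (at (s + T))"
        using S(3)[of "s + T"] that assms(2) by simp
      then show ?thesis by (rule has_vector_derivative_translate_argument)
    qed
  qed
qed

lemma run_concat:
  assumes "run w1 c1" "run w2 c2" "0 \<le> T" "c1 T = c2 0"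
  shows "run (\<lambda>s. if s < T then w1 s else w2 (s - T)) (\<lambda>s. if s \<le> T then c1 s else c2 (s - T))"
    (is "run ?w ?c")
proof -
  obtain S1 where S1: "locally_finite_times S1" "constant_between S1 w1"
    "\<And>s. 0 < s \<Longrightarrow> s \<notin> S1 \<Longrightarrow> (c1 has_vector_derivative velocity (w1 s) (c1 s)) (at s)"
    and w1: "\<And>s. 0 \<le> s \<Longrightarrow> w1 s \<in> {sm..sp}" and c1: "continuous_on {0..} c1"
    using assms(1) unfolding run_def by blast
  obtain S2 where S2: "locally_finite_times S2" "constant_between S2 w2"
    "\<And>s. 0 < s \<Longrightarrow> s \<notin> S2 \<Longrightarrow> (c2 has_vector_derivative velocity (w2 s) (c2 s)) (at s)"
    and w2: "\<And>s. 0 \<le> s \<Longrightarrow> w2 s \<in> {sm..sp}" and c2: "continuous_on {0..} c2"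
    using assms(2) unfolding run_def by blast
  let ?S = "S1 \<union> {T} \<union> (\<lambda>s. s + T) ` (S2 \<inter> {0..})"
  show ?thesis
  proof (rule runI[where S = ?S])
    show "?w s \<in> {sm..sp}" if "0 \<le> s" for s using w1[of s] w2[of "s - T"] that by auto
    have "continuous_on ({0..T} \<union> {T..}) ?c"
    proof (rule continuous_on_closed_Un)
      show "continuous_on {0..T} ?c"
        by (rule continuous_on_eq[OF continuous_on_subset[OF c1]]) auto
      have "continuous_on {T..} (\<lambda>s. c2 (s - T))"
        by (rule continuous_on_compose2[OF c2]) (auto intro!: continuous_intros)
      then show "continuous_on {T..} ?c"
        by (rule continuous_on_eq) (use assms(4) in auto)
    qed auto
    moreover have "{0..T} \<union> {T..} = {0..}" using assms(3) by auto
    ultimately show "continuous_on {0..} ?c" by simp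
    have "locally_finite_times {T}" by (simp add: locally_finite_times_def)
    then show "locally_finite_times ?S"
      using S1(1) S2(1) by (intro locally_finite_times_Un locally_finite_times_translate)
    show "constant_between ?S ?w"
      unfolding constant_between_def
    proof (intro allI impI)
      fix l r :: real assume lr: "0 \<le> l" "l < r" "{l<..<r} \<inter> ?S = {}"
      then have "T \<notin> {l<..<r}" by blast
      then consider "r \<le> T" | "T \<le> l" by force
      then show "?w constant_on {l<..<r}"
      proof cases
        case 1
        have "w1 constant_on {l<..<r}" using S1(2) lr unfolding constant_between_def by blast
        then show ?thesis using 1 unfolding constant_on_def by (metis greaterThanLessThan_iff order_less_le_trans)
      next
        case 2
        have "x \<notin> S2" if "x \<in> {l - T<..<r - T}" for x
        proof
          assume "x \<in> S2"
          then have "x + T \<in> ?S" using that 2 by auto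
          moreover have "x + T \<in> {l<..<r}" using that by auto
          ultimately show False using lr(3) by blast
        qed
        then have "w2 constant_on {l - T<..<r - T}"
          using S2(2) lr(2) 2 unfolding constant_between_def
          by (metis Int_emptyI diff_strict_right_mono diff_ge_0_iff_ge)
        then obtain k where "\<And>x. x \<in> {l - T<..<r - T} \<Longrightarrow> w2 x = k" unfolding constant_on_def by blast
        then show ?thesis using 2 unfolding constant_on_def by (intro exI[of _ k]) auto
      qed
    qed
    show "(?c has_vector_derivative velocity (?w s) (?c s)) (at s)" if "0 < s" "s \<notin> ?S" for s
    proof (cases "s < T")
      case True
      have "(c1 has_vector_derivative velocity (w1 s) (c1 s)) (at s)" using S1(3) that by blast
      then have "(?c has_vector_derivative velocity (w1 s) (c1 s)) (at s)"
        by (rule has_vector_derivative_transform_within_open[where S = "{..<T}"]) (use True in auto)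
      then show ?thesis using True by simp
    next
      case False
      then have T: "T < s" using that by (cases "s = T") auto
      have "s - T \<notin> S2"
      proof
        assume "s - T \<in> S2"
        then have "s \<in> (\<lambda>s. s + T) ` (S2 \<inter> {0..})" using T by (intro image_eqI[of _ _ "s - T"]) auto
        then show False using that by blast
      qed
      then have "(c2 has_vector_derivative velocity (w2 (s - T)) (c2 (s - T))) (at (s - T))"
        using S2(3) T by simp
      then have "((\<lambda>s. c2 (s - T)) has_vector_derivative velocity (w2 (s - T)) (c2 (s - T))) (at s)"
        using has_vector_derivative_translate_argument[of c2 _ s "- T"] by simp
      then have "(?c has_vector_derivative velocity (w2 (s - T)) (c2 (s - T))) (at s)"
        by (rule has_vector_derivative_transform_within_open[where S = "{T<..}"]) (use T in auto)
      then show ?thesis using T by simp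
    qed
  qed
qed

definition reach :: "real \<Rightarrow> real \<times> complex \<Rightarrow> real \<times> complex \<Rightarrow> bool" where
  "reach s p p' \<longleftrightarrow> 0 \<le> s \<and> (\<exists>w c. run w c \<and> c 0 = p \<and> c s = p')"

lemma reachI: "run w c \<Longrightarrow> 0 \<le> s \<Longrightarrow> reach s (c 0) (c s)"
  unfolding reach_def by blast

lemma reach_trans: "reach s p p' \<Longrightarrow> reach s' p' p'' \<Longrightarrow> reach (s + s') p p''"
proof -
  assume "reach s p p'" "reach s' p' p''"
  then obtain w c w' c' where *: "run w c" "c 0 = p" "c s = p'" "run w' c'" "c' 0 = p'" "c' s' = p''"
    "0 \<le> s" "0 \<le> s'" unfolding reach_def by blast
  have "run (\<lambda>r. if r < s then w r else w' (r - s)) (\<lambda>r. if r \<le> s then c r else c' (r - s))"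
    by (rule run_concat) (use * in auto)
  from reachI[OF this, of "s + s'"] show ?thesis using * by (auto split: if_splits)
qed

lemma reach_tail: "run w c \<Longrightarrow> 0 \<le> s \<Longrightarrow> s \<le> r \<Longrightarrow> reach (r - s) (c s) (c r)"
  using reachI[OF run_tail[of w c s], of "r - s"] by simp

lemma run_components:
  assumes "run w c"
  obtains S where "locally_finite_times S" "continuous_on {0..} (\<lambda>s. fst (c s))"
    "continuous_on {0..} (\<lambda>s. snd (c s))"
    "\<And>s. 0 < s \<Longrightarrow> s \<notin> S \<Longrightarrow> ((\<lambda>s. snd (c s)) has_vector_derivative
        (a * snd (c s) + b + cis (fst (c s)))) (at s)"
    "\<And>s. 0 < s \<Longrightarrow> s \<notin> S \<Longrightarrow> ((\<lambda>s. fst (c s)) has_vector_derivative w s) (at s)"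
proof -
  obtain S where S: "locally_finite_times S"
    "\<And>s. 0 < s \<Longrightarrow> s \<notin> S \<Longrightarrow> (c has_vector_derivative velocity (w s) (c s)) (at s)"
    and c: "continuous_on {0..} c"
    using assms unfolding run_def by blast
  show thesis
  proof (rule that[OF S(1)])
    show "continuous_on {0..} (\<lambda>s. fst (c s))" "continuous_on {0..} (\<lambda>s. snd (c s))"
      using c by (auto intro: continuous_intros)
    fix s :: real assume "0 < s" "s \<notin> S"
    from S(2)[OF this] have d: "(c has_vector_derivative velocity (w s) (c s)) (at s)" .
    show "((\<lambda>s. snd (c s)) has_vector_derivative (a * snd (c s) + b + cis (fst (c s)))) (at s)"
      using bounded_linear.has_vector_derivative[OF bounded_linear_snd d] by (simp add: velocity_def)
    show "((\<lambda>s. fst (c s)) has_vector_derivative w s) (at s)"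
      using bounded_linear.has_vector_derivative[OF bounded_linear_fst d] by (simp add: velocity_def)
  qed
qed

text \<open>A solution in \<open>SE(2)\<close> may be lifted to start at any prescribed point over its initial value.\<close>

lemma run_translate:
  assumes "run w c" shows "run w (\<lambda>s. c s + (2 * pi * of_int k, 0))"
proof -
  obtain S where S: "locally_finite_times S" "constant_between S w"
    "\<And>s. 0 < s \<Longrightarrow> s \<notin> S \<Longrightarrow> (c has_vector_derivative velocity (w s) (c s)) (at s)"
    and w: "\<And>s. 0 \<le> s \<Longrightarrow> w s \<in> {sm..sp}" and c: "continuous_on {0..} c"
    using assms(1) unfolding run_def by blast
  have cis: "cis (t + 2 * pi * of_int k) = cis t" for t
    by (simp add: cis_mult[symmetric] cis_multiple_2pi)
  show ?thesis
  proof (rule runI[OF w _ S(1,2)])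
    fix s :: real assume "0 < s" "s \<notin> S"
    from S(3)[OF this] show "((\<lambda>s. c s + (2 * pi * of_int k, 0)) has_vector_derivative
        velocity (w s) (c s + (2 * pi * of_int k, 0))) (at s)"
      by (auto simp: velocity_def cis intro!: derivative_eq_intros)
  qed (use c in \<open>auto intro!: continuous_intros\<close>)
qed

end

context turning_system
begin

text \<open>The equation for \<open>z\<close> is affine and its inhomogeneity depends on the angle only. Hence adding a
solution of \<open>z' = a z\<close> gives another solution with the same control and the same angle.\<close>

lemma run_shift:
  assumes "run w c" shows "run w (\<lambda>s. c s + (0, exp (a * of_real s) * d))"
proof -
  obtain S where S: "locally_finite_times S" "constant_between S w"
    "\<And>s. 0 < s \<Longrightarrow> s \<notin> S \<Longrightarrow> (c has_vector_derivative velocity (w s) (c s)) (at s)"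
    and w: "\<And>s. 0 \<le> s \<Longrightarrow> w s \<in> {sm..sp}" and c: "continuous_on {0..} c"
    using assms(1) unfolding run_def by blast
  have ex: "((\<lambda>s. exp (a * of_real s) * d) has_vector_derivative a * (exp (a * of_real s) * d)) (at s)"
    for s :: real
  proof -
    have "((\<lambda>z. exp (a * z) * d) has_field_derivative a * (exp (a * of_real s) * d)) (at (of_real s))"
      by (auto intro!: derivative_eq_intros)
    from has_vector_derivative_real_field[OF this] show ?thesis by simp
  qed
  show ?thesis
  proof (rule runI[OF w _ S(1,2)])
    fix s :: real assume "0 < s" "s \<notin> S"
    have "((\<lambda>s. (0::real, exp (a * of_real s) * d)) has_vector_derivative
        (0, a * (exp (a * of_real s) * d))) (at s)"
      by (rule has_vector_derivative_Pair[OF has_vector_derivative_const ex])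
    from has_vector_derivative_add[OF S(3)[OF \<open>0 < s\<close> \<open>s \<notin> S\<close>] this]
    show "((\<lambda>s. c s + (0, exp (a * of_real s) * d)) has_vector_derivative
        velocity (w s) (c s + (0, exp (a * of_real s) * d))) (at s)"
      by (simp add: velocity_def algebra_simps)
  qed (use c in \<open>auto intro!: continuous_intros\<close>)
qed

lemma antimono_along_run:
  fixes f :: "real \<Rightarrow> real"
  assumes "locally_finite_times S" "continuous_on {0..} f" "0 \<le> s"
    and "\<And>r. 0 < r \<Longrightarrow> r \<notin> S \<Longrightarrow> (f has_real_derivative f' r) (at r)"
    and "\<And>r. 0 < r \<Longrightarrow> r \<notin> S \<Longrightarrow> f' r \<le> 0"
  shows "f s \<le> f 0"
proof (rule antimono_piecewise_deriv[where S = "S \<inter> {0..s}" and f = f and f' = f' and a = 0 and b = s])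
  show "finite (S \<inter> {0..s})" using assms(1) unfolding locally_finite_times_def by blast
  show "continuous_on {0..s} f" using assms(2) by (rule continuous_on_subset) auto
qed (use assms in auto)

end

section \<open>The planar quotient system\<close>

text \<open>For \<open>b = 0\<close> the rotations \<open>(t, z) \<mapsto> (t + s, e\<^bsup>\<i>s\<^esup> z)\<close> map solutions to solutions.\<close>

locale rotating_system = turning_system a 0 sm sp for a sm sp
begin

text \<open>The invariant of the rotations. Together with the angle it is a coordinate system, with inverse
\<open>lift\<close>, and along solutions \<open>W' = (a - \<i>w) W + 1\<close>.\<close>

definition W :: "real \<times> complex \<Rightarrow> complex" where
  "W p = cis (- fst p) * snd p"

definition lift :: "real \<Rightarrow> complex \<Rightarrow> real \<times> complex" where
  "lift t v = (t, cis t * v)"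

lemma W_lift [simp]: "W (lift t v) = v"
  by (simp add: W_def lift_def mult.assoc[symmetric] cis_mult)

lemma lift_W [simp]: "lift (fst p) (W p) = p"
  by (cases p) (simp add: W_def lift_def mult.assoc[symmetric] cis_mult)

lemma fst_lift [simp]: "fst (lift t v) = t"
  by (simp add: lift_def)

lemma norm_W [simp]: "norm (W p) = norm (snd p)"
  by (simp add: W_def norm_mult)

lemma continuous_on_W: "continuous_on A W"
  unfolding W_def [abs_def] by (intro continuous_intros)

lemma continuous_on_lift: "continuous_on A (lift t)"
  unfolding lift_def [abs_def] by (intro continuous_intros)

lemma run_rotate:
  assumes "run w c" shows "run w (\<lambda>s. (fst (c s) + t, cis t * snd (c s)))"
proof -
  obtain S where S: "locally_finite_times S" "constant_between S w"
    "\<And>s. 0 < s \<Longrightarrow> s \<notin> S \<Longrightarrow> (c has_vector_derivative velocity (w s) (c s)) (at s)"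
    and w: "\<And>s. 0 \<le> s \<Longrightarrow> w s \<in> {sm..sp}" and c: "continuous_on {0..} c"
    using assms(1) unfolding run_def by blast
  show ?thesis
  proof (rule runI[OF w _ S(1,2)])
    fix s :: real assume "0 < s" "s \<notin> S"
    from S(3)[OF this] have d: "(c has_vector_derivative velocity (w s) (c s)) (at s)" .
    have 1: "((\<lambda>s. fst (c s)) has_vector_derivative w s) (at s)"
      using bounded_linear.has_vector_derivative[OF bounded_linear_fst d] by (simp add: velocity_def)
    have 2: "((\<lambda>s. snd (c s)) has_vector_derivative a * snd (c s) + cis (fst (c s))) (at s)"
      using bounded_linear.has_vector_derivative[OF bounded_linear_snd d] by (simp add: velocity_def)
    have 3: "((\<lambda>s. cis t * snd (c s)) has_vector_derivative cis t * (a * snd (c s) + cis (fst (c s)))) (at s)"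
      by (rule has_vector_derivative_mult_right[OF 2])
    have 4: "((\<lambda>s. fst (c s) + t) has_vector_derivative w s) (at s)"
      using has_vector_derivative_add[OF 1 has_vector_derivative_const, of t] by simp
    show "((\<lambda>s. (fst (c s) + t, cis t * snd (c s))) has_vector_derivative
        velocity (w s) (fst (c s) + t, cis t * snd (c s))) (at s)"
      using has_vector_derivative_Pair[OF 4 3]
      by (simp add: velocity_def algebra_simps cis_mult)
  qed (use c in \<open>auto intro!: continuous_intros\<close>)
qed

text \<open>Which values of \<open>W\<close> are reached, and by which change of the angle, depends on the initial value of
\<open>W\<close> only.\<close>

lemma reach_rotate:
  assumes "reach s p p'" "W p0 = W p"
  shows "reach s p0 (lift (fst p' + (fst p0 - fst p)) (W p'))"
proof -
  obtain w c where c: "run w c" "c 0 = p" "c s = p'" "0 \<le> s"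
    using assms(1) unfolding reach_def by blast
  let ?t = "fst p0 - fst p"
  let ?c = "\<lambda>s. (fst (c s) + ?t, cis ?t * snd (c s))"
  have *: "(fst x + ?t, cis ?t * snd x) = lift (fst x + ?t) (W x)" for x
    by (simp add: lift_def W_def mult.assoc[symmetric] cis_mult)
  have "?c 0 = lift (fst p0) (W p0)" using c(2) *[of p] assms(2) by simp
  then have "?c 0 = p0" by simp
  then show ?thesis
    using reachI[OF run_rotate[OF c(1), of ?t] c(4)] c(3) by (simp add: *)
qed

text \<open>Reachability in the plane of the invariant \<open>W\<close>, with the angle ignored.\<close>

definition wreach :: "complex \<Rightarrow> complex \<Rightarrow> bool" where
  "wreach v v' \<longleftrightarrow> (\<exists>s p p'. reach s p p' \<and> W p = v \<and> W p' = v')"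

lemma wreachI: "reach s p p' \<Longrightarrow> wreach (W p) (W p')"
  unfolding wreach_def by blast

lemma wreachD:
  assumes "wreach v v'"
  obtains s r where "\<And>t. reach s (lift t v) (lift (t + r) v')"
proof -
  obtain s p p' where p: "reach s p p'" "W p = v" "W p' = v'"
    using assms unfolding wreach_def by blast
  have "reach s (lift t v) (lift (t + (fst p' - fst p)) v')" for t
    using reach_rotate[OF p(1), of "lift t v"] p(2,3) by (simp add: algebra_simps)
  then show thesis by (rule that)
qed

lemma wreach_trans: "wreach u v \<Longrightarrow> wreach v x \<Longrightarrow> wreach u x"
  by (metis wreachD wreachI reach_trans W_lift)

text \<open>The zero of the planar field \<open>(a - \<i>w) W + 1\<close>.\<close>

definition equilibrium :: "real \<Rightarrow> complex" where
  "equilibrium w = - 1 / (a - \<i> * of_real w)"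

lemma run_constant_control:
  assumes w: "w \<in> {sm..sp}" and nz: "a \<noteq> \<i> * of_real w"
  shows "run (\<lambda>_. w) (\<lambda>s. lift (t + w * s)
    (equilibrium w + exp ((a - \<i> * of_real w) * of_real s) * (v - equilibrium w)))"
proof (rule run_constI[OF w])
  fix s :: real
  define \<beta> where "\<beta> = a - \<i> * of_real w"
  define m where "m = equilibrium w"
  have bm: "\<beta> * m = - 1" using nz by (simp add: m_def \<beta>_def equilibrium_def)
  have "((\<lambda>z. exp (\<i> * (of_real t + of_real w * z)) * (m + exp (\<beta> * z) * (v - m))) has_field_derivative
     exp (\<i> * (of_real t + of_real w * of_real s)) *
     (\<i> * of_real w * (m + exp (\<beta> * of_real s) * (v - m)) + \<beta> * exp (\<beta> * of_real s) * (v - m)))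
     (at (of_real s))"
    by (auto intro!: derivative_eq_intros simp: algebra_simps)
  from has_vector_derivative_real_field[OF this]
  have "((\<lambda>s. cis (t + w * s) * (m + exp (\<beta> * of_real s) * (v - m))) has_vector_derivative
     cis (t + w * s) *
     (\<i> * of_real w * (m + exp (\<beta> * of_real s) * (v - m)) + \<beta> * exp (\<beta> * of_real s) * (v - m))) (at s)"
    by (simp add: cis_conv_exp)
  also have "cis (t + w * s) *
     (\<i> * of_real w * (m + exp (\<beta> * of_real s) * (v - m)) + \<beta> * exp (\<beta> * of_real s) * (v - m))
     = cis (t + w * s) * ((\<beta> + \<i> * of_real w) * (m + exp (\<beta> * of_real s) * (v - m)) - \<beta> * m)"
    by (simp add: algebra_simps)
  also have "\<dots> = a * (cis (t + w * s) * (m + exp (\<beta> * of_real s) * (v - m))) + cis (t + w * s)"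
    unfolding bm by (simp add: \<beta>_def algebra_simps)
  finally have 2: "((\<lambda>s. cis (t + w * s) * (m + exp (\<beta> * of_real s) * (v - m))) has_vector_derivative
     a * (cis (t + w * s) * (m + exp (\<beta> * of_real s) * (v - m))) + cis (t + w * s)) (at s)" .
  have 1: "((\<lambda>s. t + w * s) has_vector_derivative w) (at s)"
    by (auto intro!: derivative_eq_intros)
  show "((\<lambda>s. lift (t + w * s) (equilibrium w + exp ((a - \<i> * of_real w) * of_real s) * (v - equilibrium w)))
     has_vector_derivative velocity w (lift (t + w * s)
       (equilibrium w + exp ((a - \<i> * of_real w) * of_real s) * (v - equilibrium w)))) (at s)"
    using has_vector_derivative_Pair[OF 1 2] unfolding lift_def velocity_def m_def \<beta>_def by simp
qed

lemma wreach_constant_control: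
  assumes "w \<in> {sm..sp}" "a \<noteq> \<i> * of_real w" "0 \<le> s"
  shows "wreach v (equilibrium w + exp ((a - \<i> * of_real w) * of_real s) * (v - equilibrium w))"
  using wreachI[OF reachI[OF run_constant_control[OF assms(1,2), of 0 v] assms(3)]] by simp

lemma wreach_constant_control_backward:
  assumes "w \<in> {sm..sp}" "a \<noteq> \<i> * of_real w" "0 \<le> s"
  shows "wreach (equilibrium w + exp (- ((a - \<i> * of_real w) * of_real s)) * (v - equilibrium w)) v"
  using wreach_constant_control[OF assms, of
      "equilibrium w + exp (- ((a - \<i> * of_real w) * of_real s)) * (v - equilibrium w)"]
  by (simp add: mult.assoc[symmetric] exp_add[symmetric])

lemma run_at_equilibrium:
  assumes "w \<in> {sm..sp}" "a \<noteq> \<i> * of_real w"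
  shows "run (\<lambda>_. w) (\<lambda>s. lift (t + w * s) (equilibrium w))"
  using run_constant_control[OF assms, of t "equilibrium w"] by simp

lemma wreach_refl: "wreach v v"
proof -
  have "run (\<lambda>_. w) c \<Longrightarrow> reach 0 (c 0) (c 0)" for w c by (rule reachI) auto
  obtain w where w: "w \<in> {sm..sp}" "a \<noteq> \<i> * of_real w"
  proof (cases "a = 0")
    case True
    show thesis by (rule that[of sp]) (use True sm sp in auto)
  next
    case False
    show thesis by (rule that[of 0]) (use False sm sp in auto)
  qed
  from wreach_constant_control[OF this, of 0 v] show ?thesis by simp
qed

text \<open>At an equilibrium with \<open>w \<noteq> 0\<close> the angle turns at constant speed while \<open>W\<close> rests. Waiting there long
enough produces any angle modulo \<open>2\<pi>\<close>, so a connection in the \<open>W\<close>-plane through that equilibrium lifts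
to a connection of arbitrary points.\<close>

lemma reach_any_angle:
  assumes "wreach (W p) (equilibrium w)" "wreach (equilibrium w) (W p')"
    and w: "w \<in> {sm..sp}" "a \<noteq> \<i> * of_real w" "w \<noteq> 0"
  obtains s and k :: int where "reach s p (fst p' + 2 * pi * of_int k, snd p')"
proof -
  obtain s1 r1 where 1: "\<And>t. reach s1 (lift t (W p)) (lift (t + r1) (equilibrium w))"
    using wreachD[OF assms(1)] by blast
  obtain s2 r2 where 2: "\<And>t. reach s2 (lift t (equilibrium w)) (lift (t + r2) (W p'))"
    using wreachD[OF assms(2)] by blast
  \<comment> \<open>the angle that the two connections leave to be made up for\<close>
  define gap where "gap = fst p' - fst p - r1 - r2"
  obtain k :: int where k: "0 \<le> (gap + 2 * pi * of_int k) / w"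
  proof (cases "0 < w")
    case True
    show thesis
    proof (rule that[of "\<lceil>- gap / (2 * pi)\<rceil>"])
      have "2 * pi * (- gap / (2 * pi)) \<le> 2 * pi * of_int \<lceil>- gap / (2 * pi)\<rceil>"
        by (intro mult_left_mono le_of_int_ceiling) simp
      then have "0 \<le> gap + 2 * pi * of_int \<lceil>- gap / (2 * pi)\<rceil>" by simp
      then show "0 \<le> (gap + 2 * pi * of_int \<lceil>- gap / (2 * pi)\<rceil>) / w" using True by simp
    qed
  next
    case False
    show thesis
    proof (rule that[of "\<lfloor>- gap / (2 * pi)\<rfloor>"])
      have "2 * pi * of_int \<lfloor>- gap / (2 * pi)\<rfloor> \<le> 2 * pi * (- gap / (2 * pi))"
        by (intro mult_left_mono of_int_floor_le) simp
      then have "gap + 2 * pi * of_int \<lfloor>- gap / (2 * pi)\<rfloor> \<le> 0" by simp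
      then show "0 \<le> (gap + 2 * pi * of_int \<lfloor>- gap / (2 * pi)\<rfloor>) / w"
        using False by (simp add: divide_nonpos_nonpos)
    qed
  qed
  define s where "s = (gap + 2 * pi * of_int k) / w"
  have m: "reach s (lift t (equilibrium w)) (lift (t + w * s) (equilibrium w))" for t
    using reachI[OF run_at_equilibrium[OF w(1,2)], of s t] k by (simp add: s_def)
  have "reach (s1 + s + s2) (lift (fst p) (W p)) (lift (fst p + r1 + w * s + r2) (W p'))"
    by (rule reach_trans[OF reach_trans[OF 1 m] 2])
  moreover have "fst p + r1 + w * s + r2 = fst p' + 2 * pi * of_int k"
    using w(3) by (simp add: s_def gap_def)
  moreover have "lift (fst p' + 2 * pi * of_int k) (W p') = (fst p' + 2 * pi * of_int k, snd p')"
    using lift_W[of p'] unfolding lift_def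
    by (metis cis_multiple_2pi cis_mult mult.right_neutral prod.sel(2) Ints_of_int)
  ultimately show thesis using that by simp
qed

text \<open>The quantity \<open>Re (e e\<^bsup>-as\<^esup> z) + e\<^bsup>-\<lambda>s\<^esup>/\<lambda>\<close> with \<open>\<lambda> = Re a\<close> and \<open>|e| = 1\<close> decreases, because its
derivative is \<open>Re (e e\<^bsup>-as\<^esup> e\<^bsup>\<i>t\<^esup>) - e\<^bsup>-\<lambda>s\<^esup>\<close>. All bounds on solutions, upper and lower, come from this
one by the choice of \<open>e\<close>.\<close>

lemma run_bound:
  assumes "run w c" "0 \<le> s" "norm e = 1" "Re a \<noteq> 0"
  shows "Re (e * exp (- a * of_real s) * snd (c s))
    \<le> Re (e * snd (c 0)) + (1 - exp (- Re a * s)) / Re a"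
proof -
  obtain S where S: "locally_finite_times S" 
    "continuous_on {0..} (\<lambda>s. snd (c s))"
    "\<And>s. 0 < s \<Longrightarrow> s \<notin> S \<Longrightarrow> ((\<lambda>s. snd (c s)) has_vector_derivative
        (a * snd (c s) + cis (fst (c s)))) (at s)"
    using run_components[OF assms(1)] by (metis add.right_neutral)
  let ?f = "\<lambda>r. Re (e * exp (- a * of_real r) * snd (c r)) + exp (- Re a * r) / Re a"
  let ?f' = "\<lambda>r. Re (e * exp (- a * of_real r) * cis (fst (c r))) - exp (- Re a * r)"
  have "?f s \<le> ?f 0"
  proof (rule antimono_along_run[OF S(1) _ assms(2), where f' = ?f'])
    show "continuous_on {0..} ?f" using S(2) assms(4) by (auto intro!: continuous_intros)
    fix r :: real assume r: "0 < r" "r \<notin> S"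
    have E: "((\<lambda>r. e * exp (- a * of_real r)) has_vector_derivative - a * (e * exp (- a * of_real r))) (at r)"
    proof -
      have "((\<lambda>z. e * exp (- a * z)) has_field_derivative - a * (e * exp (- a * of_real r))) (at (of_real r))"
        by (auto intro!: derivative_eq_intros)
      from has_vector_derivative_real_field[OF this] show ?thesis by simp
    qed
    have "((\<lambda>r. e * exp (- a * of_real r) * snd (c r)) has_vector_derivative
        e * exp (- a * of_real r) * cis (fst (c r))) (at r)"
      using has_vector_derivative_mult[OF E S(3)[OF r]] by (simp add: algebra_simps)
    then have 1: "((\<lambda>r. Re (e * exp (- a * of_real r) * snd (c r))) has_real_derivative
        Re (e * exp (- a * of_real r) * cis (fst (c r)))) (at r)"
      unfolding has_real_derivative_iff_has_vector_derivative
      by (rule bounded_linear.has_vector_derivative[OF bounded_linear_Re])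
    have 2: "((\<lambda>r. exp (- Re a * r) / Re a) has_real_derivative - exp (- Re a * r)) (at r)"
      using assms(4) by (auto intro!: derivative_eq_intros)
    show "(?f has_real_derivative ?f' r) (at r)"
      using DERIV_add[OF 1 2] by simp
    have "Re (e * exp (- a * of_real r) * cis (fst (c r))) \<le> norm (e * exp (- a * of_real r) * cis (fst (c r)))"
      by (rule complex_Re_le_cmod)
    then show "?f' r \<le> 0" using assms(3) by (simp add: norm_mult)
  qed
  then show ?thesis using assms(4) by (simp add: diff_divide_distrib)
qed

end

context rotating_system
begin

section \<open>Reachability near the equilibria and in the plane\<close>

text \<open>Neighbouring solutions with the same control separate at the exact rate \<open>e\<^bsup>\<lambda>s\<^esup>\<close>, \<open>\<lambda> = Re a\<close>. The value
may be prescribed at any time \<open>r\<^sub>0\<close>, so this also shows that points can be steered backwards.\<close>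

lemma run_neighbour:
  assumes "run w c"
  obtains c' where "run w c'" "W (c' r\<^sub>0) = v"
    "\<And>r. norm (W (c' r) - W (c r)) = exp (Re a * (r - r\<^sub>0)) * norm (v - W (c r\<^sub>0))"
proof -
  define d where "d = exp (- a * of_real r\<^sub>0) * cis (fst (c r\<^sub>0)) * (v - W (c r\<^sub>0))"
  let ?c = "\<lambda>s. c s + (0, exp (a * of_real s) * d)"
  have diff: "W (?c r) - W (c r) = cis (- fst (c r)) * exp (a * of_real r) * d" for r
    by (simp add: W_def algebra_simps)
  show thesis
  proof (rule that[OF run_shift[OF assms, of d]])
    have "W (?c r\<^sub>0) - W (c r\<^sub>0) = (cis (- fst (c r\<^sub>0)) * cis (fst (c r\<^sub>0))) *
        (exp (a * of_real r\<^sub>0) * exp (- a * of_real r\<^sub>0)) * (v - W (c r\<^sub>0))"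
      unfolding diff by (simp add: d_def)
    also have "\<dots> = v - W (c r\<^sub>0)" by (simp add: cis_mult exp_add[symmetric])
    finally show "W (?c r\<^sub>0) = v" by simp
    show "norm (W (?c r) - W (c r)) = exp (Re a * (r - r\<^sub>0)) * norm (v - W (c r\<^sub>0))" for r
    proof -
      have "exp (Re a * (r - r\<^sub>0)) = exp (Re a * r) * exp (- (Re a * r\<^sub>0))"
        by (simp add: exp_add[symmetric] right_diff_distrib)
      then show ?thesis unfolding diff by (simp add: d_def norm_mult)
    qed
  qed
qed

text \<open>The endpoint after two constant controls \<open>w + e\<^sub>1\<close>, \<open>w + e\<^sub>2\<close>, each of duration \<open>\<tau>\<close>, has at
\<open>e\<^sub>1 = e\<^sub>2 = 0\<close> the derivative \<open>g (\<rho> e\<^sub>1 + e\<^sub>2)\<close> with \<open>\<rho> = e\<^bsup>(a - \<i>w)\<tau>\<^esup>\<close> and \<open>g \<noteq> 0\<close>. If \<open>\<rho>\<close> is purely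
imaginary and not zero, this is onto, and the open mapping theorem applies. Negative \<open>\<tau>\<close> is allowed and
describes motion backwards in time.\<close>

lemma equilibrium_interior_two_steps:
  fixes \<tau> :: real
  assumes w: "sm < w" "w < sp" "w \<noteq> Im a"
    and "exp ((a - \<i> * of_real w) * of_real \<tau>) = \<i> * of_real r" "r \<noteq> 0"
  obtains U where "equilibrium w \<in> interior U"
    "\<And>x. x \<in> U \<Longrightarrow> \<exists>w1 w2 y. w1 \<in> {sm..sp} \<and> w2 \<in> {sm..sp} \<and> a \<noteq> \<i> * of_real w1 \<and> a \<noteq> \<i> * of_real w2 \<and>
       y = equilibrium w1 + exp ((a - \<i> * of_real w1) * of_real \<tau>) * (equilibrium w - equilibrium w1) \<and>
       x = equilibrium w2 + exp ((a - \<i> * of_real w2) * of_real \<tau>) * (y - equilibrium w2)"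
proof -
  define \<beta> where "\<beta> = a - \<i> * of_real w"
  \<comment> \<open>for smaller changes the speed stays admissible and off the resonance\<close>
  define \<delta> where "\<delta> = min (\<bar>Im a - w\<bar>) (min (w - sm) (sp - w))"
  have \<delta>: "0 < \<delta>" using w by (simp add: \<delta>_def)
  define m where "m e = equilibrium (w + e)" for e
  define E where "E e = exp ((a - \<i> * of_real (w + e)) * of_real \<tau>)" for e
  define D where "D = - \<i> / \<beta>\<^sup>2"
  define f where "f p = m (snd p) + E (snd p) * (m (fst p) + E (fst p) * (m 0 - m (fst p)) - m (snd p))"
    for p :: "real \<times> real"
  define T where "T = {- \<delta><..<\<delta>} \<times> {- \<delta><..<\<delta>}"
  have e: "w + e \<in> {sm..sp}" "a \<noteq> \<i> * of_real (w + e)" if "e \<in> {- \<delta><..<\<delta>}" for e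
  proof -
    have "\<bar>e\<bar> < \<bar>Im a - w\<bar>" "\<bar>e\<bar> < w - sm" "\<bar>e\<bar> < sp - w" using that by (auto simp: \<delta>_def)
    then show "w + e \<in> {sm..sp}" "a \<noteq> \<i> * of_real (w + e)" by (auto simp: complex_eq_iff)
  qed
  have \<beta>0: "\<beta> \<noteq> 0" using w by (auto simp: \<beta>_def complex_eq_iff)
  have m0: "(m has_vector_derivative D) (at 0)"
  proof -
    have "((\<lambda>z. - 1 / (a - \<i> * (of_real w + z))) has_field_derivative (- \<i> / \<beta>\<^sup>2)) (at (of_real 0))"
      using \<beta>0 by (auto simp: \<beta>_def power2_eq_square intro!: derivative_eq_intros)
    from has_vector_derivative_real_field[OF this] show ?thesis
      by (simp add: m_def[abs_def] equilibrium_def D_def)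
  qed
  have E0: "(E has_vector_derivative (- \<i> * of_real \<tau> * E 0)) (at 0)"
  proof -
    have "((\<lambda>z. exp ((a - \<i> * (of_real w + z)) * of_real \<tau>)) has_field_derivative (- \<i> * of_real \<tau> * E 0)) (at (of_real 0))"
      by (auto simp: E_def intro!: derivative_eq_intros)
    from has_vector_derivative_real_field[OF this] show ?thesis
      by (simp add: E_def[abs_def])
  qed
  have EE: "E 0 = \<i> * of_real r" using assms(4) by (simp add: E_def)
  define g where "g = D * (1 - E 0)"
  have "1 - E 0 \<noteq> 0" by (simp add: EE complex_eq_iff)
  then have g0: "g \<noteq> 0" using \<beta>0 by (simp add: g_def D_def)
  have der: "(f has_derivative (\<lambda>h. g * (\<i> * of_real r * of_real (fst h) + of_real (snd h)))) (at (0, 0))"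
  proof -
    have m1: "((\<lambda>p. m (fst p)) has_derivative (\<lambda>h. fst h *\<^sub>R D)) (at (0::real, 0::real))"
      using has_derivative_compose[OF has_derivative_fst[OF has_derivative_ident], of m _ "(0,0)" UNIV]
        m0 unfolding has_vector_derivative_def by simp
    have m2: "((\<lambda>p. m (snd p)) has_derivative (\<lambda>h. snd h *\<^sub>R D)) (at (0::real, 0::real))"
      using has_derivative_compose[OF has_derivative_snd[OF has_derivative_ident], of m _ "(0,0)" UNIV]
        m0 unfolding has_vector_derivative_def by simp
    have E1: "((\<lambda>p. E (fst p)) has_derivative (\<lambda>h. fst h *\<^sub>R (- \<i> * of_real \<tau> * E 0))) (at (0::real, 0::real))"
      using has_derivative_compose[OF has_derivative_fst[OF has_derivative_ident], of E _ "(0,0)" UNIV]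
        E0 unfolding has_vector_derivative_def by simp
    have E2: "((\<lambda>p. E (snd p)) has_derivative (\<lambda>h. snd h *\<^sub>R (- \<i> * of_real \<tau> * E 0))) (at (0::real, 0::real))"
      using has_derivative_compose[OF has_derivative_snd[OF has_derivative_ident], of E _ "(0,0)" UNIV]
        E0 unfolding has_vector_derivative_def by simp
    show ?thesis
      unfolding f_def[abs_def]
      by (rule has_derivative_eq_rhs, (rule m1 m2 E1 E2 derivative_intros)+)
         (rule ext, simp add: g_def EE scaleR_conv_of_real algebra_simps)
  qed
  have bl: "bounded_linear (\<lambda>y::complex. (Im (y / g) / r, Re (y / g)))"
    by (intro bounded_linear_Pair bounded_linear_compose[OF bounded_linear_divide]
        bounded_linear_compose[OF bounded_linear_Im] bounded_linear_compose[OF bounded_linear_Re]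
        bounded_linear_ident)
  have cont: "continuous_on T f"
  proof -
    have M: "continuous_on {- \<delta><..<\<delta>} m"
      unfolding m_def equilibrium_def using e(2) by (intro continuous_intros) (auto simp: algebra_simps)
    have E: "continuous_on {- \<delta><..<\<delta>} E"
      unfolding E_def by (intro continuous_intros)
    have "continuous_on T fst" "continuous_on T snd"
      "fst ` T \<subseteq> {- \<delta><..<\<delta>}" "snd ` T \<subseteq> {- \<delta><..<\<delta>}"
      by (auto simp: T_def intro!: continuous_on_fst continuous_on_snd continuous_on_id)
    then have "continuous_on T (\<lambda>p. m (fst p))" "continuous_on T (\<lambda>p. m (snd p))"
      "continuous_on T (\<lambda>p. E (fst p))" "continuous_on T (\<lambda>p. E (snd p))"
      by (blast intro: continuous_on_compose2[OF M] continuous_on_compose2[OF E])+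
    then show ?thesis unfolding f_def by (intro continuous_intros)
  qed
  have "f (0, 0) \<in> interior (f ` T)"
  proof (rule sussmann_open_mapping[OF _ cont _ der bl])
    show "open T" unfolding T_def by (intro open_Times open_greaterThanLessThan)
    then show "(0, 0) \<in> interior T" using \<delta> by (simp add: interior_open) (simp add: T_def)
    show "(0, 0) \<in> T" using \<delta> by (simp add: T_def)
    show "(\<lambda>h. g * (\<i> * of_real r * of_real (fst h) + of_real (snd h))) \<circ> (\<lambda>y. (Im (y / g) / r, Re (y / g))) = id"
    proof
      fix y
      have "\<i> * of_real (Im (y / g)) + of_real (Re (y / g)) = y / g" by (simp add: complex_eq_iff)
      then show "((\<lambda>h. g * (\<i> * of_real r * of_real (fst h) + of_real (snd h))) \<circ> (\<lambda>y. (Im (y / g) / r, Re (y / g)))) y = id y"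
        using assms(5) g0 by simp
    qed
  qed auto
  then have 1: "equilibrium w \<in> interior (f ` T)" by (simp add: f_def m_def)
  show thesis
  proof (rule that[OF 1])
    fix x assume "x \<in> f ` T"
    then obtain e1 e2 where x: "e1 \<in> {- \<delta><..<\<delta>}" "e2 \<in> {- \<delta><..<\<delta>}" "x = f (e1, e2)"
      unfolding T_def by auto
    show "\<exists>w1 w2 y. w1 \<in> {sm..sp} \<and> w2 \<in> {sm..sp} \<and> a \<noteq> \<i> * of_real w1 \<and> a \<noteq> \<i> * of_real w2 \<and>
       y = equilibrium w1 + exp ((a - \<i> * of_real w1) * of_real \<tau>) * (equilibrium w - equilibrium w1) \<and>
       x = equilibrium w2 + exp ((a - \<i> * of_real w2) * of_real \<tau>) * (y - equilibrium w2)"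
      by (rule exI[of _ "w + e1"], rule exI[of _ "w + e2"])
        (use e[OF x(1)] e[OF x(2)] in \<open>simp add: x(3) f_def m_def E_def\<close>)
  qed
qed

text \<open>Off resonance, that is for \<open>w \<noteq> Im a\<close>, the linear part turns by a right angle in finite time.\<close>

lemma quarter_turn:
  assumes "w \<noteq> Im a"
  defines "\<tau> \<equiv> pi / (2 * \<bar>Im a - w\<bar>)"
  shows "0 \<le> \<tau>" "\<exists>r. r \<noteq> 0 \<and> exp ((a - \<i> * of_real w) * of_real \<tau>) = \<i> * of_real r"
    "\<exists>r. r \<noteq> 0 \<and> exp ((a - \<i> * of_real w) * of_real (- \<tau>)) = \<i> * of_real r"
proof -
  have i: "(Im a - w) * \<tau> = sgn (Im a - w) * (pi / 2)"
    using assms(1) by (simp add: \<tau>_def sgn_if field_simps)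
  have ex: "exp ((a - \<i> * of_real w) * of_real x) = of_real (exp (Re a * x)) * cis ((Im a - w) * x)" for x
  proof -
    have "(a - \<i> * of_real w) * of_real x = of_real (Re a * x) + \<i> * of_real ((Im a - w) * x)"
      by (simp add: complex_eq_iff)
    then show ?thesis by (simp only: exp_add cis_conv_exp exp_of_real)
  qed
  show "0 \<le> \<tau>" by (simp add: \<tau>_def)
  have "cis (sgn (Im a - w) * (pi / 2)) = \<i> * of_real (sgn (Im a - w))"
    "cis (- (sgn (Im a - w) * (pi / 2))) = \<i> * of_real (- sgn (Im a - w))"
    using assms(1) by (auto simp: sgn_if complex_eq_iff)
  then have 1: "exp ((a - \<i> * of_real w) * of_real \<tau>) = \<i> * of_real (exp (Re a * \<tau>) * sgn (Im a - w))"
    "exp ((a - \<i> * of_real w) * of_real (- \<tau>)) = \<i> * of_real (exp (Re a * - \<tau>) * - sgn (Im a - w))"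
    unfolding ex by (simp_all add: i)
  have s: "sgn (Im a - w) \<noteq> 0" using assms(1) by (simp add: sgn_if)
  show "\<exists>r. r \<noteq> 0 \<and> exp ((a - \<i> * of_real w) * of_real \<tau>) = \<i> * of_real r"
    by (rule exI[of _ "exp (Re a * \<tau>) * sgn (Im a - w)"], intro conjI 1(1)) (use s in simp)
  show "\<exists>r. r \<noteq> 0 \<and> exp ((a - \<i> * of_real w) * of_real (- \<tau>)) = \<i> * of_real r"
    by (rule exI[of _ "exp (Re a * - \<tau>) * - sgn (Im a - w)"], intro conjI 1(2)) (use s in simp)
qed

lemma equilibrium_interior_forward:
  assumes w: "sm < w" "w < sp" "w \<noteq> Im a"
  shows "equilibrium w \<in> interior {v. wreach (equilibrium w) v}"
proof -
  define \<tau> where "\<tau> = pi / (2 * \<bar>Im a - w\<bar>)"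
  have \<tau>: "0 \<le> \<tau>" and "\<exists>r. r \<noteq> 0 \<and> exp ((a - \<i> * of_real w) * of_real \<tau>) = \<i> * of_real r"
    unfolding \<tau>_def using quarter_turn[OF w(3)] by blast+
  then obtain r where r: "exp ((a - \<i> * of_real w) * of_real \<tau>) = \<i> * of_real r" "r \<noteq> 0" by blast
  from equilibrium_interior_two_steps[OF w r] obtain U where U: "equilibrium w \<in> interior U"
    "\<And>x. x \<in> U \<Longrightarrow> \<exists>w1 w2 y. w1 \<in> {sm..sp} \<and> w2 \<in> {sm..sp} \<and> a \<noteq> \<i> * of_real w1 \<and> a \<noteq> \<i> * of_real w2 \<and>
       y = equilibrium w1 + exp ((a - \<i> * of_real w1) * of_real \<tau>) * (equilibrium w - equilibrium w1) \<and>
       x = equilibrium w2 + exp ((a - \<i> * of_real w2) * of_real \<tau>) * (y - equilibrium w2)" by blast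
  have "U \<subseteq> {v. wreach (equilibrium w) v}"
  proof
    fix x assume "x \<in> U"
    then obtain w1 w2 y where *: "w1 \<in> {sm..sp}" "w2 \<in> {sm..sp}" "a \<noteq> \<i> * of_real w1" "a \<noteq> \<i> * of_real w2"
       "y = equilibrium w1 + exp ((a - \<i> * of_real w1) * of_real \<tau>) * (equilibrium w - equilibrium w1)"
       "x = equilibrium w2 + exp ((a - \<i> * of_real w2) * of_real \<tau>) * (y - equilibrium w2)"
      using U(2) by blast
    have "wreach (equilibrium w) y" unfolding *(5) by (rule wreach_constant_control[OF *(1,3) \<tau>])
    moreover have "wreach y x" unfolding *(6) by (rule wreach_constant_control[OF *(2,4) \<tau>])
    ultimately show "x \<in> {v. wreach (equilibrium w) v}" using wreach_trans by blast
  qed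
  then show ?thesis using U(1) interior_mono by blast
qed

lemma equilibrium_interior_backward:
  assumes w: "sm < w" "w < sp" "w \<noteq> Im a"
  shows "equilibrium w \<in> interior {v. wreach v (equilibrium w)}"
proof -
  define \<tau> where "\<tau> = pi / (2 * \<bar>Im a - w\<bar>)"
  have \<tau>: "0 \<le> \<tau>" and "\<exists>r. r \<noteq> 0 \<and> exp ((a - \<i> * of_real w) * of_real (- \<tau>)) = \<i> * of_real r"
    unfolding \<tau>_def using quarter_turn[OF w(3)] by blast+
  then obtain r where r: "exp ((a - \<i> * of_real w) * of_real (- \<tau>)) = \<i> * of_real r" "r \<noteq> 0" by blast
  from equilibrium_interior_two_steps[OF w r] obtain U where U: "equilibrium w \<in> interior U"
    "\<And>x. x \<in> U \<Longrightarrow> \<exists>w1 w2 y. w1 \<in> {sm..sp} \<and> w2 \<in> {sm..sp} \<and> a \<noteq> \<i> * of_real w1 \<and> a \<noteq> \<i> * of_real w2 \<and>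
       y = equilibrium w1 + exp ((a - \<i> * of_real w1) * of_real (- \<tau>)) * (equilibrium w - equilibrium w1) \<and>
       x = equilibrium w2 + exp ((a - \<i> * of_real w2) * of_real (- \<tau>)) * (y - equilibrium w2)" by blast
  have "U \<subseteq> {v. wreach v (equilibrium w)}"
  proof
    fix x assume "x \<in> U"
    then obtain w1 w2 y where *: "w1 \<in> {sm..sp}" "w2 \<in> {sm..sp}" "a \<noteq> \<i> * of_real w1" "a \<noteq> \<i> * of_real w2"
       "y = equilibrium w1 + exp ((a - \<i> * of_real w1) * of_real (- \<tau>)) * (equilibrium w - equilibrium w1)"
       "x = equilibrium w2 + exp ((a - \<i> * of_real w2) * of_real (- \<tau>)) * (y - equilibrium w2)"
      using U(2) by blast
    have "wreach y (equilibrium w)" unfolding *(5)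
      using wreach_constant_control_backward[OF *(1,3) \<tau>] by simp
    moreover have "wreach x y" unfolding *(6)
      using wreach_constant_control_backward[OF *(2,4) \<tau>] by simp
    ultimately show "x \<in> {v. wreach v (equilibrium w)}" using wreach_trans by blast
  qed
  then show ?thesis using U(1) interior_mono by blast
qed

lemma exp_decay:
  assumes "Re b < 0"
  shows "((\<lambda>s::real. m + exp (b * of_real s) * (v - m)) \<longlongrightarrow> m) at_top"
proof -
  have "((\<lambda>s::real. exp (Re b * s)) \<longlongrightarrow> 0) at_top"
    using assms by (intro filterlim_compose[OF exp_at_bot] filterlim_tendsto_neg_mult_at_bot[OF tendsto_const]
        filterlim_ident)
  then have "((\<lambda>s::real. exp (b * of_real s)) \<longlongrightarrow> 0) at_top"
    by (subst tendsto_norm_zero_iff[symmetric]) simp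
  then have "((\<lambda>s::real. m + exp (b * of_real s) * (v - m)) \<longlongrightarrow> m + 0 * (v - m)) at_top"
    by (intro tendsto_intros)
  then show ?thesis by simp
qed

text \<open>The spiral enters the neighbourhood of the equilibrium from which it can be hit exactly.\<close>

lemma wreach_equilibrium_if_contracting:
  assumes "Re a < 0" and w: "sm < w" "w < sp" "w \<noteq> Im a"
  shows "wreach v (equilibrium w)"
proof -
  have nz: "a \<noteq> \<i> * of_real w" using w(3) by (auto simp: complex_eq_iff)
  let ?f = "\<lambda>s::real. equilibrium w + exp ((a - \<i> * of_real w) * of_real s) * (v - equilibrium w)"
  have "(?f \<longlongrightarrow> equilibrium w) at_top" by (rule exp_decay) (use assms(1) in simp)
  then have "\<forall>\<^sub>F s in at_top. ?f s \<in> interior {v. wreach v (equilibrium w)}"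
    by (rule topological_tendstoD) (use equilibrium_interior_backward[OF w] in auto)
  then have "\<forall>\<^sub>F s in at_top. ?f s \<in> interior {v. wreach v (equilibrium w)} \<and> s \<ge> 0"
    by (intro eventually_conj eventually_ge_at_top)
  then obtain s where "?f s \<in> interior {v. wreach v (equilibrium w)}" "s \<ge> 0"
    by (auto simp: eventually_at_top_linorder)
  then have "wreach (?f s) (equilibrium w)" "s \<ge> 0" using interior_subset by auto
  with wreach_constant_control[OF _ nz, of s v] w show ?thesis using wreach_trans by auto
qed

text \<open>The same argument backwards in time.\<close>

lemma wreach_from_equilibrium_if_expanding:
  assumes "Re a > 0" and w: "sm < w" "w < sp" "w \<noteq> Im a"
  shows "wreach (equilibrium w) v"
proof -
  have nz: "a \<noteq> \<i> * of_real w" using w(3) by (auto simp: complex_eq_iff)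
  let ?f = "\<lambda>s::real. equilibrium w + exp (- (a - \<i> * of_real w) * of_real s) * (v - equilibrium w)"
  have "(?f \<longlongrightarrow> equilibrium w) at_top" by (rule exp_decay) (use assms(1) in simp)
  then have "\<forall>\<^sub>F s in at_top. ?f s \<in> interior {v. wreach (equilibrium w) v}"
    by (rule topological_tendstoD) (use equilibrium_interior_forward[OF w] in auto)
  then have "\<forall>\<^sub>F s in at_top. ?f s \<in> interior {v. wreach (equilibrium w) v} \<and> s \<ge> 0"
    by (intro eventually_conj eventually_ge_at_top)
  then obtain s where "?f s \<in> interior {v. wreach (equilibrium w) v}" "s \<ge> 0"
    by (auto simp: eventually_at_top_linorder)
  then have "wreach (equilibrium w) (?f s)" "s \<ge> 0" using interior_subset by auto
  with wreach_constant_control_backward[OF _ nz, of s v] w show ?thesis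
    using wreach_trans by (auto simp: algebra_simps)
qed

text \<open>Following the control of a point that reaches the equilibrium, its neighbours arrive in a
neighbourhood of the equilibrium, from where they can be steered to it.\<close>

lemma open_reaching_equilibrium:
  assumes w: "sm < w" "w < sp" "w \<noteq> Im a"
  shows "open {v. wreach v (equilibrium w)}"
  unfolding open_contains_ball
proof
  fix v assume "v \<in> {v. wreach v (equilibrium w)}"
  then obtain s p p' where *: "reach s p p'" "W p = v" "W p' = equilibrium w"
    unfolding wreach_def by blast
  then obtain u c where c: "run u c" "c 0 = p" "c s = p'" "0 \<le> s" unfolding reach_def by blast
  obtain e where e: "e > 0" "ball (equilibrium w) e \<subseteq> {v. wreach v (equilibrium w)}"
    using equilibrium_interior_backward[OF w] by (auto simp: mem_interior)
  let ?d = "exp (- (Re a * s)) * e"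
  show "\<exists>d>0. ball v d \<subseteq> {v. wreach v (equilibrium w)}"
  proof (intro exI[of _ ?d] conjI subsetI)
    fix x assume x: "x \<in> ball v ?d"
    obtain c' where c': "run u c'" "W (c' 0) = x"
      "\<And>r. norm (W (c' r) - W (c r)) = exp (Re a * (r - 0)) * norm (x - W (c 0))"
      using run_neighbour[OF c(1), of 0 x] by blast
    have "norm (W (c' s) - equilibrium w) = exp (Re a * s) * norm (x - v)"
      using c'(3)[of s] c *(2,3) by simp
    also have "\<dots> < exp (Re a * s) * ?d" using x by (simp add: dist_norm norm_minus_commute)
    also have "\<dots> = e" by (simp add: mult.assoc[symmetric] exp_add[symmetric])
    finally have "W (c' s) \<in> ball (equilibrium w) e" by (simp add: dist_norm norm_minus_commute)
    then have "wreach (W (c' s)) (equilibrium w)" using e(2) by blast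
    moreover have "wreach x (W (c' s))" using wreachI[OF reachI[OF c'(1) c(4)]] c'(2) by simp
    ultimately show "x \<in> {v. wreach v (equilibrium w)}" using wreach_trans by blast
  qed (use e(1) in auto)
qed

text \<open>For \<open>Re a = 0\<close> the solutions with constant control \<open>w\<close> run through circles about the equilibrium.\<close>

lemma wreach_on_circles:
  assumes "Re a = 0" "w \<in> {sm..sp}" "w \<noteq> Im a" "dist v (equilibrium w) = dist v' (equilibrium w)"
  shows "wreach v v'"
proof -
  define m where "m = equilibrium w"
  have nz: "a \<noteq> \<i> * of_real w" using assms(3) by (auto simp: complex_eq_iff)
  have a: "a - \<i> * of_real w = \<i> * of_real (Im a - w)" using assms(1) by (simp add: complex_eq_iff)
  obtain x where x: "v' - m = cis x * (v - m)"
  proof (cases "v = m")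
    case True then show thesis using that[of 0] assms(4) by (simp add: m_def)
  next
    case False
    have "norm (v' - m) = norm (v - m)"
      using assms(4) by (simp add: m_def dist_norm)
    moreover have "norm (v - m) \<noteq> 0" using False by simp
    ultimately have "norm ((v' - m) / (v - m)) = 1" by (simp only: norm_divide) simp
    then have "(v' - m) / (v - m) = cis (Arg ((v' - m) / (v - m)))"
      using rcis_cmod_Arg[of "(v' - m) / (v - m)"] by (simp add: rcis_def)
    then obtain x where "(v' - m) / (v - m) = cis x" by blast
    then show thesis using that[of x] False by (simp add: field_simps)
  qed
  define \<gamma> where "\<gamma> = Im a - w"
  have \<gamma>: "\<gamma> \<noteq> 0" using assms(3) by (simp add: \<gamma>_def)
  obtain k :: int where k: "0 \<le> (x + 2 * pi * of_int k) / \<gamma>"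
  proof (cases "0 < \<gamma>")
    case True
    have "2 * pi * (- x / (2 * pi)) \<le> 2 * pi * of_int \<lceil>- x / (2 * pi)\<rceil>"
      by (intro mult_left_mono le_of_int_ceiling) simp
    then show thesis using that[of "\<lceil>- x / (2 * pi)\<rceil>"] True by simp
  next
    case False
    have "2 * pi * of_int \<lfloor>- x / (2 * pi)\<rfloor> \<le> 2 * pi * (- x / (2 * pi))"
      by (intro mult_left_mono of_int_floor_le) simp
    then show thesis using that[of "\<lfloor>- x / (2 * pi)\<rfloor>"] False by (simp add: divide_nonpos_nonpos)
  qed
  define s where "s = (x + 2 * pi * of_int k) / \<gamma>"
  have "exp ((a - \<i> * of_real w) * of_real s) = cis (\<gamma> * s)"
    unfolding a cis_conv_exp by (simp add: \<gamma>_def mult.assoc)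
  also have "\<gamma> * s = x + 2 * pi * of_int k" using \<gamma> by (simp add: s_def)
  also have "cis (x + 2 * pi * of_int k) = cis x"
    by (simp add: cis_mult[symmetric] cis_multiple_2pi)
  finally have "m + exp ((a - \<i> * of_real w) * of_real s) * (v - m) = v'" using x by (simp add: algebra_simps)
  then show ?thesis
    using wreach_constant_control[OF assms(2) nz, of s v] k by (simp add: s_def m_def)
qed

end

text \<open>Let \<open>\<rho>\<close> be the distance of \<open>x\<close> from \<open>c\<close>. If \<open>\<rho> \<le> 2|d|\<close>, then the circle of \<open>x\<close> about \<open>c\<close> meets the
circle of \<open>c\<close> about \<open>c + d\<close>, so \<open>x\<close> is related to \<open>c\<close> in two steps. Otherwise, half a turn about
\<open>c + d\<close> starting on the ray from \<open>c\<close> through \<open>c + d\<close> lowers \<open>\<rho>\<close> by \<open>2|d|\<close>.\<close>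

lemma plane_connected_by_two_families_of_circles:
  fixes c d :: complex and R :: "complex \<Rightarrow> complex \<Rightarrow> bool"
  assumes "d \<noteq> 0"
    and R: "\<And>x y. R x y \<Longrightarrow> R y x" "\<And>x y z. R x y \<Longrightarrow> R y z \<Longrightarrow> R x z"
    and c: "\<And>x y. dist x c = dist y c \<Longrightarrow> R x y" "\<And>x y. dist x (c + d) = dist y (c + d) \<Longrightarrow> R x y"
  shows "R x y"
proof -
  have "R x c" if "norm (x - c) \<le> 2 * norm d * real n" for x n
    using that
  proof (induction n arbitrary: x)
    case 0
    then show ?case using c(1)[of x c] by simp
  next
    case (Suc n)
    define \<rho> where "\<rho> = norm (x - c)"
    define e where "e = sgn d"
    have e: "norm e = 1" "d = of_real (norm d) * e"
      using assms(1) by (simp_all add: e_def norm_sgn) (simp add: sgn_div_norm scaleR_conv_of_real)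
    show ?case
    proof (cases "\<rho> \<le> 2 * norm d")
      case True
      \<comment> \<open>a point of the circle through \<open>x\<close> about \<open>c\<close> that is as far from \<open>c + d\<close> as \<open>c\<close> is\<close>
      define h where "h = sqrt ((norm d)\<^sup>2 - (norm d - \<rho>\<^sup>2 / (2 * norm d))\<^sup>2)"
      define z where "z = c + e * Complex (\<rho>\<^sup>2 / (2 * norm d)) h"
      have d0: "norm d > 0" using assms(1) by simp
      have "0 \<le> \<rho>" by (simp add: \<rho>_def)
      have "\<rho>\<^sup>2 \<le> (2 * norm d)\<^sup>2" using True \<open>0 \<le> \<rho>\<close> by (intro power_mono)
      then have "\<rho>\<^sup>2 / (2 * norm d) \<le> 2 * norm d" using d0 by (simp add: field_simps power2_eq_square)
      moreover have "0 \<le> \<rho>\<^sup>2 / (2 * norm d)" by simp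
      ultimately have "\<bar>norm d - \<rho>\<^sup>2 / (2 * norm d)\<bar> \<le> norm d" by linarith
      then have "(norm d - \<rho>\<^sup>2 / (2 * norm d))\<^sup>2 \<le> (norm d)\<^sup>2"
        using abs_le_square_iff[of "norm d - \<rho>\<^sup>2 / (2 * norm d)" "norm d"] by simp
      then have h: "h\<^sup>2 = (norm d)\<^sup>2 - (norm d - \<rho>\<^sup>2 / (2 * norm d))\<^sup>2" by (simp add: h_def)
      have "norm (z - c) = sqrt ((\<rho>\<^sup>2 / (2 * norm d))\<^sup>2 + h\<^sup>2)"
        by (simp only: z_def add_diff_cancel_left' norm_mult e(1)) (simp add: cmod_def)
      also have "(\<rho>\<^sup>2 / (2 * norm d))\<^sup>2 + h\<^sup>2 = \<rho>\<^sup>2"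
        unfolding h using d0 by (simp add: power2_diff)
      finally have 1: "norm (z - c) = \<rho>" using \<open>0 \<le> \<rho>\<close> by simp
      have "z - (c + d) = e * (Complex (\<rho>\<^sup>2 / (2 * norm d)) h - of_real (norm d))"
        using e(2) by (simp add: z_def algebra_simps)
      then have "norm (z - (c + d)) = sqrt ((\<rho>\<^sup>2 / (2 * norm d) - norm d)\<^sup>2 + h\<^sup>2)"
        by (simp only: norm_mult e(1)) (simp add: cmod_def)
      also have "\<dots> = norm d" unfolding h by (simp add: power2_commute)
      finally have 2: "norm (z - (c + d)) = norm d" .
      have "R x z" using c(1)[of x z] 1 by (simp add: \<rho>_def dist_norm)
      moreover have "R z c" using c(2)[of z c] 2 by (simp add: dist_norm)
      ultimately show ?thesis using R(2) by blast
    next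
      case False
      define y where "y = c + of_real \<rho> * e"
      define z where "z = c + of_real (2 * norm d - \<rho>) * e"
      have "0 \<le> \<rho>" by (simp add: \<rho>_def)
      then have "R x y" using c(1)[of x y] e(1) by (simp add: y_def \<rho>_def dist_norm norm_mult)
      moreover have "R y z"
      proof (rule c(2))
        have "y - (c + d) = of_real (\<rho> - norm d) * e" "z - (c + d) = of_real (norm d - \<rho>) * e"
          by (subst e(2), simp add: y_def z_def algebra_simps)+
        then show "dist y (c + d) = dist z (c + d)"
          by (simp only: dist_norm norm_mult e(1) norm_of_real) simp
      qed
      moreover have "R z c"
      proof (rule Suc.IH)
        have "norm (z - c) = \<bar>2 * norm d - \<rho>\<bar>"
          by (simp only: z_def add_diff_cancel_left' norm_mult e(1) norm_of_real mult_1_right)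
        then show "norm (z - c) \<le> 2 * norm d * real n" using False Suc.prems by (simp add: \<rho>_def algebra_simps)
      qed
      ultimately show ?thesis using R(2) by blast
    qed
  qed
  moreover have "\<exists>n. norm (x - c) \<le> 2 * norm d * real n" for x
  proof -
    obtain n where "norm (x - c) / (2 * norm d) \<le> real n" using real_arch_simple by blast
    then show ?thesis using assms(1) by (intro exI[of _ n]) (simp add: field_simps)
  qed
  ultimately show ?thesis using R by metis
qed

context rotating_system
begin

lemma inner_speed_avoiding:
  obtains w where "sm < w" "w < sp" "w \<noteq> x" "w \<noteq> y" "w \<noteq> 0"
proof -
  have "infinite {sm<..<sp}" using sm sp by (simp add: infinite_Ioo)
  then have "\<not> {sm<..<sp} \<subseteq> {x, y, 0}" using finite_subset by blast
  then obtain w where w: "w \<in> {sm<..<sp}" "w \<notin> {x, y, 0}" by blast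
  show thesis
  proof (rule that)
    show "sm < w" "w < sp" using w(1) by simp_all
    show "w \<noteq> x" "w \<noteq> y" "w \<noteq> 0" using w(2) by blast+
  qed
qed

lemma wreach_everything_if_rotation:
  assumes "Re a = 0" shows "wreach v v'"
proof -
  obtain w1 where w1: "sm < w1" "w1 < sp" "w1 \<noteq> Im a" using inner_speed_avoiding by metis
  obtain w2 where w2: "sm < w2" "w2 < sp" "w2 \<noteq> Im a" "w2 \<noteq> w1" using inner_speed_avoiding by metis
  have ne: "equilibrium w2 - equilibrium w1 \<noteq> 0"
  proof -
    have "a - \<i> * of_real w1 \<noteq> 0" "a - \<i> * of_real w2 \<noteq> 0" "w1 \<noteq> w2"
      using w1 w2 by (auto simp: complex_eq_iff)
    then show ?thesis by (simp add: equilibrium_def divide_eq_eq) 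
  qed
  define c1 where "c1 = equilibrium w1"
  define d where "d = equilibrium w2 - equilibrium w1"
  define R where "R x y \<longleftrightarrow> wreach x y \<and> wreach y x" for x y
  have "R v v'"
  proof (rule plane_connected_by_two_families_of_circles[of d R c1])
    show "R x y" if "dist x c1 = dist y c1" for x y
      using wreach_on_circles[OF assms, of w1] w1 that by (auto simp: R_def c1_def)
    show "R x y" if "dist x (c1 + d) = dist y (c1 + d)" for x y
      using wreach_on_circles[OF assms, of w2] w2 that by (auto simp: R_def c1_def d_def)
  qed (use ne in \<open>auto simp: R_def d_def intro: wreach_trans\<close>)
  then show ?thesis by (simp add: R_def)
qed

end

section \<open>Control sets in terms of runs\<close>

lemma closure_meets_open:
  assumes "x \<in> closure S" "open U" "x \<in> U"
  obtains y where "y \<in> S" "y \<in> U"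
  using assms open_Int_closure_eq_empty[of U S] by blast

lemma closureI_meets_open:
  assumes "\<And>U. open U \<Longrightarrow> x \<in> U \<Longrightarrow> \<exists>y\<in>S. y \<in> U"
  shows "x \<in> closure S"
proof (rule ccontr)
  assume "x \<notin> closure S"
  then obtain y where "y \<in> S" "y \<in> - closure S" using assms[of "- closure S"] by auto
  then show False using closure_subset by blast
qed

text \<open>Both defining properties pass to unions of chains, so Zorn's lemma provides maximal sets.\<close>

lemma pre_control_set_subset_control_set:
  assumes "pre_control_set X Y \<Omega> D"
  obtains E where "control_set X Y \<Omega> E" "D \<subseteq> E"
proof -
  let ?A = "{E. pre_control_set X Y \<Omega> E \<and> D \<subseteq> E}"
  have "\<exists>M\<in>?A. \<forall>E\<in>?A. M \<subseteq> E \<longrightarrow> E = M"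
  proof (rule subset_Zorn_nonempty)
    show "?A \<noteq> {}" using assms by blast
    fix \<C> assume ne: "\<C> \<noteq> {}" and ch: "subset.chain ?A \<C>"
    have sub: "E \<subseteq> F \<or> F \<subseteq> E" "pre_control_set X Y \<Omega> E" "D \<subseteq> E" if "E \<in> \<C>" "F \<in> \<C>" for E F
      using ch that unfolding subset.chain_def by blast+
    have "pre_control_set X Y \<Omega> (\<Union>\<C>)"
      unfolding pre_control_set_def
    proof (intro conjI ballI)
      fix x assume "x \<in> \<Union>\<C>"
      then obtain E where E: "E \<in> \<C>" "x \<in> E" by blast
      show "\<exists>u \<gamma>. admissible_control \<Omega> u \<and> is_solution X Y u \<gamma> \<and> \<gamma> 0 = x \<and> \<gamma> ` {0..} \<subseteq> \<Union>\<C>"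
        using sub(2)[OF E(1) E(1)] E unfolding pre_control_set_def by (meson Sup_upper subset_trans)
      show "\<Union>\<C> \<subseteq> closure (positive_orbit X Y \<Omega> x)"
      proof
        fix y assume "y \<in> \<Union>\<C>"
        then obtain F where F: "F \<in> \<C>" "y \<in> F" by blast
        then obtain G where "G \<in> \<C>" "x \<in> G" "y \<in> G" using sub(1)[OF E(1) F(1)] E by blast
        then show "y \<in> closure (positive_orbit X Y \<Omega> x)"
          using sub(2) unfolding pre_control_set_def by blast
      qed
    qed
    then show "\<Union>\<C> \<in> ?A" using ne sub(3) by blast
  qed
  then obtain M where M: "M \<in> ?A" "\<And>E. E \<in> ?A \<Longrightarrow> M \<subseteq> E \<Longrightarrow> E = M" by auto
  then have "control_set X Y \<Omega> M" unfolding control_set_def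
    by (metis (mono_tags, lifting) mem_Collect_eq subset_trans)
  then show thesis using M(1) by (intro that) auto
qed

text \<open>A system on \<open>SE(2)\<close> that is the image of a turning system under a covering map \<open>q\<close>. The assumptions
are all that is used of the manifold: \<open>q\<close> is an open continuous surjection with the translations by
\<open>2\<pi>\<close> in the angle as deck transformations, and it lifts and projects solutions.\<close>

locale normal_form = turning_system a b sm sp for a b sm sp +
  fixes X Y :: vfield and \<Omega> :: "real set" and q :: "real \<times> complex \<Rightarrow> se2"
  assumes continuous_q: "continuous_on UNIV q"
    and open_image_q: "\<And>U. open U \<Longrightarrow> open (q ` U)"
    and surj_q: "range q = UNIV"
    and q_eq_iff: "\<And>p p'. q p = q p' \<longleftrightarrow> (\<exists>k::int. fst p' = fst p + 2 * pi * of_int k) \<and> snd p' = snd p"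
    and solution_lift: "\<And>u \<gamma> p. admissible_control \<Omega> u \<Longrightarrow> is_solution X Y u \<gamma> \<Longrightarrow> \<gamma> 0 = q p \<Longrightarrow>
        \<exists>w c. run w c \<and> c 0 = p \<and> (\<forall>s\<ge>0. \<gamma> s = q (c s))"
    and solution_project: "\<And>w c. run w c \<Longrightarrow>
        \<exists>u. admissible_control \<Omega> u \<and> is_solution X Y u (\<lambda>s. q (c s))"
begin

lemma open_vimage_q: "open (q -` D) \<longleftrightarrow> open D"
proof
  assume "open D" then show "open (q -` D)" using continuous_q by (simp add: open_vimage)
next
  assume "open (q -` D)"
  moreover have "q ` (q -` D) = D" using surj_q by (simp add: image_vimage_eq)
  ultimately show "open D" using open_image_q by metis
qed

lemma vimage_closure_q: "q -` closure D = closure (q -` D)"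
proof
  show "q -` closure D \<subseteq> closure (q -` D)"
  proof
    fix p assume p: "p \<in> q -` closure D"
    show "p \<in> closure (q -` D)"
    proof (rule closureI_meets_open)
      fix U assume U: "open U" "p \<in> U"
      then have "open (q ` U)" "q p \<in> q ` U" using open_image_q by auto
      then obtain y where "y \<in> D" "y \<in> q ` U" using p closure_meets_open by blast
      then show "\<exists>y\<in>q -` D. y \<in> U" by auto
    qed
  qed
  have "closed (q -` closure D)" using continuous_q by (simp add: closed_vimage)
  then show "closure (q -` D) \<subseteq> q -` closure D"
    by (intro closure_minimal) (use closure_subset in auto)
qed

lemma positive_orbit_q: "positive_orbit X Y \<Omega> (q p) = q ` {p'. \<exists>s. reach s p p'}"
proof
  show "positive_orbit X Y \<Omega> (q p) \<subseteq> q ` {p'. \<exists>s. reach s p p'}"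
  proof
    fix g assume "g \<in> positive_orbit X Y \<Omega> (q p)"
    then obtain \<gamma> s u where "g = \<gamma> s" "admissible_control \<Omega> u" "is_solution X Y u \<gamma>" "\<gamma> 0 = q p" "0 \<le> s"
      unfolding positive_orbit_def by blast
    moreover then obtain w c where "run w c" "c 0 = p" "\<forall>s\<ge>0. \<gamma> s = q (c s)" using solution_lift by blast
    ultimately show "g \<in> q ` {p'. \<exists>s. reach s p p'}" unfolding reach_def by blast
  qed
  show "q ` {p'. \<exists>s. reach s p p'} \<subseteq> positive_orbit X Y \<Omega> (q p)"
  proof
    fix g assume "g \<in> q ` {p'. \<exists>s. reach s p p'}"
    then obtain p' s where g: "g = q p'" "reach s p p'" by auto
    then obtain w c where c: "0 \<le> s" "run w c" "c 0 = p" "c s = p'" unfolding reach_def by blast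
    then obtain u where u: "admissible_control \<Omega> u" "is_solution X Y u (\<lambda>s. q (c s))"
      using solution_project by blast
    show "g \<in> positive_orbit X Y \<Omega> (q p)"
      unfolding positive_orbit_def mem_Collect_eq
      by (intro exI[of _ "\<lambda>s. q (c s)"] exI[of _ s] exI[of _ u]) (use u c g in auto)
  qed
qed

lemma closure_orbitD:
  assumes "q p' \<in> closure (positive_orbit X Y \<Omega> (q p))" "open U" "p' \<in> U"
  obtains s p'' p1 where "reach s p p''" "p1 \<in> U" "q p1 = q p''"
proof -
  have "p' \<in> closure (q -` positive_orbit X Y \<Omega> (q p))"
    using assms(1) vimage_closure_q by auto
  then obtain p1 where "p1 \<in> U" "q p1 \<in> positive_orbit X Y \<Omega> (q p)"
    using closure_meets_open[OF _ assms(2,3)] by blast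
  then show thesis using that unfolding positive_orbit_q by blast
qed

text \<open>A continuous invariant with values in a closed set on everything reached from \<open>p\<close> excludes points from
the closure of the orbit of \<open>p\<close>. The closure lives in \<open>SE(2)\<close>, hence \<open>h\<close> must not depend on the choice
of the point over it.\<close>

lemma closed_condition_on_orbit_closure:
  fixes h :: "real \<times> complex \<Rightarrow> 'b :: topological_space"
  assumes "q p' \<in> closure (positive_orbit X Y \<Omega> (q p))"
    and h: "continuous_on UNIV h" "\<And>p p'. q p = q p' \<Longrightarrow> h p = h p'"
    and "closed K" "\<And>s p''. reach s p p'' \<Longrightarrow> h p'' \<in> K"
  shows "h p' \<in> K"
proof (rule ccontr)
  assume "h p' \<notin> K"
  then have U: "p' \<in> h -` (- K)" by simp
  have o: "open (h -` (- K))" using h(1) \<open>closed K\<close> by (intro open_vimage) auto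
  obtain s p'' p1 where p: "reach s p p''" "p1 \<in> h -` (- K)" "q p1 = q p''"
    by (rule closure_orbitD[OF assms(1) o U])
  from h(2)[OF p(3)] assms(5)[OF p(1)] p(2) show False by simp
qed

lemma pre_control_set_q:
  "pre_control_set X Y \<Omega> D \<longleftrightarrow>
     (\<forall>p. q p \<in> D \<longrightarrow> (\<exists>w c. run w c \<and> c 0 = p \<and> (\<forall>s\<ge>0. q (c s) \<in> D))) \<and>
     (\<forall>p p'. q p \<in> D \<longrightarrow> q p' \<in> D \<longrightarrow> q p' \<in> closure (positive_orbit X Y \<Omega> (q p)))"
  (is "_ \<longleftrightarrow> ?A \<and> ?B")
proof
  assume D: "pre_control_set X Y \<Omega> D"
  have ?A
  proof (intro allI impI)
    fix p assume "q p \<in> D"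
    then obtain u \<gamma> where g: "admissible_control \<Omega> u" "is_solution X Y u \<gamma>" "\<gamma> 0 = q p" "\<gamma> ` {0..} \<subseteq> D"
      using D unfolding pre_control_set_def by blast
    obtain w c where "run w c" "c 0 = p" "\<forall>s\<ge>0. \<gamma> s = q (c s)" using solution_lift[OF g(1-3)] by blast
    then show "\<exists>w c. run w c \<and> c 0 = p \<and> (\<forall>s\<ge>0. q (c s) \<in> D)"
      using g(4) by (intro exI[of _ w] exI[of _ c]) (metis atLeast_iff image_subset_iff)
  qed
  moreover have ?B using D unfolding pre_control_set_def by blast
  ultimately show "?A \<and> ?B" ..
next
  assume AB: "?A \<and> ?B"
  show "pre_control_set X Y \<Omega> D"
    unfolding pre_control_set_def
  proof (intro conjI ballI)
    fix x assume x: "x \<in> D"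
    obtain p where p: "x = q p" using surj_q by blast
    then obtain w c where c: "run w c" "c 0 = p" "\<forall>s\<ge>0. q (c s) \<in> D" using AB x by blast
    obtain u where "admissible_control \<Omega> u" "is_solution X Y u (\<lambda>s. q (c s))"
      using solution_project[OF c(1)] by blast
    then show "\<exists>u \<gamma>. admissible_control \<Omega> u \<and> is_solution X Y u \<gamma> \<and> \<gamma> 0 = x \<and> \<gamma> ` {0..} \<subseteq> D"
      using c(2,3) p by (intro exI[of _ u] exI[of _ "\<lambda>s. q (c s)"]) auto
    show "D \<subseteq> closure (positive_orbit X Y \<Omega> x)"
    proof
      fix y assume "y \<in> D"
      moreover obtain p' where "y = q p'" using surj_q by blast
      ultimately show "y \<in> closure (positive_orbit X Y \<Omega> x)" using AB x p by blast
    qed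
  qed
qed

text \<open>In the case \<open>a = 0\<close>, \<open>b = -1\<close> the function \<open>Re z\<close> decreases along solutions. It is therefore constant on
every pre-control set, which keeps the control sets through the singularities \<open>(0, r)\<close>
apart and without interior points.\<close>

lemma infinite_control_sets_with_empty_interior:
  assumes "a = 0" "b = - 1"
  shows "infinite {D. control_set X Y \<Omega> D \<and> interior D = {}}"
proof -
  have mono: "Re (snd p') \<le> Re (snd p)" if r: "reach s p p'" for s p p'
  proof -
    obtain w c where c: "run w c" "c 0 = p" "c s = p'" "0 \<le> s" using r unfolding reach_def by blast
    obtain S where S: "locally_finite_times S" "continuous_on {0..} (\<lambda>s. snd (c s))"
      "\<And>s. 0 < s \<Longrightarrow> s \<notin> S \<Longrightarrow> ((\<lambda>s. snd (c s)) has_vector_derivative (- 1 + cis (fst (c s)))) (at s)"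
      using run_components[OF c(1)] assms by (metis add_0 mult_zero_left)
    have "Re (snd (c s)) \<le> Re (snd (c 0))"
    proof (rule antimono_along_run[OF S(1) _ c(4), where f = "\<lambda>s. Re (snd (c s))"
          and f' = "\<lambda>s. Re (- 1 + cis (fst (c s)))"])
      show "continuous_on {0..} (\<lambda>s. Re (snd (c s)))" by (rule continuous_on_Re[OF S(2)])
      show "((\<lambda>s. Re (snd (c s))) has_real_derivative Re (- 1 + cis (fst (c r)))) (at r)"
        if "0 < r" "r \<notin> S" for r
        unfolding has_real_derivative_iff_has_vector_derivative
        by (rule bounded_linear.has_vector_derivative[OF bounded_linear_Re S(3)[OF that]])
    qed simp
    then show ?thesis using c by simp
  qed
  have le: "Re (snd p') \<le> Re (snd p)" if "q p' \<in> closure (positive_orbit X Y \<Omega> (q p))" for p p'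
  proof -
    have "continuous_on UNIV (\<lambda>p :: real \<times> complex. Re (snd p))"
      by (intro continuous_on_Re continuous_on_snd continuous_on_id)
    from closed_condition_on_orbit_closure[OF that this, of "{..Re (snd p)}"] mono
    show ?thesis by (simp add: q_eq_iff)
  qed
  have eq: "Re (snd p') = Re (snd p)" if "pre_control_set X Y \<Omega> D" "q p \<in> D" "q p' \<in> D" for D p p'
    using that le unfolding pre_control_set_q by (meson order_antisym)
  have point: "pre_control_set X Y \<Omega> {q (0, of_real r)}" for r
    unfolding pre_control_set_q
  proof (intro conjI allI impI)
    fix p assume p: "q p \<in> {q (0, of_real r)}"
    then obtain k :: int where k: "fst p = 2 * pi * of_int k" "snd p = of_real r"
      by (auto simp: q_eq_iff[of _ p] dest!: sym[of "q p"])
    have "cis (fst p) = 1" unfolding k(1) by (rule cis_multiple_2pi) simp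
    then have "velocity 0 p = 0" unfolding velocity_def by (simp add: assms zero_prod_def)
    then have "run (\<lambda>_. 0) (\<lambda>_. p)"
      by (intro run_constI) (use sm sp in simp_all)
    then show "\<exists>w c. run w c \<and> c 0 = p \<and> (\<forall>s\<ge>0. q (c s) \<in> {q (0, of_real r)})" using p by blast
    fix p' assume "q p' \<in> {q (0, of_real r)}"
    then have "q p' = q p" using p by simp
    moreover have "reach 0 p p" using reachI[OF \<open>run (\<lambda>_. 0) (\<lambda>_. p)\<close>, of 0] by simp
    ultimately have "q p' \<in> positive_orbit X Y \<Omega> (q p)" unfolding positive_orbit_q by auto
    then show "q p' \<in> closure (positive_orbit X Y \<Omega> (q p))" using closure_subset by blast
  qed
  have "\<exists>D. control_set X Y \<Omega> D \<and> q (0, of_real r) \<in> D" for r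
    using pre_control_set_subset_control_set[OF point[of r]] by (metis insert_subset)
  then obtain F where F: "\<And>r. control_set X Y \<Omega> (F r)" "\<And>r::real. q (0, of_real r) \<in> F r" by metis
  have pre: "pre_control_set X Y \<Omega> (F r)" for r using F(1) unfolding control_set_def by blast
  have "interior (F r) = {}" for r
  proof (rule ccontr)
    assume "interior (F r) \<noteq> {}"
    then obtain p where p: "q p \<in> interior (F r)" using surj_q by (metis ex_in_conv rangeE UNIV_I)
    \<comment> \<open>an interior point could be moved in the direction of \<open>Re z\<close>\<close>
    let ?f = "\<lambda>x::real. (fst p, snd p + of_real x)"
    have "continuous_on UNIV (\<lambda>x. q (?f x))"
      by (rule continuous_on_compose2[OF continuous_q]) (auto intro!: continuous_intros)
    then have "open ((\<lambda>x. q (?f x)) -` interior (F r))" by (intro open_vimage) auto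
    moreover have "0 \<in> (\<lambda>x. q (?f x)) -` interior (F r)" using p by simp
    ultimately obtain e where e: "e > 0" "ball 0 e \<subseteq> (\<lambda>x. q (?f x)) -` interior (F r)"
      by (rule openE)
    have "e / 2 \<in> ball 0 e" using e(1) by (simp add: dist_norm)
    with e(2) have "q (?f (e / 2)) \<in> interior (F r)" by blast
    then have "q (?f (e / 2)) \<in> F r" "q p \<in> F r" using p interior_subset by auto
    from eq[OF pre this] e(1) show False by simp
  qed
  then have "range F \<subseteq> {D. control_set X Y \<Omega> D \<and> interior D = {}}" using F(1) by blast
  moreover have "inj F"
  proof (rule injI)
    fix r r' assume "F r = F r'"
    then have "q (0, of_real r') \<in> F r" using F(2)[of r'] by simp
    from eq[OF pre F(2) this] show "r = r'" by simp
  qed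
  then have "infinite (range F)"
    using finite_imageD[of F UNIV] infinite_UNIV_char_0[where 'a = real] by auto
  ultimately show ?thesis using finite_subset by blast
qed

end

context rotating_system
begin

section \<open>Growth of the invariant\<close>

lemma run_norm_le:
  assumes "run w c" "0 \<le> s" "Re a \<noteq> 0"
  shows "norm (W (c s)) \<le> exp (Re a * s) * norm (W (c 0)) + (exp (Re a * s) - 1) / Re a"
proof -
  define y where "y = exp (- a * of_real s) * snd (c s)"
  \<comment> \<open>this direction turns the left side of \<open>run_bound\<close> into a modulus\<close>
  obtain e where e: "norm e = 1" "e * y = of_real (norm y)"
  proof (cases "y = 0")
    case True
    then show thesis by (intro that[of 1]) auto
  next
    case False
    show thesis
    proof (rule that[of "of_real (norm y) / y"])
      show "norm (of_real (norm y) / y) = 1" using False by (simp add: norm_divide)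
      show "of_real (norm y) / y * y = of_real (norm y)" using False by simp
    qed
  qed
  have "norm y = Re (e * exp (- a * of_real s) * snd (c s))" using e(2) by (simp add: y_def mult.assoc)
  also have "\<dots> \<le> Re (e * snd (c 0)) + (1 - exp (- Re a * s)) / Re a"
    by (rule run_bound[OF assms(1,2) e(1) assms(3)])
  also have "Re (e * snd (c 0)) \<le> norm (W (c 0))"
    using complex_Re_le_cmod[of "e * snd (c 0)"] e(1) by (simp add: norm_mult)
  finally have "exp (Re a * s) * norm y \<le> exp (Re a * s) * (norm (W (c 0)) + (1 - exp (- Re a * s)) / Re a)"
    by (intro mult_left_mono) auto
  also have "exp (Re a * s) * (1 - exp (- Re a * s)) = exp (Re a * s) - 1"
    by (simp add: right_diff_distrib exp_add[symmetric])
  then have "exp (Re a * s) * (norm (W (c 0)) + (1 - exp (- Re a * s)) / Re a)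
      = exp (Re a * s) * norm (W (c 0)) + (exp (Re a * s) - 1) / Re a"
    by (simp add: distrib_left)
  also have "exp (Re a * s) * norm y = norm (W (c s))"
    by (simp add: y_def norm_mult mult.assoc[symmetric] exp_add[symmetric])
  finally show ?thesis .
qed

lemma run_norm_ge:
  assumes "run w c" "0 \<le> s" "Re a \<noteq> 0"
  shows "norm (W (c s)) \<ge> exp (Re a * s) * (norm (W (c 0)) - 1 / Re a) + 1 / Re a"
proof -
  define y where "y = snd (c 0)"
  \<comment> \<open>this direction makes the initial value in \<open>run_bound\<close> as negative as possible\<close>
  obtain e where e: "norm e = 1" "e * y = - of_real (norm y)"
  proof (cases "y = 0")
    case True
    then show thesis by (intro that[of 1]) auto
  next
    case False
    show thesis
    proof (rule that[of "- (of_real (norm y) / y)"])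
      show "norm (- (of_real (norm y) / y)) = 1" using False by (simp add: norm_divide)
      show "- (of_real (norm y) / y) * y = - of_real (norm y)" using False by simp
    qed
  qed
  have "- norm (exp (- a * of_real s) * snd (c s)) \<le> Re (e * exp (- a * of_real s) * snd (c s))"
    using abs_Re_le_cmod[of "e * exp (- a * of_real s) * snd (c s)"] e(1) by (simp add: norm_mult)
  also have "\<dots> \<le> Re (e * snd (c 0)) + (1 - exp (- Re a * s)) / Re a"
    by (rule run_bound[OF assms(1,2) e(1) assms(3)])
  also have "Re (e * snd (c 0)) = - norm (W (c 0))" using e(2) by (simp add: y_def)
  finally have "exp (Re a * s) * (norm (W (c 0)) - (1 - exp (- Re a * s)) / Re a)
      \<le> exp (Re a * s) * norm (exp (- a * of_real s) * snd (c s))"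
    by (intro mult_left_mono) auto
  also have "\<dots> = norm (W (c s))"
    by (simp add: norm_mult mult.assoc[symmetric] exp_add[symmetric])
  also have "exp (Re a * s) * (norm (W (c 0)) - (1 - exp (- Re a * s)) / Re a)
     = exp (Re a * s) * (norm (W (c 0)) - 1 / Re a) + exp (Re a * s) * exp (- Re a * s) / Re a"
    using assms(3) by (simp add: right_diff_distrib diff_divide_distrib)
  also have "exp (Re a * s) * exp (- Re a * s) = 1" by (simp add: exp_add[symmetric])
  finally show ?thesis .
qed

lemma wreach_bounded:
  assumes "Re a < 0" "wreach v v'" "norm v \<le> - (1 / Re a)"
  shows "norm v' \<le> - (1 / Re a)"
proof -
  obtain s p p' where "reach s p p'" "W p = v" "W p' = v'" using assms(2) unfolding wreach_def by blast
  then obtain w c where c: "run w c" "W (c 0) = v" "W (c s) = v'" "0 \<le> s" unfolding reach_def by blast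
  have "norm v' \<le> exp (Re a * s) * norm v + (exp (Re a * s) - 1) / Re a"
    using run_norm_le[OF c(1,4)] assms(1) c(2,3) by simp
  also have "\<dots> \<le> exp (Re a * s) * (- (1 / Re a)) + (exp (Re a * s) - 1) / Re a"
    using assms(3) by (intro add_right_mono mult_left_mono) auto
  finally show ?thesis by (simp add: diff_divide_distrib)
qed

lemma wreach_unbounded:
  assumes "Re a > 0" "wreach v v'" "norm v \<ge> 1 / Re a"
  shows "norm v' \<ge> norm v"
proof -
  obtain s p p' where "reach s p p'" "W p = v" "W p' = v'" using assms(2) unfolding wreach_def by blast
  then obtain w c where c: "run w c" "W (c 0) = v" "W (c s) = v'" "0 \<le> s" unfolding reach_def by blast
  have "1 * (norm v - 1 / Re a) \<le> exp (Re a * s) * (norm v - 1 / Re a)"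
    using assms(1,3) c(4) by (intro mult_right_mono) auto
  then show ?thesis using run_norm_ge[OF c(1,4)] assms(1) c(2,3) by simp
qed

lemma norm_equilibrium: "norm (equilibrium w) = 1 / norm (a - \<i> * of_real w)"
  by (simp add: equilibrium_def norm_divide)

lemma norm_equilibrium_le:
  assumes "Re a \<noteq> 0" shows "norm (equilibrium w) \<le> 1 / \<bar>Re a\<bar>"
proof -
  have "\<bar>Re a\<bar> \<le> norm (a - \<i> * of_real w)" using abs_Re_le_cmod[of "a - \<i> * of_real w"] by simp
  moreover have "0 < \<bar>Re a\<bar>" using assms by simp
  ultimately show ?thesis unfolding norm_equilibrium by (intro divide_left_mono mult_pos_pos) linarith+
qed

lemma norm_equilibrium_less:
  assumes "Re a > 0" "w \<noteq> Im a" shows "norm (equilibrium w) < 1 / Re a"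
proof -
  have "(Re a)\<^sup>2 < (norm (a - \<i> * of_real w))\<^sup>2" using assms(2) by (simp add: cmod_power2)
  then have "Re a < norm (a - \<i> * of_real w)" by (rule power_less_imp_less_base) simp
  then show ?thesis unfolding norm_equilibrium
    using assms(1) by (intro divide_strict_left_mono mult_pos_pos) linarith+
qed

lemma equilibrium_resonant:
  assumes "Re a \<noteq> 0" shows "equilibrium (Im a) = - 1 / of_real (Re a)"
proof -
  have "a - \<i> * of_real (Im a) = of_real (Re a)" by (simp add: complex_eq_iff)
  then show ?thesis by (simp add: equilibrium_def)
qed

text \<open>Where the solution is differentiable, \<open>0 = (|z|\<^sup>2)'/2 = \<lambda> |z|\<^sup>2 + Re W\<close> with \<open>\<lambda> = Re a\<close>, so
\<open>Re W = -1/\<lambda>\<close>. As \<open>|W| = 1/\<lambda>\<close>, this forces \<open>W = -1/\<lambda>\<close>. Time \<open>0\<close> is reached by continuity.\<close>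

lemma run_on_sphere:
  assumes "run w c" "Re a > 0" and sphere: "\<And>s. 0 \<le> s \<Longrightarrow> norm (W (c s)) = 1 / Re a"
  shows "W (c 0) = equilibrium (Im a)"
proof -
  obtain S where S: "locally_finite_times S" "continuous_on {0..} (\<lambda>s. fst (c s))" "continuous_on {0..} (\<lambda>s. snd (c s))"
    "\<And>s. 0 < s \<Longrightarrow> s \<notin> S \<Longrightarrow> ((\<lambda>s. snd (c s)) has_vector_derivative
        (a * snd (c s) + cis (fst (c s)))) (at s)"
    using run_components[OF assms(1)] by (metis add.right_neutral)
  define f where "f s = Re (W (c s))" for s
  have off: "f s = - 1 / Re a" if s: "0 < s" "s \<notin> S" for s
  proof -
    let ?d = "a * snd (c s) + cis (fst (c s))"
    have const: "snd (c r) \<bullet> snd (c r) = (1 / Re a)\<^sup>2" if "0 < r" for r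
      using sphere[of r] that by (simp add: power2_norm_eq_inner[symmetric])
    have "((\<lambda>r. snd (c r) \<bullet> snd (c r)) has_derivative (\<lambda>h. snd (c s) \<bullet> (h *\<^sub>R ?d) + (h *\<^sub>R ?d) \<bullet> snd (c s))) (at s)"
      using S(4)[OF s] unfolding has_vector_derivative_def by (intro has_derivative_inner) auto
    moreover have "((\<lambda>r. snd (c r) \<bullet> snd (c r)) has_derivative (\<lambda>h. 0)) (at s)"
      by (rule has_derivative_transform_within_open[OF has_derivative_const, where s = "{0<..}"])
        (use s const in auto)
    ultimately have "(\<lambda>h. snd (c s) \<bullet> (h *\<^sub>R ?d) + (h *\<^sub>R ?d) \<bullet> snd (c s)) = (\<lambda>h. 0)"
      by (rule has_derivative_unique)
    from fun_cong[OF this, of 1] have "snd (c s) \<bullet> ?d = 0" by (simp add: inner_commute)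
    moreover have "snd (c s) \<bullet> ?d = Re a * (snd (c s) \<bullet> snd (c s)) + f s"
      by (simp add: f_def W_def inner_complex_def algebra_simps)
    ultimately have "Re a * (1 / Re a)\<^sup>2 + f s = 0" using const[OF s(1)] by simp
    then show ?thesis using assms(2) by (simp add: power2_eq_square field_simps)
  qed
  have contf: "continuous_on {0..} f"
    unfolding f_def W_def
    by (intro continuous_on_Re continuous_on_mult continuous_on_cis continuous_on_minus S(2,3))
  have f0: "f 0 = - 1 / Re a"
  proof (rule ccontr)
    assume ne: "f 0 \<noteq> - 1 / Re a"
    have "openin (top_of_set {0..}) ({0..} \<inter> f -` (- {- 1 / Re a}))"
      by (rule continuous_openin_preimage_gen[OF contf]) auto
    then obtain T where T: "open T" "{0..} \<inter> f -` (- {- 1 / Re a}) = {0..} \<inter> T" by (meson openin_open)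
    then have "0 \<in> T" using ne by auto
    from openE[OF T(1) this] obtain e where e: "e > 0" "ball 0 e \<subseteq> T" .
    have "infinite {0<..<e}" using e(1) by (simp add: infinite_Ioo)
    moreover have "finite (S \<inter> {0..e})" using S(1) unfolding locally_finite_times_def by blast
    ultimately have "\<not> {0<..<e} \<subseteq> S \<inter> {0..e}" using finite_subset by blast
    then obtain s where s': "s \<in> {0<..<e}" "s \<notin> S \<inter> {0..e}" by blast
    then have s: "s \<in> {0<..<e}" "s \<notin> S" by auto
    then have "s \<in> {0..} \<inter> T" using e(2) by (auto simp: subset_iff dist_norm)
    then have "f s \<noteq> - 1 / Re a" using T(2) by blast
    then show False using off s by auto
  qed
  have "(Re (W (c 0)))\<^sup>2 + (Im (W (c 0)))\<^sup>2 = (1 / Re a)\<^sup>2"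
    using sphere[of 0] by (simp add: cmod_power2[symmetric])
  then have "Im (W (c 0)) = 0" using f0 by (simp add: f_def power_divide)
  then show ?thesis
    using f0 assms(2) by (simp add: f_def equilibrium_resonant complex_eq_iff Re_divide_of_real Im_divide_of_real)
qed

end

section \<open>Control sets for \<open>a \<noteq> 0\<close>\<close>

locale rotating_normal_form = normal_form a 0 sm sp X Y \<Omega> q + rotating_system a sm sp for a sm sp X Y \<Omega> q
begin

text \<open>Rotation invariant subsets of \<open>SE(2)\<close> are products of the circle with a subset of the \<open>W\<close>-plane.
All control sets of interest, except single points, have this form.\<close>

definition slab :: "complex set \<Rightarrow> se2 set" where
  "slab K = q ` (W -` K)"

lemma W_cong: "q p = q p' \<Longrightarrow> W p = W p'"
proof -
  assume "q p = q p'"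
  then obtain k :: int where k: "fst p' = fst p + 2 * pi * of_int k" "snd p' = snd p"
    unfolding q_eq_iff by blast
  have "cis (- (fst p + 2 * pi * of_int k)) = cis (- fst p) * cis (2 * pi * of_int (- k))"
    by (simp add: cis_mult)
  also have "cis (2 * pi * of_int (- k)) = 1" by (rule cis_multiple_2pi) simp
  finally show ?thesis by (simp add: W_def k)
qed

lemma q_in_slab [simp]: "q p \<in> slab K \<longleftrightarrow> W p \<in> K"
proof
  assume "q p \<in> slab K"
  then obtain p' where "q p = q p'" "W p' \<in> K" unfolding slab_def by auto
  then show "W p \<in> K" using W_cong[of p p'] by simp
qed (simp add: slab_def)

lemma vimage_q_slab: "q -` slab K = W -` K"
  by (rule set_eqI) simp

lemma slab_subsetI: "(\<And>p. q p \<in> D \<Longrightarrow> W p \<in> K) \<Longrightarrow> D \<subseteq> slab K"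
  using surj_q by (metis (no_types) UNIV_I imageE q_in_slab subsetI)

lemma open_slab: "open K \<Longrightarrow> open (slab K)"
  unfolding open_vimage_q[symmetric] vimage_q_slab by (intro open_vimage continuous_on_W)

lemma closure_vimage_W: "W p \<in> closure K \<Longrightarrow> p \<in> closure (W -` K)"
proof (rule closureI_meets_open)
  fix U assume U: "W p \<in> closure K" "open U" "p \<in> U"
  have "open (lift (fst p) -` U)" using U(2) by (intro open_vimage continuous_on_lift)
  moreover have "W p \<in> lift (fst p) -` U" using U(3) by simp
  ultimately obtain v where "v \<in> K" "v \<in> lift (fst p) -` U" using closure_meets_open[OF U(1)] by blast
  then show "\<exists>y\<in>W -` K. y \<in> U" by (intro bexI[of _ "lift (fst p) v"]) auto
qed

lemma slab_closure: "W p \<in> closure K \<Longrightarrow> q p \<in> closure (slab K)"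
  using closure_vimage_W vimage_closure_q[of "slab K"] unfolding vimage_q_slab by blast

lemma compact_slab:
  assumes "compact K" shows "compact (slab K)"
proof -
  obtain B where B: "\<And>v. v \<in> K \<Longrightarrow> norm v \<le> B" using compact_imp_bounded[OF assms] bounded_iff by blast
  let ?M = "({0..2 * pi} \<times> cball 0 B) \<inter> W -` K"
  have "compact ?M"
    by (intro compact_Int_closed compact_Times compact_Icc compact_cball closed_vimage
        continuous_on_W compact_imp_closed assms)
  then have "compact (q ` ?M)"
    using compact_continuous_image continuous_on_subset[OF continuous_q] by blast
  moreover have "q ` ?M = slab K"
  proof
    show "slab K \<subseteq> q ` ?M"
    proof
      fix g assume "g \<in> slab K"
      then obtain p where p: "g = q p" "W p \<in> K" unfolding slab_def by auto
      let ?k = "\<lfloor>fst p / (2 * pi)\<rfloor>"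
      let ?p = "(fst p - 2 * pi * of_int ?k, snd p)"
      have "q ?p = q p" unfolding q_eq_iff by (intro conjI exI[of _ ?k]) auto
      moreover have "2 * pi * of_int ?k \<le> 2 * pi * (fst p / (2 * pi))"
        by (intro mult_left_mono of_int_floor_le) simp
      moreover have "2 * pi * (fst p / (2 * pi)) \<le> 2 * pi * (of_int ?k + 1)"
        by (intro mult_left_mono order_less_imp_le[OF floor_less_iff[THEN iffD1]]) simp_all
      ultimately have "?p \<in> ?M" using p(2) B[OF p(2)] W_cong[of ?p p] by (simp add: distrib_left)
      then show "g \<in> q ` ?M" using p(1) \<open>q ?p = q p\<close> by (metis imageI)
    qed
  qed auto
  ultimately show ?thesis by simp
qed

lemma in_positive_orbit:
  assumes "wreach (W p) (equilibrium w)" "wreach (equilibrium w) (W p')"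
    and "w \<in> {sm..sp}" "a \<noteq> \<i> * of_real w" "w \<noteq> 0"
  shows "q p' \<in> positive_orbit X Y \<Omega> (q p)"
proof -
  obtain s and k :: int where s: "reach s p (fst p' + 2 * pi * of_int k, snd p')"
    by (rule reach_any_angle[OF assms])
  have "q p' = q (fst p' + 2 * pi * of_int k, snd p')" by (auto simp: q_eq_iff)
  with s show ?thesis unfolding positive_orbit_q by blast
qed

lemma controllable_if_rotation:
  assumes "Re a = 0" shows "controllable X Y \<Omega>"
proof -
  obtain w where w: "sm < w" "w < sp" "w \<noteq> Im a" "w \<noteq> 0" using inner_speed_avoiding by metis
  have "q p' \<in> positive_orbit X Y \<Omega> (q p)" for p p'
    by (rule in_positive_orbit[of _ w])
      (use w in \<open>auto intro: wreach_everything_if_rotation[OF assms] simp: complex_eq_iff\<close>)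
  then show ?thesis unfolding controllable_def using surj_q by (metis UNIV_I imageE UNIV_eq_I)
qed

text \<open>Some solution from \<open>p\<close> stays in \<open>D\<close>. Each of its points can be steered close to any point of \<open>D\<close>,
in particular back to where it started. So points of \<open>D\<close> return arbitrarily late.\<close>

lemma pre_control_set_recurrent:
  assumes "pre_control_set X Y \<Omega> D" "q p \<in> D" "open V" "W p \<in> V" "0 \<le> s"
  obtains r w c where "s \<le> r" "run w c" "c 0 = p" "W (c r) \<in> V"
proof -
  obtain w c where c: "run w c" "c 0 = p" "\<And>s. 0 \<le> s \<Longrightarrow> q (c s) \<in> D"
    using assms(1,2) unfolding pre_control_set_q by blast
  have "q p \<in> closure (positive_orbit X Y \<Omega> (q (c s)))"
    using assms(1,2,5) c(3) unfolding pre_control_set_q by blast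
  moreover have "open (W -` V)" using assms(3) by (intro open_vimage continuous_on_W)
  moreover have "p \<in> W -` V" using assms(4) by simp
  ultimately obtain s' p'' p1 where *: "reach s' (c s) p''" "p1 \<in> W -` V" "q p1 = q p''"
    by (rule closure_orbitD)
  have "W p'' \<in> V" using *(2) W_cong[OF *(3)] by simp
  have "reach (s + s') p p''" using reach_trans[OF reachI[OF c(1) assms(5)] *(1)] c(2) by simp
  moreover have "s \<le> s + s'" using *(1) unfolding reach_def by simp
  moreover obtain u d where "run u d" "d 0 = p" "d (s + s') = p''"
    using calculation(1) unfolding reach_def by blast
  ultimately show thesis using \<open>W p'' \<in> V\<close> by (intro that[of "s + s'" u d]) simp_all
qed

text \<open>Let \<open>p\<close> return close to itself at a late time. The solution from \<open>m\<close> with the same control has by then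
come close to it, so \<open>W p\<close> is a limit of points reached from \<open>m\<close>.\<close>

lemma pre_control_set_subset_if_contracting:
  assumes "Re a < 0" "pre_control_set X Y \<Omega> D"
  shows "D \<subseteq> slab (closure {v. wreach m v})"
proof (rule slab_subsetI)
  fix p assume p: "q p \<in> D"
  show "W p \<in> closure {v. wreach m v}"
    unfolding closure_approachable
  proof (intro allI impI)
    fix e :: real assume e: "0 < e"
    have "((\<lambda>s. exp (Re a * s) * norm (m - W p)) \<longlongrightarrow> 0) at_top"
      using assms(1) by (intro tendsto_mult_left_zero filterlim_compose[OF exp_at_bot]
          filterlim_tendsto_neg_mult_at_bot[OF tendsto_const] filterlim_ident)
    then have "\<forall>\<^sub>F s in at_top. exp (Re a * s) * norm (m - W p) < e / 2"
      by (rule order_tendstoD) (use e in auto)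
    then obtain s0 where s0: "\<And>s. s \<ge> s0 \<Longrightarrow> exp (Re a * s) * norm (m - W p) < e / 2"
      unfolding eventually_at_top_linorder by blast
    obtain r w c where r: "max 0 s0 \<le> r" "run w c" "c 0 = p" "W (c r) \<in> ball (W p) (e / 2)"
      by (rule pre_control_set_recurrent[OF assms(2) p, of "ball (W p) (e / 2)" "max 0 s0"]) (use e in auto)
    obtain c' where c': "run w c'" "W (c' 0) = m"
      "\<And>r. norm (W (c' r) - W (c r)) = exp (Re a * (r - 0)) * norm (m - W (c 0))"
      using run_neighbour[OF r(2), of 0 m] by blast
    have "dist (W (c' r)) (W p) \<le> dist (W (c' r)) (W (c r)) + dist (W p) (W (c r))"
      by (metis dist_commute dist_triangle)
    also have "\<dots> < e / 2 + e / 2"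
      using c'(3)[of r] s0[of r] r by (intro add_strict_mono) (auto simp: dist_norm)
    finally have "dist (W (c' r)) (W p) < e" by simp
    moreover have "wreach m (W (c' r))" using wreachI[OF reachI[OF c'(1), of r]] r(1) c'(2) by simp
    ultimately show "\<exists>y\<in>{v. wreach m v}. dist y (W p) < e" by blast
  qed
qed

text \<open>Let \<open>p\<close> return close to itself at a late time. The solution with the same control that ends in \<open>m\<close> must
have started close to \<open>p\<close>, so \<open>W p\<close> is a limit of points that reach \<open>m\<close>.\<close>

lemma pre_control_set_subset_if_expanding:
  assumes "Re a > 0" "pre_control_set X Y \<Omega> D"
  shows "D \<subseteq> slab (closure {v. wreach v m})"
proof (rule slab_subsetI)
  fix p assume p: "q p \<in> D"
  show "W p \<in> closure {v. wreach v m}"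
    unfolding closure_approachable
  proof (intro allI impI)
    fix e :: real assume e: "0 < e"
    have "((\<lambda>s. exp (- Re a * s) * (norm (m - W p) + 1)) \<longlongrightarrow> 0) at_top"
      using assms(1) by (intro tendsto_mult_left_zero filterlim_compose[OF exp_at_bot]
          filterlim_tendsto_neg_mult_at_bot[OF tendsto_const] filterlim_ident) auto
    then have "\<forall>\<^sub>F s in at_top. exp (- Re a * s) * (norm (m - W p) + 1) < e"
      by (rule order_tendstoD) (use e in auto)
    then obtain s0 where s0: "\<And>s. s \<ge> s0 \<Longrightarrow> exp (- Re a * s) * (norm (m - W p) + 1) < e"
      unfolding eventually_at_top_linorder by blast
    obtain r w c where r: "max 0 s0 \<le> r" "run w c" "c 0 = p" "W (c r) \<in> ball (W p) 1"
      by (rule pre_control_set_recurrent[OF assms(2) p, of "ball (W p) 1" "max 0 s0"]) auto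
    obtain c' where c': "run w c'" "W (c' r) = m"
      "\<And>x. norm (W (c' x) - W (c x)) = exp (Re a * (x - r)) * norm (m - W (c r))"
      using run_neighbour[OF r(2), of r m] by blast
    have "norm (m - W (c r)) \<le> norm (m - W p) + norm (W p - W (c r))"
      using norm_triangle_ineq[of "m - W p" "W p - W (c r)"] by simp
    also have "norm (W p - W (c r)) \<le> 1" using r(4) by (simp add: dist_norm)
    finally have "exp (- Re a * r) * norm (m - W (c r)) \<le> exp (- Re a * r) * (norm (m - W p) + 1)"
      by (intro mult_left_mono) auto
    also have "\<dots> < e" using s0[of r] r(1) by simp
    finally have "dist (W (c' 0)) (W p) < e" using c'(3)[of 0] r(3) by (simp add: dist_norm)
    moreover have "wreach (W (c' 0)) m" using wreachI[OF reachI[OF c'(1), of r]] r(1) c'(2) by simp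
    ultimately show "\<exists>y\<in>{v. wreach v m}. dist y (W p) < e" by blast
  qed
qed

text \<open>The control set lies over the closure of the set \<open>R\<close> reached from one equilibrium \<open>m\<close>. Every point
reaches \<open>m\<close> and hence all of \<open>R\<close>, and every pre-control set lies over \<open>closure R\<close>.\<close>

proposition control_set_if_contracting:
  assumes "Re a < 0"
  shows "\<exists>C. control_set X Y \<Omega> C \<and> interior C \<noteq> {} \<and> compact C \<and>
    (\<forall>D. control_set X Y \<Omega> D \<longrightarrow> D = C)"
proof -
  obtain w where w: "sm < w" "w < sp" "w \<noteq> Im a" "w \<noteq> 0" using inner_speed_avoiding by metis
  have w': "w \<in> {sm..sp}" "a \<noteq> \<i> * of_real w" using w by (auto simp: complex_eq_iff)
  define m where "m = equilibrium w"
  define R where "R = {v. wreach m v}"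
  define C where "C = slab (closure R)"
  have inv: "W (c s) \<in> closure R" if c: "run u c" "W (c 0) \<in> closure R" "0 \<le> s" for u c s
    unfolding closure_approachable
  proof (intro allI impI)
    fix e :: real assume e: "0 < e"
    then have "0 < exp (- (Re a * s)) * e" by simp
    then obtain v where v: "v \<in> R" "dist v (W (c 0)) < exp (- (Re a * s)) * e"
      using c(2) unfolding closure_approachable by blast
    obtain c' where c': "run u c'" "W (c' 0) = v"
      "\<And>r. norm (W (c' r) - W (c r)) = exp (Re a * (r - 0)) * norm (v - W (c 0))"
      using run_neighbour[OF c(1), of 0 v] by blast
    have "exp (Re a * s) * norm (v - W (c 0)) < exp (Re a * s) * (exp (- (Re a * s)) * e)"
      using v(2) by (simp add: dist_norm)
    also have "\<dots> = e" by (simp add: mult.assoc[symmetric] exp_add[symmetric])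
    finally have "dist (W (c' s)) (W (c s)) < e" using c'(3)[of s] by (simp add: dist_norm)
    moreover have "wreach v (W (c' s))" using wreachI[OF reachI[OF c'(1) c(3)]] c'(2) by simp
    then have "W (c' s) \<in> R" using v(1) wreach_trans unfolding R_def by blast
    ultimately show "\<exists>y\<in>R. dist y (W (c s)) < e" by blast
  qed
  have pre: "pre_control_set X Y \<Omega> C"
    unfolding pre_control_set_q
  proof (intro conjI allI impI)
    fix p assume p: "q p \<in> C"
    let ?c = "\<lambda>s. lift (fst p + w * s)
      (equilibrium w + exp ((a - \<i> * of_real w) * of_real s) * (W p - equilibrium w))"
    have c: "run (\<lambda>_. w) ?c" "?c 0 = p" using run_constant_control[OF w'] by simp_all
    have "q (?c s) \<in> C" if "0 \<le> s" for s
      using inv[OF c(1) _ that] p c(2) unfolding C_def q_in_slab by simp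
    then show "\<exists>w c. run w c \<and> c 0 = p \<and> (\<forall>s\<ge>0. q (c s) \<in> C)" using c by blast
    fix p' assume "q p' \<in> C"
    then have "p' \<in> closure (W -` R)" by (simp add: C_def closure_vimage_W)
    moreover have "W -` R \<subseteq> q -` positive_orbit X Y \<Omega> (q p)"
      using in_positive_orbit[of p w] w w' wreach_equilibrium_if_contracting[OF assms w(1-3)]
      by (auto simp: R_def m_def)
    ultimately have "p' \<in> closure (q -` positive_orbit X Y \<Omega> (q p))" using closure_mono by blast
    then show "q p' \<in> closure (positive_orbit X Y \<Omega> (q p))" unfolding vimage_closure_q[symmetric] by simp
  qed
  have sub: "D \<subseteq> C" if "pre_control_set X Y \<Omega> D" for D
    unfolding C_def R_def by (rule pre_control_set_subset_if_contracting[OF assms that])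
  have C: "control_set X Y \<Omega> C" unfolding control_set_def using pre sub by blast
  have "D = C" if "control_set X Y \<Omega> D" for D
    using that pre sub unfolding control_set_def by blast
  moreover have "interior C \<noteq> {}"
  proof -
    have "slab (interior R) \<subseteq> C" using interior_subset closure_subset[of R] unfolding slab_def C_def by blast
    then have "slab (interior R) \<subseteq> interior C" by (rule interior_maximal) (rule open_slab, simp)
    moreover have "q (lift 0 m) \<in> slab (interior R)"
      using equilibrium_interior_forward[OF w(1-3)] by (simp add: R_def m_def)
    ultimately show ?thesis by blast
  qed
  moreover have "compact C"
    unfolding C_def
  proof (rule compact_slab)
    have "norm v \<le> - (1 / Re a)" if "v \<in> R" for v
      using wreach_bounded[OF assms, of m v] that norm_equilibrium_le[of w] assms by (simp add: R_def m_def)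
    then have "bounded R" unfolding bounded_iff by blast
    then show "compact (closure R)" by (simp add: compact_closure)
  qed
  ultimately show ?thesis using C by blast
qed

text \<open>The control set lies over the open set \<open>N\<close> of points that reach one equilibrium \<open>m\<close>. From \<open>m\<close> everything
is reached. A pre-control set that meets it must lie in it, since its points come
close to, and so into, the open set. A control set with interior points meets it because it lies
over \<open>closure N\<close>.\<close>

proposition control_set_if_expanding:
  assumes "Re a > 0"
  shows "\<exists>C. control_set X Y \<Omega> C \<and> interior C \<noteq> {} \<and> open C \<and>
    (\<forall>D. control_set X Y \<Omega> D \<and> interior D \<noteq> {} \<longrightarrow> D = C) \<and>
    (Im a \<in> {sm..sp} \<longrightarrow> slab {equilibrium (Im a)} \<subseteq> frontier C)"
proof -
  obtain w where w: "sm < w" "w < sp" "w \<noteq> Im a" "w \<noteq> 0" using inner_speed_avoiding by metis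
  have w': "w \<in> {sm..sp}" "a \<noteq> \<i> * of_real w" using w by (auto simp: complex_eq_iff)
  define m where "m = equilibrium w"
  define N where "N = {v. wreach v m}"
  define C where "C = slab N"
  have N: "open N" unfolding N_def m_def by (rule open_reaching_equilibrium[OF w(1-3)])
  have mN: "m \<in> N" by (simp add: N_def wreach_refl)
  have orbit: "q p' \<in> positive_orbit X Y \<Omega> (q p)" if "W p \<in> N" for p p'
    by (rule in_positive_orbit[of _ w])
      (use that w w' wreach_from_equilibrium_if_expanding[OF assms w(1-3)] in \<open>auto simp: N_def m_def\<close>)
  have pre: "pre_control_set X Y \<Omega> C"
    unfolding pre_control_set_q
  proof (intro conjI allI impI)
    fix p assume "q p \<in> C"
    then have p: "W p \<in> N" by (simp add: C_def)
    then obtain s r where "reach s (lift (fst p) (W p)) (lift (fst p + r) m)"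
      unfolding N_def using wreachD by blast
    then obtain u c where c: "run u c" "c 0 = p" "c s = lift (fst p + r) m" "0 \<le> s"
      unfolding reach_def by auto
    \<comment> \<open>the run to the equilibrium, continued by resting there\<close>
    let ?d = "\<lambda>s. lift (fst p + r + w * s) m"
    let ?c = "\<lambda>x. if x \<le> s then c x else ?d (x - s)"
    have run: "run (\<lambda>x. if x < s then u x else w) ?c"
      by (rule run_concat[OF c(1) run_at_equilibrium[OF w', of "fst p + r", folded m_def] c(4)]) (simp add: c)
    have "W (?c x) \<in> N" if "0 \<le> x" for x
    proof (cases "x \<le> s")
      case True
      then have "wreach (W (c x)) (W (c s))" using reach_tail[OF c(1) that] wreachI by blast
      then show ?thesis using True c(3) by (simp add: N_def)
    next
      case False then show ?thesis using mN by simp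
    qed
    then show "\<exists>w c. run w c \<and> c 0 = p \<and> (\<forall>s\<ge>0. q (c s) \<in> C)"
      using run c(2,4) by (intro exI[of _ "\<lambda>x. if x < s then u x else w"] exI[of _ ?c]) (auto simp: C_def)
    show "q p' \<in> closure (positive_orbit X Y \<Omega> (q p))" for p'
      using orbit[OF p] closure_subset by blast
  qed
  have absorb: "D \<subseteq> C" if D: "pre_control_set X Y \<Omega> D" "q p\<^sub>0 \<in> D" "W p\<^sub>0 \<in> N" for D p\<^sub>0
    unfolding C_def
  proof (rule slab_subsetI)
    fix p assume "q p \<in> D"
    then have "q p\<^sub>0 \<in> closure (positive_orbit X Y \<Omega> (q p))" using D(1,2) unfolding pre_control_set_q by blast
    moreover have "open (W -` N)" using N by (intro open_vimage continuous_on_W)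
    moreover have "p\<^sub>0 \<in> W -` N" using D(3) by simp
    ultimately obtain s p'' p1 where *: "reach s p p''" "p1 \<in> W -` N" "q p1 = q p''"
      by (rule closure_orbitD)
    have "wreach (W p) (W p'')" by (rule wreachI[OF *(1)])
    moreover have "W p'' \<in> N" using *(2) W_cong[OF *(3)] by simp
    ultimately show "W p \<in> N" using wreach_trans unfolding N_def by blast
  qed
  have qm: "q (lift 0 m) \<in> C" using mN by (simp add: C_def)
  have C: "control_set X Y \<Omega> C"
    unfolding control_set_def
  proof (intro conjI pre allI impI)
    fix D assume "pre_control_set X Y \<Omega> D" "C \<subseteq> D"
    then show "D = C" using absorb[of D "lift 0 m"] qm mN by auto
  qed
  have openC: "open C" unfolding C_def by (rule open_slab[OF N])
  have "D = C" if D: "control_set X Y \<Omega> D" "interior D \<noteq> {}" for D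
  proof -
    have preD: "pre_control_set X Y \<Omega> D" using D(1) unfolding control_set_def by blast
    obtain g where "g \<in> interior D" using D(2) by blast
    moreover obtain p where "g = q p" using surj_q by blast
    ultimately have p: "q p \<in> interior D" by simp
    have "W p \<in> closure N"
      using pre_control_set_subset_if_expanding[OF assms preD, of m] p interior_subset
      unfolding N_def by (metis q_in_slab subsetD)
    moreover have "open (lift (fst p) -` (q -` interior D))"
      by (rule open_vimage) (simp_all add: open_vimage_q continuous_on_lift)
    moreover have "W p \<in> lift (fst p) -` (q -` interior D)" using p by simp
    ultimately obtain v where "v \<in> N" "v \<in> lift (fst p) -` (q -` interior D)" by (rule closure_meets_open)
    then have "W (lift (fst p) v) \<in> N" "q (lift (fst p) v) \<in> D" using interior_subset by auto
    then have "D \<subseteq> C" using absorb[OF preD] by blast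
    then show ?thesis using D(1) pre unfolding control_set_def by blast
  qed
  moreover have "slab {equilibrium (Im a)} \<subseteq> frontier C" if I: "Im a \<in> {sm..sp}"
  proof
    let ?m = "equilibrium (Im a)"
    have nz: "a \<noteq> \<i> * of_real (Im a)" using assms by (auto simp: complex_eq_iff)
    have lim: "((\<lambda>s::real. ?m + exp (- (a - \<i> * of_real (Im a)) * of_real s) * (m - ?m)) \<longlongrightarrow> ?m) at_top"
      by (rule exp_decay) (use assms in simp)
    have ev: "\<forall>\<^sub>F s in at_top. ?m + exp (- (a - \<i> * of_real (Im a)) * of_real s) * (m - ?m) \<in> closure N"
    proof (rule eventually_mono[OF eventually_ge_at_top[of 0]])
      fix s :: real assume "0 \<le> s"
      then have "?m + exp (- (a - \<i> * of_real (Im a)) * of_real s) * (m - ?m) \<in> N"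
        using wreach_constant_control_backward[OF I nz, of s m]
        unfolding N_def mem_Collect_eq mult_minus_left by blast
      then show "?m + exp (- (a - \<i> * of_real (Im a)) * of_real s) * (m - ?m) \<in> closure N"
        using closure_subset by blast
    qed
    have cl: "?m \<in> closure N"
      by (rule Lim_in_closed_set[OF closed_closure ev trivial_limit_at_top_linorder lim])
    have "?m \<notin> N"
    proof
      assume "?m \<in> N"
      moreover have "norm ?m = 1 / Re a" using assms by (simp add: equilibrium_resonant norm_divide)
      ultimately have "1 / Re a \<le> norm m" using wreach_unbounded[OF assms, of ?m m] by (simp add: N_def)
      then show False using norm_equilibrium_less[OF assms w(3)] by (simp add: m_def)
    qed
    fix g assume "g \<in> slab {?m}"
    then obtain p where p: "g = q p" "W p = ?m" unfolding slab_def by auto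
    have "g \<in> closure C" using slab_closure[of p N] cl p by (simp add: C_def)
    moreover have "g \<notin> interior C" using \<open>?m \<notin> N\<close> p interior_open[OF openC] by (simp add: C_def)
    ultimately show "g \<in> frontier C" by (simp add: frontier_def)
  qed
  moreover have "interior C \<noteq> {}" using openC qm interior_open by blast
  ultimately show ?thesis using C openC by blast
qed

text \<open>On \<open>|W| \<ge> 1/\<lambda>\<close>, \<open>\<lambda> = Re a\<close>, the modulus of \<open>W\<close> cannot decrease along solutions. As \<open>D\<close> contains a
point with \<open>|W| = 1/\<lambda>\<close> and all its points return approximately to one another, the modulus is \<open>1/\<lambda>\<close>
on all of \<open>D\<close>. Now follow the solutions inside \<open>D\<close>.\<close>

lemma pre_control_set_through_resonant_circle:
  assumes "Re a > 0" "pre_control_set X Y \<Omega> D" "q p\<^sub>0 \<in> D" "W p\<^sub>0 = equilibrium (Im a)"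
  shows "D \<subseteq> slab {equilibrium (Im a)}"
proof (rule slab_subsetI)
  have n0: "norm (W p\<^sub>0) = 1 / Re a" using assms(1,4) by (simp add: equilibrium_resonant norm_divide)
  have cl: "closed {v::complex. r \<le> norm v}" for r by (intro closed_Collect_le continuous_intros)
  have mono: "W p' \<in> {v. norm (W p) \<le> norm v}" if "reach s p p'" "1 / Re a \<le> norm (W p)" for s p p'
    using wreach_unbounded[OF assms(1) wreachI[OF that(1)] that(2)] by simp
  have sphere: "norm (W p) = 1 / Re a" if p: "q p \<in> D" for p
  proof (rule order_antisym)
    have "q p \<in> closure (positive_orbit X Y \<Omega> (q p\<^sub>0))"
      using assms(2,3) p unfolding pre_control_set_q by blast
    then have "W p \<in> {v. norm (W p\<^sub>0) \<le> norm v}"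
      by (rule closed_condition_on_orbit_closure[OF _ continuous_on_W W_cong cl])
        (assumption, rule mono, assumption, simp only: n0 order_refl)
    then show "1 / Re a \<le> norm (W p)" using n0 by simp
    show "norm (W p) \<le> 1 / Re a"
    proof (rule ccontr)
      assume "\<not> ?thesis"
      then have big: "1 / Re a < norm (W p)" by simp
      have "q p\<^sub>0 \<in> closure (positive_orbit X Y \<Omega> (q p))"
        using assms(2,3) p unfolding pre_control_set_q by blast
      then have "W p\<^sub>0 \<in> {v. norm (W p) \<le> norm v}"
        by (rule closed_condition_on_orbit_closure[OF _ continuous_on_W W_cong cl])
          (assumption, rule mono, assumption, rule order_less_imp_le[OF big])
      then show False using n0 big by simp
    qed
  qed
  fix p assume p: "q p \<in> D"
  then obtain u c where c: "run u c" "c 0 = p" "\<And>s. 0 \<le> s \<Longrightarrow> q (c s) \<in> D"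
    using assms(2) unfolding pre_control_set_q by blast
  then show "W p \<in> {equilibrium (Im a)}" using run_on_sphere[OF c(1) assms(1)] sphere by simp
qed

proposition periodic_control_set_if_resonant:
  assumes "Re a > 0" and I: "Im a \<in> {sm..sp}" and ne: "Im a \<noteq> 0"
  defines "P \<equiv> slab {equilibrium (Im a)}"
  shows "periodic_orbit X Y \<Omega> P" "control_set X Y \<Omega> P"
proof -
  let ?m = "equilibrium (Im a)"
  have nz: "a \<noteq> \<i> * of_real (Im a)" using assms(1) by (auto simp: complex_eq_iff)
  let ?c = "\<lambda>t s. lift (t + Im a * s) ?m"
  have run: "run (\<lambda>_. Im a) (?c t)" for t by (rule run_at_equilibrium[OF I nz])
  show "periodic_orbit X Y \<Omega> P"
  proof -
    obtain u where u: "admissible_control \<Omega> u" "is_solution X Y u (\<lambda>s. q (?c 0 s))"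
      using solution_project[OF run] by blast
    define T where "T = 2 * pi / \<bar>Im a\<bar>"
    have T: "T > 0" using ne by (simp add: T_def)
    have per: "q (lift (x + 2 * pi * of_int k) ?m) = q (lift x ?m)" for x and k :: int
    proof -
      have "cis (x + 2 * pi * of_int k) = cis x" by (simp add: cis_mult[symmetric] cis_multiple_2pi)
      then show ?thesis unfolding q_eq_iff by (auto simp: lift_def intro: exI[of _ "- k"])
    qed
    have "q (?c 0 (s + T)) = q (?c 0 s)" for s
    proof -
      have "0 + Im a * (s + T) = 0 + Im a * s + 2 * pi * of_int (if Im a > 0 then 1 else - 1)"
        using ne by (simp add: T_def distrib_left abs_if)
      then show ?thesis using per by metis
    qed
    moreover have "\<not> (\<lambda>s. q (?c 0 s)) constant_on {0..}"
    proof
      assume "(\<lambda>s. q (?c 0 s)) constant_on {0..}"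
      \<comment> \<open>half a period turns the angle by \<open>\<pi>\<close> in absolute value\<close>
      then have "q (?c 0 (pi / \<bar>Im a\<bar>)) = q (?c 0 0)"
        unfolding constant_on_def by (metis atLeast_iff abs_ge_zero divide_nonneg_nonneg order_refl pi_ge_zero)
      then have "W (?c 0 0) = W (?c 0 (pi / \<bar>Im a\<bar>))" "\<exists>k::int. 0 = Im a * (pi / \<bar>Im a\<bar>) + 2 * pi * of_int k"
        unfolding q_eq_iff by simp_all
      then obtain k :: int where k: "0 = Im a * (pi / \<bar>Im a\<bar>) + 2 * pi * of_int k" by blast
      have "Im a * (pi / \<bar>Im a\<bar>) = pi * sgn (Im a)" using ne by (simp add: sgn_if)
      then have "pi * (sgn (Im a) + 2 * of_int k) = 0" using k by (simp add: algebra_simps)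
      then have "sgn (Im a) + 2 * of_int k = 0" by simp
      then have "of_int (2 * k) = (1::real) \<or> of_int (2 * k) = (- 1::real)" using ne by (auto simp: sgn_if split: if_splits)
      then have "2 * k = 1 \<or> 2 * k = - 1" by (metis of_int_1 of_int_eq_iff of_int_minus)
      then show False by presburger
    qed
    moreover have "P = (\<lambda>s. q (?c 0 s)) ` {0..}"
    proof
      show "(\<lambda>s. q (?c 0 s)) ` {0..} \<subseteq> P" by (auto simp: P_def)
      show "P \<subseteq> (\<lambda>s. q (?c 0 s)) ` {0..}"
      proof
        fix g assume "g \<in> P"
        then obtain p where p: "g = q p" "W p = ?m" unfolding P_def slab_def by auto
        have plift: "p = lift (fst p) ?m" using lift_W[of p] p(2) by simp
        define n where "n = nat \<lceil>\<bar>fst p\<bar> / (2 * pi)\<rceil>"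
        define k where "k = (if Im a > 0 then int n else - int n)"
        have "\<bar>fst p\<bar> / (2 * pi) \<le> real n" unfolding n_def by linarith
        then have n: "\<bar>fst p\<bar> \<le> 2 * pi * real n" by (simp add: field_simps)
        have "0 \<le> (fst p + 2 * pi * of_int k) / Im a"
        proof (cases "Im a > 0")
          case True
          then have "0 \<le> fst p + 2 * pi * of_int k" using n by (simp add: k_def)
          then show ?thesis using True by simp
        next
          case False
          then have "fst p + 2 * pi * of_int k \<le> 0" using n by (simp add: k_def)
          then show ?thesis using False by (simp add: divide_nonpos_nonpos)
        qed
        moreover have "g = q (?c 0 ((fst p + 2 * pi * of_int k) / Im a))"
          using ne per[of "fst p" k] plift p(1) by simp
        ultimately show "g \<in> (\<lambda>s. q (?c 0 s)) ` {0..}" by blast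
      qed
    qed
    ultimately show ?thesis unfolding periodic_orbit_def using u T by blast
  qed
  have pre: "pre_control_set X Y \<Omega> P"
    unfolding pre_control_set_q
  proof (intro conjI allI impI)
    fix p assume "q p \<in> P"
    then have p: "W p = ?m" by (simp add: P_def)
    show "\<exists>w c. run w c \<and> c 0 = p \<and> (\<forall>s\<ge>0. q (c s) \<in> P)"
      using run[of "fst p"] p lift_W[of p]
      by (intro exI[of _ "\<lambda>_. Im a"] exI[of _ "?c (fst p)"]) (auto simp: P_def)
    fix p' assume "q p' \<in> P"
    then have "q p' \<in> positive_orbit X Y \<Omega> (q p)"
      by (intro in_positive_orbit[of _ "Im a"] I nz ne) (simp_all add: P_def p wreach_refl)
    then show "q p' \<in> closure (positive_orbit X Y \<Omega> (q p))" using closure_subset by blast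
  qed
  show "control_set X Y \<Omega> P"
    unfolding control_set_def
  proof (intro conjI pre allI impI)
    fix D assume D: "pre_control_set X Y \<Omega> D" "P \<subseteq> D"
    have "q (lift 0 ?m) \<in> P" by (simp add: P_def)
    then have "q (lift 0 ?m) \<in> D" using D(2) by blast
    then have "D \<subseteq> P" unfolding P_def
      by (rule pre_control_set_through_resonant_circle[OF assms(1) D(1)]) simp
    then show "D = P" using D(2) by blast
  qed
qed

text \<open>For real \<open>a\<close> the resonant speed is \<open>0\<close>, so the points over \<open>-1/\<lambda>\<close>, \<open>\<lambda> = Re a\<close>, do not move. The
half-plane \<open>Re (e\<^bsup>-\<i>s\<^esup> z) \<le> -1/\<lambda>\<close> through such a point with angle \<open>s\<close> is forward invariant. Since it
contains no other \<open>z\<close> with \<open>|z| = 1/\<lambda>\<close>, no other of these points is in the orbit closure.\<close>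

proposition singularity_control_set_if_resonant:
  assumes "Re a > 0" "Im a = 0" "W p = equilibrium 0"
  shows "control_set X Y \<Omega> {q p}"
proof -
  have a: "a = of_real (Re a)" using assms(2) by (simp add: complex_eq_iff)
  have nz: "a \<noteq> \<i> * of_real 0" using assms(1) by (auto simp: complex_eq_iff)
  have m: "equilibrium 0 = - 1 / of_real (Re a)" using equilibrium_resonant assms(1,2) by simp
  have run: "run (\<lambda>_. 0) (\<lambda>_. p')" if "q p' = q p" for p'
    using run_at_equilibrium[OF _ nz, of "fst p'"] sm sp assms(3) lift_W[of p'] W_cong[OF that] by simp
  have pre: "pre_control_set X Y \<Omega> {q p}"
    unfolding pre_control_set_q
  proof (intro conjI allI impI)
    fix p1 assume p1: "q p1 \<in> {q p}"
    then show "\<exists>w c. run w c \<and> c 0 = p1 \<and> (\<forall>s\<ge>0. q (c s) \<in> {q p})" using run[of p1] by auto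
    fix p2 assume "q p2 \<in> {q p}"
    then have "q p2 = q p1" using p1 by simp
    moreover have "reach 0 p1 p1" using reachI[OF run[of p1], of 0] p1 by simp
    ultimately have "q p2 \<in> positive_orbit X Y \<Omega> (q p1)" unfolding positive_orbit_q by auto
    then show "q p2 \<in> closure (positive_orbit X Y \<Omega> (q p1))" using closure_subset by blast
  qed
  show ?thesis
    unfolding control_set_def
  proof (intro conjI pre allI impI)
    fix D assume D: "pre_control_set X Y \<Omega> D" "{q p} \<subseteq> D"
    have "g = q p" if g: "g \<in> D" for g
    proof -
      obtain p' where p': "g = q p'" using surj_q by blast
      have "D \<subseteq> slab {equilibrium 0}"
        using pre_control_set_through_resonant_circle[OF assms(1) D(1), of p] D(2) assms(2,3) by simp
      then have W': "W p' = equilibrium 0" using g p' by auto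
      let ?h = "\<lambda>x :: real \<times> complex. Re (cis (- fst p) * snd x)"
      have "?h p' \<in> {..- 1 / Re a}"
      proof (rule closed_condition_on_orbit_closure[where h = ?h])
        show "q p' \<in> closure (positive_orbit X Y \<Omega> (q p))"
          using D g p' unfolding pre_control_set_q by blast
        show "continuous_on UNIV ?h"
          by (intro continuous_on_Re continuous_on_mult continuous_on_const continuous_on_snd continuous_on_id)
        show "?h x = ?h y" if "q x = q y" for x y using that by (simp add: q_eq_iff)
        show "?h p'' \<in> {..- 1 / Re a}" if r: "reach s p p''" for s p''
        proof -
          obtain w c where c: "run w c" "c 0 = p" "c s = p''" "0 \<le> s" using r unfolding reach_def by blast
          have "Re (cis (- fst p) * exp (- a * of_real s) * snd (c s))
              \<le> Re (cis (- fst p) * snd (c 0)) + (1 - exp (- Re a * s)) / Re a"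
            by (rule run_bound[OF c(1,4)]) (use assms(1) in auto)
          also have "cis (- fst p) * snd (c 0) = of_real (- 1 / Re a)"
            using assms(3) c(2) by (simp add: W_def m)
          also have "exp (- a * of_real s) = of_real (exp (- Re a * s))"
            by (subst a) (simp flip: exp_of_real)
          also have "Re (cis (- fst p) * of_real (exp (- Re a * s)) * snd (c s)) = exp (- Re a * s) * ?h p''"
            using c(3) by (simp add: algebra_simps)
          finally have "exp (- Re a * s) * ?h p'' \<le> exp (- Re a * s) * (- 1 / Re a)"
            by (simp add: diff_divide_distrib)
          then have "?h p'' \<le> - 1 / Re a" by (rule mult_left_le_imp_le) simp
          then show ?thesis by (simp only: atMost_iff)
        qed
      qed simp
      also have "cis (- fst p) * snd p' = of_real (- 1 / Re a) * cis (fst p' - fst p)"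
      proof -
        have "snd p' = cis (fst p') * equilibrium 0" using lift_W[of p'] W' unfolding lift_def by (metis snd_conv)
        then show ?thesis by (simp add: m cis_mult mult.assoc[symmetric])
      qed
      finally have "- (cos (fst p' - fst p) / Re a) \<le> - (1 / Re a)" by simp
      then have "1 \<le> cos (fst p' - fst p)" using assms(1) by (simp add: divide_le_cancel)
      then have "cos (fst p' - fst p) = 1" by (simp add: order_antisym)
      then obtain k :: int where k: "fst p' - fst p = of_int k * 2 * pi" using cos_one_2pi_int by blast
      have "cis (fst p') = cis (fst p + 2 * pi * of_int k)" using k by (simp add: algebra_simps)
      also have "\<dots> = cis (fst p)" by (simp add: cis_mult[symmetric] cis_multiple_2pi)
      finally have "snd p' = snd p"
        using lift_W[of p'] lift_W[of p] W' assms(3) unfolding lift_def by (metis snd_conv)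
      then show ?thesis unfolding p' q_eq_iff using k by (intro conjI exI[of _ "- k"]) (simp_all add: algebra_simps)
    qed
    then show "D = {q p}" using D(2) by blast
  qed
qed

end

section \<open>Complex coordinates and the covering of SE(2)\<close>

definition to_complex :: "real^2 \<Rightarrow> complex" where
  "to_complex v = Complex (v $ 1) (v $ 2)"

definition of_complex :: "complex \<Rightarrow> real^2" where
  "of_complex z = vector [Re z, Im z]"

lemma to_complex_of_complex [simp]: "to_complex (of_complex z) = z"
  by (simp add: to_complex_def of_complex_def)

lemma of_complex_to_complex [simp]: "of_complex (to_complex v) = v"
  by (simp add: to_complex_def of_complex_def vec_eq_iff forall_2)

lemma to_complex_inject: "to_complex v = to_complex w \<longleftrightarrow> v = w"
  by (metis of_complex_to_complex)

lemma linear_to_complex: "linear to_complex"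
  by (rule linearI) (simp_all add: to_complex_def complex_eq_iff)

lemma linear_of_complex: "linear of_complex"
  by (rule linearI) (simp_all add: of_complex_def vec_eq_iff forall_2)

lemmas bounded_linear_to_complex = linear_conv_bounded_linear[THEN iffD1, OF linear_to_complex]
lemmas bounded_linear_of_complex = linear_conv_bounded_linear[THEN iffD1, OF linear_of_complex]

lemmas to_complex_linear_simps =
  linear_add[OF linear_to_complex] linear_diff[OF linear_to_complex] linear_cmul[OF linear_to_complex]
  linear_0[OF linear_to_complex] linear_neg[OF linear_to_complex]

lemma to_complex_matrix:
  "to_complex (vector [vector [x, - y], vector [y, x]] *v v) = Complex x y * to_complex v"
  by (simp add: to_complex_def complex_eq_iff matrix_vector_mult_def sum_2)

lemma to_complex_rotation: "to_complex (rotation t *v v) = cis t * to_complex v"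
  unfolding rotation_def to_complex_matrix by (simp add: cis.ctr)

lemma to_complex_rot_gen: "to_complex (rot_gen *v v) = \<i> * to_complex v"
  using to_complex_matrix[of 0 1 v] by (simp add: rot_gen_def Complex_eq)

lemma abs_rep_circle: "abs_circle (rep_circle c) = c"
  by (rule Quotient3_abs_rep[OF Quotient3_circle])

lemma rho_abs_circle: "rho (abs_circle t) = rotation t"
  by (rule rho.abs_eq)

lemma rho_rep_circle: "rotation (rep_circle c) = rho c"
  using rho_abs_circle[of "rep_circle c"] by (simp add: abs_rep_circle)

lemma abs_circle_eq_iff: "abs_circle s = abs_circle t \<longleftrightarrow> (\<exists>k::int. s = t + 2 * pi * of_int k)"
  unfolding circle.abs_eq_iff angle_rel_def by (auto simp: algebra_simps)

lemma continuous_abs_circle: "continuous_on UNIV abs_circle"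
  unfolding continuous_on_open_vimage[OF open_UNIV] by (simp add: open_circle_def)

text \<open>The saturation of an open set of angles is the union of its translates.\<close>

lemma open_image_abs_circle: "open U \<Longrightarrow> open (abs_circle ` U)"
proof -
  assume U: "open U"
  have "abs_circle -` abs_circle ` U = (\<Union>k::int. (+) (2 * pi * of_int k) ` U)"
    by (auto simp: abs_circle_eq_iff image_iff add.commute) metis+
  moreover have "open (\<Union>k::int. (+) (2 * pi * of_int k) ` U)"
    using U by (intro open_UN open_translation ballI)
  ultimately show ?thesis unfolding open_circle_def by simp
qed

lemma continuous_se2_cover: "continuous_on UNIV se2_cover"
  unfolding se2_cover_def[abs_def]
  by (intro continuous_on_Pair continuous_on_compose2[OF continuous_abs_circle] continuous_on_fst
      continuous_on_snd continuous_on_id) auto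

lemma open_image_se2_cover: "open U \<Longrightarrow> open (se2_cover ` U)"
proof (rule open_prod_intro)
  fix g assume U: "open U" "g \<in> se2_cover ` U"
  then obtain p where p: "p \<in> U" "g = se2_cover p" by blast
  obtain A B where AB: "open A" "open B" "p \<in> A \<times> B" "A \<times> B \<subseteq> U" using open_prod_elim[OF U(1) p(1)] .
  show "\<exists>A B. open A \<and> open B \<and> g \<in> A \<times> B \<and> A \<times> B \<subseteq> se2_cover ` U"
  proof (intro exI conjI)
    show "open (abs_circle ` A)" "open B" using AB open_image_abs_circle by auto
    show "g \<in> abs_circle ` A \<times> B" using AB(3) p(2) by (auto simp: se2_cover_def)
    show "abs_circle ` A \<times> B \<subseteq> se2_cover ` U"
    proof
      fix y assume "y \<in> abs_circle ` A \<times> B"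
      then obtain t v where "t \<in> A" "v \<in> B" "y = (abs_circle t, v)" by auto
      then have "(t, v) \<in> U" "y = se2_cover (t, v)" using AB(4) by (auto simp: se2_cover_def)
      then show "y \<in> se2_cover ` U" by blast
    qed
  qed
qed

section \<open>The rank condition\<close>

text \<open>These fields form a Lie algebra that contains \<open>\<X>\<close> and \<open>Y\<^sup>L\<close>. In particular all the fields generated
are smooth, which makes their brackets computable.\<close>

definition affine_field :: "real^2^2 \<Rightarrow> real \<Rightarrow> real \<Rightarrow> real^2 \<Rightarrow> real^2 \<Rightarrow> vfield" where
  "affine_field A x r b c = (\<lambda>(t, v). (x, r *\<^sub>R (A *v v) + b + rho t *v c))"

lemma linear_field_eq_affine_field:
  "linear_field \<xi> A = affine_field A 0 1 (rot_gen *v \<xi>) (- (rot_gen *v \<xi>))"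
  by (auto simp: linear_field_def affine_field_def matrix_vector_mult_diff_rdistrib
      linear_neg[OF matrix_vector_mul_linear])

lemma left_invariant_field_eq_affine_field:
  "left_invariant_field \<alpha> \<eta> = affine_field A \<alpha> 0 0 \<eta>"
  by (auto simp: left_invariant_field_def affine_field_def)

lemma rotation_mult_vector: "rotation t *v c = cos t *\<^sub>R c + sin t *\<^sub>R (rot_gen *v c)"
  by (simp add: rotation_def rot_gen_def vec_eq_iff forall_2 matrix_vector_mult_def sum_2)

lemma rot_gen_rot_gen: "rot_gen *v (rot_gen *v c) = - c"
  by (simp add: rot_gen_def vec_eq_iff forall_2 matrix_vector_mult_def sum_2)

lemma vfield_deriv_affine_field:
  "vfield_deriv (affine_field A x r b c) g (h, k)
     = (0, r *\<^sub>R (A *v k) + h *\<^sub>R (rho (fst g) *v (rot_gen *v c)))"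
proof -
  define t where "t = rep_circle (fst g)"
  have eq: "affine_field A x r b c \<circ> se2_cover
      = (\<lambda>p. (x, r *\<^sub>R (A *v snd p) + b + (cos (fst p) *\<^sub>R c + sin (fst p) *\<^sub>R (rot_gen *v c))))"
    by (auto simp: affine_field_def se2_cover_def rho_abs_circle rotation_mult_vector)
  have A: "bounded_linear (\<lambda>p. r *\<^sub>R (A *v snd p) :: real^2)" for r
    by (intro bounded_linear_scaleR_right bounded_linear_compose[OF bounded_linear_scaleR_right]
        bounded_linear_compose[OF matrix_vector_mul_bounded_linear] bounded_linear_snd)
  have "((affine_field A x r b c \<circ> se2_cover) has_derivative
      (\<lambda>p. (0, r *\<^sub>R (A *v snd p) + ((- (fst p * sin t)) *\<^sub>R c + (fst p * cos t) *\<^sub>R (rot_gen *v c)))))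
      (at (t, snd g))"
    unfolding eq
    by (rule has_derivative_eq_rhs, rule has_derivative_Pair, rule has_derivative_const,
        rule has_derivative_add, rule has_derivative_add,
        rule bounded_linear_imp_has_derivative[OF A], rule has_derivative_const)
      (auto intro!: derivative_eq_intros)
  from frechet_derivative_at[OF this]
  have "vfield_deriv (affine_field A x r b c) g
     = (\<lambda>p. (0, r *\<^sub>R (A *v snd p) + ((- (fst p * sin t)) *\<^sub>R c + (fst p * cos t) *\<^sub>R (rot_gen *v c))))"
    unfolding vfield_deriv_def t_def by simp
  moreover have "rho (fst g) *v (rot_gen *v c) = - sin t *\<^sub>R c + cos t *\<^sub>R (rot_gen *v c)"
    unfolding t_def rho_rep_circle[symmetric] rotation_mult_vector rot_gen_rot_gen by simp
  ultimately show ?thesis by (simp add: scaleR_diff_right)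
qed

lemma lie_bracket_affine_field:
  assumes "A ** rot_gen = rot_gen ** A"
  shows "lie_bracket (affine_field A x1 r1 b1 c1) (affine_field A x2 r2 b2 c2)
    = affine_field A 0 0 (A *v (r2 *\<^sub>R b1 - r1 *\<^sub>R b2))
        (A *v (r2 *\<^sub>R c1 - r1 *\<^sub>R c2) + rot_gen *v (x1 *\<^sub>R c2 - x2 *\<^sub>R c1))"
proof
  fix g :: se2
  obtain t v where g: "g = (t, v)" by (cases g)
  have comm: "A *v (rot_gen *v c) = rot_gen *v (A *v c)" for c
    using assms by (simp add: matrix_vector_mul_assoc)
  have "A *v (rho t *v c) = rho t *v (A *v c)" for c
    unfolding rho_rep_circle[symmetric] rotation_mult_vector
    by (simp add: linear_add[OF matrix_vector_mul_linear] linear_cmul[OF matrix_vector_mul_linear] comm)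
  moreover have field: "affine_field A x r b c g = (x, r *\<^sub>R (A *v v) + b + rho t *v c)" for x r b c
    by (simp add: g affine_field_def)
  moreover have "fst g = t" by (simp add: g)
  ultimately show "lie_bracket (affine_field A x1 r1 b1 c1) (affine_field A x2 r2 b2 c2) g
    = affine_field A 0 0 (A *v (r2 *\<^sub>R b1 - r1 *\<^sub>R b2))
        (A *v (r2 *\<^sub>R c1 - r1 *\<^sub>R c2) + rot_gen *v (x1 *\<^sub>R c2 - x2 *\<^sub>R c1)) g"
    by (simp only: lie_bracket_def field vfield_deriv_affine_field fst_conv)
      (simp add: linear_add[OF matrix_vector_mul_linear] linear_cmul[OF matrix_vector_mul_linear]
        linear_diff[OF matrix_vector_mul_linear] algebra_simps)
qed

lemma affine_field_add:
  "(\<lambda>g. affine_field A x1 r1 b1 c1 g + affine_field A x2 r2 b2 c2 g)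
    = affine_field A (x1 + x2) (r1 + r2) (b1 + b2) (c1 + c2)"
  by (auto simp: affine_field_def scaleR_add_left linear_add[OF matrix_vector_mul_linear])

lemma affine_field_scale:
  "(\<lambda>g. s *\<^sub>R affine_field A x r b c g) = affine_field A (s * x) (s * r) (s *\<^sub>R b) (s *\<^sub>R c)"
  by (auto simp: affine_field_def scaleR_add_right linear_cmul[OF matrix_vector_mul_linear])

text \<open>If \<open>\<alpha> = 0\<close>, no generated field moves the angle. If \<open>\<alpha>\<xi> + A\<eta> = 0\<close>, then \<open>\<X>\<close> and \<open>Y\<^sup>L\<close> commute, so they
span the whole Lie algebra. The drift vanishes at the identity, where only a line of tangent
vectors is then left.\<close>

lemma lie_rank_condition_nondegenerate:
  assumes comm: "A ** rot_gen = rot_gen ** A"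
    and larc: "lie_rank_condition (linear_field \<xi> A) (left_invariant_field \<alpha> \<eta>)"
  shows "\<alpha> \<noteq> 0" "\<alpha> *\<^sub>R \<xi> + A *v \<eta> \<noteq> 0"
proof -
  let ?S = "{linear_field \<xi> A, left_invariant_field \<alpha> \<eta>}"
  let ?g = "(abs_circle 0, 0) :: se2"
  have at_identity: "affine_field A x r b c ?g = (x, b + c)" for x r b c
    by (simp add: affine_field_def rho_abs_circle rotation_0)
  have full: "\<exists>Z\<in>lie_generated ?S. Z ?g = y" for y
  proof -
    have "y \<in> {Z ?g |Z. Z \<in> lie_generated ?S}" using larc unfolding lie_rank_condition_def by blast
    then show ?thesis by blast
  qed
  show "\<alpha> \<noteq> 0"
  proof
    assume \<alpha>: "\<alpha> = 0"
    have "\<exists>r b c. Z = affine_field A 0 r b c" if "Z \<in> lie_generated ?S" for Z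
      using that
    proof induction
      case (base Z)
      then show ?case
        using linear_field_eq_affine_field[of \<xi> A] left_invariant_field_eq_affine_field[of \<alpha> \<eta> A] \<alpha> by auto
    next
      case (add Z W)
      then obtain r b c r' b' c' where "Z = affine_field A 0 r b c" "W = affine_field A 0 r' b' c'" by blast
      then have "(\<lambda>g. Z g + W g) = affine_field A 0 (r + r') (b + b') (c + c')"
        by (simp add: affine_field_add)
      then show ?case by blast
    next
      case (scale Z s)
      then obtain r b c where "Z = affine_field A 0 r b c" by blast
      then have "(\<lambda>g. s *\<^sub>R Z g) = affine_field A 0 (s * r) (s *\<^sub>R b) (s *\<^sub>R c)"
        by (simp add: affine_field_scale)
      then show ?case by blast
    next
      case (bracket Z W)
      then obtain r b c r' b' c' where "Z = affine_field A 0 r b c" "W = affine_field A 0 r' b' c'" by blast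
      then show ?case using lie_bracket_affine_field[OF comm, of 0 r b c 0 r' b' c'] by blast
    qed
    then have "fst (Z ?g) = 0" if "Z \<in> lie_generated ?S" for Z using at_identity that by (metis fst_conv)
    moreover obtain Z where "Z \<in> lie_generated ?S" "Z ?g = (1, 0)" using full by blast
    ultimately show False by fastforce
  qed
  show "\<alpha> *\<^sub>R \<xi> + A *v \<eta> \<noteq> 0"
  proof
    assume zero: "\<alpha> *\<^sub>R \<xi> + A *v \<eta> = 0"
    define F where "F r x = affine_field A x r (r *\<^sub>R (rot_gen *v \<xi>)) ((x / \<alpha>) *\<^sub>R \<eta> - r *\<^sub>R (rot_gen *v \<xi>))"
      for r x
    have A\<eta>: "A *v \<eta> = - \<alpha> *\<^sub>R \<xi>" using zero by (simp add: eq_neg_iff_add_eq_0 add.commute)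
    have "\<exists>r x. Z = F r x" if "Z \<in> lie_generated ?S" for Z
      using that
    proof induction
      case (base Z)
      have "linear_field \<xi> A = F 1 0" by (simp add: F_def linear_field_eq_affine_field)
      moreover have "left_invariant_field \<alpha> \<eta> = F 0 \<alpha>"
        using \<open>\<alpha> \<noteq> 0\<close> by (simp add: F_def left_invariant_field_eq_affine_field[of _ _ A])
      ultimately show ?case using base by blast
    next
      case (add Z W)
      then obtain r x r' x' where "Z = F r x" "W = F r' x'" by blast
      then have "(\<lambda>g. Z g + W g) = F (r + r') (x + x')"
        by (simp add: F_def affine_field_add add_divide_distrib algebra_simps)
      then show ?case by blast
    next
      case (scale Z s)
      then obtain r x where "Z = F r x" by blast
      then have "(\<lambda>g. s *\<^sub>R Z g) = F (s * r) (s * x)"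
        by (simp add: F_def affine_field_scale scaleR_diff_right)
      then show ?case by blast
    next
      case (bracket Z W)
      then obtain r x r' x' where ZW: "Z = F r x" "W = F r' x'" by blast
      have 1: "r' *\<^sub>R (r *\<^sub>R v) - r *\<^sub>R (r' *\<^sub>R v) = 0" for v :: "real^2" by (simp add: mult.commute)
      have 2: "r' *\<^sub>R ((x / \<alpha>) *\<^sub>R \<eta> - r *\<^sub>R (rot_gen *v \<xi>)) - r *\<^sub>R ((x' / \<alpha>) *\<^sub>R \<eta> - r' *\<^sub>R (rot_gen *v \<xi>))
          = ((r' * x - r * x') / \<alpha>) *\<^sub>R \<eta>"
        by (simp add: algebra_simps diff_divide_distrib)
      have 3: "x *\<^sub>R ((x' / \<alpha>) *\<^sub>R \<eta> - r' *\<^sub>R (rot_gen *v \<xi>)) - x' *\<^sub>R ((x / \<alpha>) *\<^sub>R \<eta> - r *\<^sub>R (rot_gen *v \<xi>))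
          = - (r' * x - r * x') *\<^sub>R (rot_gen *v \<xi>)"
        by (simp add: algebra_simps)
      have 4: "A *v (s *\<^sub>R \<eta>) = - (s * \<alpha>) *\<^sub>R \<xi>" for s
        by (simp add: linear_cmul[OF matrix_vector_mul_linear] A\<eta>)
      have 5: "rot_gen *v (s *\<^sub>R (rot_gen *v \<xi>)) = - s *\<^sub>R \<xi>" for s
        by (simp add: linear_cmul[OF matrix_vector_mul_linear] rot_gen_rot_gen)
      have "lie_bracket Z W = F 0 0"
        unfolding ZW F_def lie_bracket_affine_field[OF comm] 1 2 3 4 5
        using \<open>\<alpha> \<noteq> 0\<close> by (simp del: minus_diff_eq)
      then show ?case by blast
    qed
    moreover obtain Z where "Z \<in> lie_generated ?S" "Z ?g = (0, axis 1 1)" using full by blast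
    ultimately obtain r x where "F r x ?g = (0, axis 1 1)" by metis
    then have "(0 :: real^2) = axis 1 1" by (auto simp: F_def at_identity)
    then show False by (simp add: axis_eq_0_iff flip: zero_neq_one)
  qed
qed

section \<open>Reduction to the normal form\<close>

locale se2_system =
  fixes \<xi> \<eta> :: "real^2" and A :: "real^2^2" and \<alpha> lam \<mu> um up :: real
    and X Y :: vfield and \<Omega> :: "real set"
  assumes X: "X = linear_field \<xi> A"
    and Y: "Y = left_invariant_field \<alpha> \<eta>"
    and \<Omega>: "\<Omega> = {um..up}" "um < 0" "0 < up"
    and A: "A = vector [vector [lam, - \<mu>], vector [\<mu>, lam]]"
    and \<alpha>: "\<alpha> \<noteq> 0"
    and nondegenerate: "\<alpha> *\<^sub>R \<xi> + A *v \<eta> \<noteq> 0"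
begin

definition a :: complex where "a = Complex lam \<mu>"
definition \<kappa> :: complex where "\<kappa> = - \<i> * (to_complex \<xi> + a * to_complex \<eta> / of_real \<alpha>)"
text \<open>The constant part \<open>\<i>\<xi>/\<kappa>\<close> of the drift that cannot be absorbed by a translation. It equals \<open>-1\<close> if \<open>a = 0\<close>,
since then \<open>\<kappa> = - \<i>\<xi>\<close>.\<close>

definition b :: complex where "b = (if a = 0 then - 1 else 0)"
definition h :: complex where "h = (if a = 0 then 0 else \<i> * to_complex \<xi> / (\<kappa> * a))"
definition sm :: real where "sm = min (um * \<alpha>) (up * \<alpha>)"
definition sp :: real where "sp = max (um * \<alpha>) (up * \<alpha>)"

text \<open>The change of coordinates \<open>z = (v + e\<^bsup>\<i>t\<^esup> \<i>\<eta>/\<alpha>) / \<kappa> + h\<close>, solved for \<open>v\<close>. The term \<open>e\<^bsup>\<i>t\<^esup> \<i>\<eta>/\<alpha>\<close>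
cancels the direct effect \<open>u e\<^bsup>\<i>t\<^esup> \<eta>\<close> of the control, \<open>h\<close> absorbs the constant \<open>\<i>\<xi>\<close> of the drift if \<open>a \<noteq> 0\<close>,
and the division by \<open>\<kappa>\<close> makes the coefficient of \<open>e\<^bsup>\<i>t\<^esup>\<close> equal to 1.\<close>

definition shear :: "real \<times> complex \<Rightarrow> real \<times> (real^2)" where
  "shear p = (fst p, of_complex (\<kappa> * (snd p - h) - cis (fst p) * (\<i> * to_complex \<eta> / of_real \<alpha>)))"

definition unshear :: "real \<times> (real^2) \<Rightarrow> real \<times> complex" where
  "unshear p = (fst p, (to_complex (snd p) + cis (fst p) * (\<i> * to_complex \<eta> / of_real \<alpha>)) / \<kappa> + h)"

definition q :: "real \<times> complex \<Rightarrow> se2" where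
  "q p = se2_cover (shear p)"

lemma \<kappa>: "\<kappa> \<noteq> 0"
proof
  assume "\<kappa> = 0"
  then have "of_real \<alpha> * (to_complex \<xi> + a * to_complex \<eta> / of_real \<alpha>) = 0" by (simp add: \<kappa>_def)
  then have "of_real \<alpha> * to_complex \<xi> + a * to_complex \<eta> = 0" using \<alpha> by (simp add: distrib_left)
  then have "to_complex (\<alpha> *\<^sub>R \<xi> + A *v \<eta>) = to_complex 0"
    unfolding A to_complex_linear_simps to_complex_matrix a_def by (simp add: scaleR_conv_of_real)
  then show False using nondegenerate to_complex_inject by blast
qed

lemma h_b: "\<kappa> * (a * h + b) = \<i> * to_complex \<xi>"
  using \<kappa> by (auto simp: h_def b_def \<kappa>_def)

lemma shear_unshear [simp]: "shear (unshear p) = p"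
  using \<kappa> by (simp add: shear_def unshear_def)

lemma unshear_shear [simp]: "unshear (shear p) = p"
  using \<kappa> by (simp add: shear_def unshear_def)

lemma continuous_shear: "continuous_on S shear"
  unfolding shear_def
  by (intro continuous_on_Pair continuous_on_fst continuous_on_id
      bounded_linear.continuous_on[OF bounded_linear_of_complex] continuous_intros)

lemma continuous_unshear: "continuous_on S unshear"
  unfolding unshear_def
  by (intro continuous_on_Pair continuous_on_fst continuous_on_id continuous_on_add continuous_on_divide
      continuous_on_mult continuous_on_const continuous_on_cis continuous_on_snd
      bounded_linear.continuous_on[OF bounded_linear_to_complex]) (use \<kappa> \<alpha> in auto)

lemma control_range: "u \<in> \<Omega> \<longleftrightarrow> u * \<alpha> \<in> {sm..sp}"
proof (cases "\<alpha> > 0")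
  case True
  then have "um * \<alpha> \<le> up * \<alpha>" using \<Omega> by simp
  then show ?thesis using True by (simp add: \<Omega>(1) sm_def sp_def)
next
  case False
  then have \<alpha>0: "\<alpha> < 0" using \<alpha> by simp
  then have "up * \<alpha> \<le> um * \<alpha>" using \<Omega> by simp
  then show ?thesis using \<alpha>0 by (auto simp: \<Omega>(1) sm_def sp_def)
qed

lemma angular_speeds_eq: "angular_speeds \<alpha> \<Omega> = {sm..sp}"
proof -
  have "w \<in> (\<lambda>u. u * \<alpha>) ` \<Omega> \<longleftrightarrow> w \<in> {sm..sp}" for w
    using control_range[of "w / \<alpha>"] \<alpha> by (auto simp: image_iff intro!: bexI[of _ "w / \<alpha>"])
  then show ?thesis unfolding angular_speeds_def by blast
qed

sublocale turning_system a b sm sp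
proof
  have "um * \<alpha> < 0 \<and> 0 < up * \<alpha> \<or> up * \<alpha> < 0 \<and> 0 < um * \<alpha>"
    using \<Omega> \<alpha> by (cases "\<alpha> > 0") (auto simp: mult_less_0_iff zero_less_mult_iff)
  then show "sm < 0" "0 < sp" by (auto simp: sm_def sp_def)
qed

text \<open>The fields at \<open>q p\<close> are what the derivative of \<open>v = \<kappa> (z - h) - e\<^bsup>\<i>t\<^esup> \<i>\<eta>/\<alpha>\<close> becomes when
\<open>z' = a z + b + e\<^bsup>\<i>t\<^esup>\<close> and \<open>t' = u \<alpha>\<close>.\<close>

lemma system_in_coordinates:
  "fst (X (q p) + u *\<^sub>R Y (q p)) = u * \<alpha>"
  "to_complex (snd (X (q p) + u *\<^sub>R Y (q p)))
     = \<kappa> * (a * snd p + b + cis (fst p)) - cis (fst p) * \<i> * of_real (u * \<alpha>) * (\<i> * to_complex \<eta> / of_real \<alpha>)"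
proof -
  show "fst (X (q p) + u *\<^sub>R Y (q p)) = u * \<alpha>"
    by (simp add: X Y linear_field_def left_invariant_field_def q_def se2_cover_def)
  let ?v = "snd (shear p)"
  have v: "to_complex ?v = \<kappa> * (snd p - h) - cis (fst p) * (\<i> * to_complex \<eta> / of_real \<alpha>)"
    by (simp add: shear_def)
  have "to_complex (snd (X (q p) + u *\<^sub>R Y (q p)))
      = a * to_complex ?v + (1 - cis (fst p)) * (\<i> * to_complex \<xi>) + of_real u * (cis (fst p) * to_complex \<eta>)"
    by (simp add: X Y linear_field_def left_invariant_field_def q_def se2_cover_def rho_abs_circle
        to_complex_linear_simps matrix_vector_mult_diff_rdistrib to_complex_rotation to_complex_rot_gen
        A to_complex_matrix a_def[symmetric] scaleR_conv_of_real[where 'a = complex] algebra_simps)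
      (simp add: shear_def)
  also have "\<dots> = \<kappa> * (a * snd p + b) - cis (fst p) * \<i> * (to_complex \<xi> + a * to_complex \<eta> / of_real \<alpha>)
      + of_real u * cis (fst p) * to_complex \<eta> + (\<i> * to_complex \<xi> - \<kappa> * (a * h + b))"
    unfolding v by (simp add: algebra_simps)
  also have "\<dots> = \<kappa> * (a * snd p + b) + cis (fst p) * \<kappa> + of_real u * cis (fst p) * to_complex \<eta>"
    unfolding h_b by (simp add: \<kappa>_def algebra_simps)
  also have "\<dots> = \<kappa> * (a * snd p + b + cis (fst p)) - cis (fst p) * \<i> * of_real (u * \<alpha>) * (\<i> * to_complex \<eta> / of_real \<alpha>)"
    using \<alpha> by (simp add: field_simps)
  finally show "to_complex (snd (X (q p) + u *\<^sub>R Y (q p)))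
     = \<kappa> * (a * snd p + b + cis (fst p)) - cis (fst p) * \<i> * of_real (u * \<alpha>) * (\<i> * to_complex \<eta> / of_real \<alpha>)" .
qed

lemma cis_has_vector_derivative:
  assumes "(f has_vector_derivative f') (at s)"
  shows "((\<lambda>s. cis (f s)) has_vector_derivative (cis (f s) * \<i> * of_real f')) (at s)"
proof -
  have "(cis has_vector_derivative cis x * \<i>) (at x)" for x
  proof -
    have D: "((\<lambda>z. exp (\<i> * z)) has_field_derivative cis x * \<i>) (at (of_real x))"
      by (auto simp: cis_conv_exp intro!: derivative_eq_intros)
    have "(\<lambda>x. exp (\<i> * of_real x)) = cis" by (simp add: fun_eq_iff cis_conv_exp)
    then show ?thesis using has_vector_derivative_real_field[OF D, of UNIV] by (simp only:)
  qed
  from vector_diff_chain_at[OF assms this[of "f s"]]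
  show ?thesis by (simp add: o_def scaleR_conv_of_real mult.commute)
qed

lemma derivative_unshear:
  assumes "(c has_vector_derivative (X (q p) + u *\<^sub>R Y (q p))) (at s)" "p = unshear (c s)"
  shows "((\<lambda>s. unshear (c s)) has_vector_derivative velocity (u * \<alpha>) p) (at s)"
proof -
  have f: "((\<lambda>s. fst (c s)) has_vector_derivative u * \<alpha>) (at s)"
    using bounded_linear.has_vector_derivative[OF bounded_linear_fst assms(1)]
    unfolding system_in_coordinates .
  have g: "((\<lambda>s. to_complex (snd (c s))) has_vector_derivative
      \<kappa> * (a * snd p + b + cis (fst p)) - cis (fst p) * \<i> * of_real (u * \<alpha>) * (\<i> * to_complex \<eta> / of_real \<alpha>)) (at s)"
    using bounded_linear.has_vector_derivative[OF bounded_linear_compose[OF bounded_linear_to_complex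
      bounded_linear_snd] assms(1)]
    unfolding system_in_coordinates o_def by simp
  have p: "fst (c s) = fst p" by (simp add: assms(2) unshear_def)
  have "((\<lambda>s. (to_complex (snd (c s)) + cis (fst (c s)) * (\<i> * to_complex \<eta> / of_real \<alpha>)) / \<kappa> + h)
      has_vector_derivative (\<kappa> * (a * snd p + b + cis (fst p)) - cis (fst p) * \<i> * of_real (u * \<alpha>) * (\<i> * to_complex \<eta> / of_real \<alpha>)
        + cis (fst p) * \<i> * of_real (u * \<alpha>) * (\<i> * to_complex \<eta> / of_real \<alpha>)) / \<kappa> + 0) (at s)"
    unfolding divide_inverse[of _ \<kappa>]
    by (intro has_vector_derivative_add has_vector_derivative_const has_vector_derivative_mult_left g
        cis_has_vector_derivative[OF f, unfolded p])
  then have "((\<lambda>s. (to_complex (snd (c s)) + cis (fst (c s)) * (\<i> * to_complex \<eta> / of_real \<alpha>)) / \<kappa> + h)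
      has_vector_derivative a * snd p + b + cis (fst p)) (at s)"
    using \<kappa> by simp
  from has_vector_derivative_Pair[OF f this] show ?thesis unfolding unshear_def velocity_def .
qed

lemma derivative_shear:
  assumes "(c has_vector_derivative velocity (u * \<alpha>) p) (at s)" "p = c s"
  shows "((\<lambda>s. shear (c s)) has_vector_derivative (X (q p) + u *\<^sub>R Y (q p))) (at s)"
proof -
  have f: "((\<lambda>s. fst (c s)) has_vector_derivative u * \<alpha>) (at s)"
    using bounded_linear.has_vector_derivative[OF bounded_linear_fst assms(1)] by (simp add: velocity_def)
  have g: "((\<lambda>s. snd (c s)) has_vector_derivative a * snd p + b + cis (fst p)) (at s)"
    using bounded_linear.has_vector_derivative[OF bounded_linear_snd assms(1)] by (simp add: velocity_def)
  let ?d = "\<kappa> * (a * snd p + b + cis (fst p) - 0) - cis (fst p) * \<i> * of_real (u * \<alpha>) * (\<i> * to_complex \<eta> / of_real \<alpha>)"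
  have "((\<lambda>s. \<kappa> * (snd (c s) - h) - cis (fst (c s)) * (\<i> * to_complex \<eta> / of_real \<alpha>)) has_vector_derivative ?d) (at s)"
    by (intro has_vector_derivative_diff has_vector_derivative_const has_vector_derivative_mult_left
        has_vector_derivative_mult_right g cis_has_vector_derivative[OF f, folded assms(2)])
  from bounded_linear.has_vector_derivative[OF bounded_linear_of_complex this]
  have "((\<lambda>s. of_complex (\<kappa> * (snd (c s) - h) - cis (fst (c s)) * (\<i> * to_complex \<eta> / of_real \<alpha>)))
     has_vector_derivative snd (X (q p) + u *\<^sub>R Y (q p))) (at s)"
    by (simp only: diff_zero system_in_coordinates(2)[symmetric] of_complex_to_complex)
  from has_vector_derivative_Pair[OF f this] show ?thesis
    unfolding shear_def by (simp only: system_in_coordinates(1)[of p u, symmetric] prod.collapse)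
qed

sublocale normal_form a b sm sp X Y \<Omega> q
proof
  show "continuous_on UNIV q"
    unfolding q_def by (rule continuous_on_compose2[OF continuous_se2_cover continuous_shear]) simp
  show "open (q ` U)" if "open U" for U
  proof -
    have "shear ` U = unshear -` U" by (force simp: image_iff intro: shear_unshear[symmetric])
    then have "open (shear ` U)" using that continuous_unshear by (simp add: open_vimage)
    then have "open (se2_cover ` shear ` U)" by (rule open_image_se2_cover)
    then show ?thesis by (simp add: image_image q_def)
  qed
  show "range q = UNIV"
  proof (intro equalityI subsetI UNIV_I)
    fix g :: se2
    have "g = se2_cover (rep_circle (fst g), snd g)" by (simp add: se2_cover_def abs_rep_circle)
    then have "g = q (unshear (rep_circle (fst g), snd g))" by (simp add: q_def)
    then show "g \<in> range q" by blast
  qed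
  show eq: "q p = q p' \<longleftrightarrow> (\<exists>k::int. fst p' = fst p + 2 * pi * of_int k) \<and> snd p' = snd p" for p p'
  proof -
    have "snd (shear p) = snd (shear p') \<longleftrightarrow> snd p' = snd p" if k: "fst p' = fst p + 2 * pi * of_int k" for k :: int
    proof -
      have "cis (fst p') = cis (fst p)" unfolding k by (simp add: cis_mult[symmetric] cis_multiple_2pi)
      then have "snd (shear p) = snd (shear p') \<longleftrightarrow>
          to_complex (snd (shear p)) = to_complex (snd (shear p'))"
        by (simp only: to_complex_inject)
      also have "\<dots> \<longleftrightarrow> \<kappa> * (snd p - h) = \<kappa> * (snd p' - h)"
        using \<open>cis (fst p') = cis (fst p)\<close> by (simp only: shear_def snd_conv to_complex_of_complex) simp
      also have "\<dots> \<longleftrightarrow> snd p' = snd p" using \<kappa> by auto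
      finally show ?thesis .
    qed
    moreover have "q p = q p' \<longleftrightarrow> abs_circle (fst p') = abs_circle (fst p) \<and> snd (shear p) = snd (shear p')"
      by (auto simp: q_def se2_cover_def shear_def)
    ultimately show ?thesis unfolding abs_circle_eq_iff by blast
  qed
  show "\<exists>w c. run w c \<and> c 0 = p \<and> (\<forall>s\<ge>0. \<gamma> s = q (c s))"
    if adm: "admissible_control \<Omega> u" and sol: "is_solution X Y u \<gamma>" and start: "\<gamma> 0 = q p" for u \<gamma> p
  proof -
    obtain c S where c: "continuous_on {0..} c" "\<And>s. 0 \<le> s \<Longrightarrow> \<gamma> s = se2_cover (c s)"
      and S: "locally_finite_times S"
        "\<And>s. 0 < s \<Longrightarrow> s \<notin> S \<Longrightarrow> (c has_vector_derivative (X (\<gamma> s) + u s *\<^sub>R Y (\<gamma> s))) (at s)"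
      using sol unfolding is_solution_def locally_finite_times_def by blast
    obtain S' where S': "locally_finite_times S'" "constant_between S' u"
      using adm unfolding admissible_control_def locally_finite_times_def constant_between_def by blast
    have u: "\<And>s. 0 \<le> s \<Longrightarrow> u s \<in> \<Omega>" using adm unfolding admissible_control_def by blast
    let ?c = "\<lambda>s. unshear (c s)"
    have \<gamma>: "\<gamma> s = q (?c s)" if "0 \<le> s" for s using c(2)[OF that] by (simp add: q_def)
    have run: "run (\<lambda>s. u s * \<alpha>) ?c"
    proof (rule runI[where S = "S \<union> S'"])
      show "u s * \<alpha> \<in> {sm..sp}" if "0 \<le> s" for s using u[OF that] control_range by blast
      show "continuous_on {0..} ?c"
        by (rule continuous_on_compose2[OF continuous_unshear[of UNIV] c(1)]) simp
      show "locally_finite_times (S \<union> S')" using S(1) S'(1) by (rule locally_finite_times_Un)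
      have "constant_between S' (\<lambda>s. u s * \<alpha>)"
        using S'(2) unfolding constant_between_def constant_on_def by metis
      then show "constant_between (S \<union> S') (\<lambda>s. u s * \<alpha>)" by (rule constant_between_mono) simp
      show "(?c has_vector_derivative velocity (u s * \<alpha>) (?c s)) (at s)" if "0 < s" "s \<notin> S \<union> S'" for s
        using derivative_unshear[of c "?c s" "u s" s] S(2)[of s] \<gamma>[of s] that by simp
    qed
    have "q (?c 0) = q p" using \<gamma>[of 0] start by simp
    then obtain k :: int where k: "fst p = fst (?c 0) + 2 * pi * of_int k" "snd p = snd (?c 0)"
      unfolding eq by blast
    show ?thesis
    proof (intro exI conjI)
      show "run (\<lambda>s. u s * \<alpha>) (\<lambda>s. ?c s + (2 * pi * of_int k, 0))" by (rule run_translate[OF run])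
      show "?c 0 + (2 * pi * of_int k, 0) = p" using k by (simp add: prod_eq_iff)
      show "\<forall>s\<ge>0. \<gamma> s = q (?c s + (2 * pi * of_int k, 0))"
        using \<gamma> by (auto simp: eq)
    qed
  qed
  show "\<exists>u. admissible_control \<Omega> u \<and> is_solution X Y u (\<lambda>s. q (c s))" if r: "run w c" for w c
  proof -
    obtain S where S: "locally_finite_times S" "constant_between S w"
      "\<And>s. 0 < s \<Longrightarrow> s \<notin> S \<Longrightarrow> (c has_vector_derivative velocity (w s) (c s)) (at s)"
      and w: "\<And>s. 0 \<le> s \<Longrightarrow> w s \<in> {sm..sp}" and c: "continuous_on {0..} c"
      using r unfolding run_def by blast
    let ?u = "\<lambda>s. w s / \<alpha>"
    have "admissible_control \<Omega> ?u"
      unfolding admissible_control_def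
    proof (intro conjI allI impI exI[of _ S])
      show "?u s \<in> \<Omega>" if "0 \<le> s" for s using control_range[of "?u s"] w[OF that] \<alpha> by simp
      show "finite (S \<inter> {0..T})" for T using S(1) unfolding locally_finite_times_def by blast
      show "?u constant_on {l<..<r}" if "0 \<le> l" "l < r" "{l<..<r} \<inter> S = {}" for l r
        using S(2) that unfolding constant_between_def constant_on_def by metis
    qed
    moreover have "is_solution X Y ?u (\<lambda>s. q (c s))"
      unfolding is_solution_def
    proof (intro exI[of _ "\<lambda>s. shear (c s)"] conjI exI[of _ S] allI impI)
      show "continuous_on {0..} (\<lambda>s. shear (c s))"
        by (rule continuous_on_compose2[OF continuous_shear[of UNIV] c]) simp
      show "q (c s) = se2_cover (shear (c s))" for s by (simp add: q_def)
      show "finite (S \<inter> {0..T})" for T using S(1) unfolding locally_finite_times_def by blast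
      show "((\<lambda>s. shear (c s)) has_vector_derivative (X (q (c s)) + ?u s *\<^sub>R Y (q (c s)))) (at s)"
        if "0 < s" "s \<notin> S" for s
        using derivative_shear[of c "?u s" "c s" s] S(3)[OF that] \<alpha> by simp
    qed
    ultimately show ?thesis by blast
  qed
qed

lemma singularity_in_coordinates:
  assumes "X (q p) = 0" shows "a * snd p + b + cis (fst p) = 0"
proof -
  have "to_complex (snd (X (q p) + 0 *\<^sub>R Y (q p))) = 0" by (simp add: assms to_complex_linear_simps)
  then show ?thesis using \<kappa> unfolding system_in_coordinates by simp
qed

end

theorem theorem4p1:
  fixes \<xi> \<eta> :: "real^2" and A :: "real^2^2" and \<alpha> lam \<mu> um up :: real
    and X Y :: vfield and \<Omega> :: "real set"
  assumes X: "X = linear_field \<xi> A"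
    and Y: "Y = left_invariant_field \<alpha> \<eta>"
    and \<Omega>: "\<Omega> = {um..up}" "um < 0" "0 < up"
    and comm: "A ** rot_gen = rot_gen ** A"
    and A: "A = vector [vector [lam, - \<mu>], vector [\<mu>, lam]]"
    and larc: "lie_rank_condition X Y"
  shows
    "(det A = 0 \<longrightarrow> infinite {D. control_set X Y \<Omega> D \<and> interior D = {}}) \<and>
     (det A \<noteq> 0 \<longrightarrow>
        (trace A = 0 \<longrightarrow> controllable X Y \<Omega>) \<and>
        (trace A < 0 \<longrightarrow>
           (\<exists>C. control_set X Y \<Omega> C \<and> interior C \<noteq> {} \<and> compact C \<and>
                (\<forall>D. control_set X Y \<Omega> D \<and> interior D \<noteq> {} \<longrightarrow> D = C))) \<and>
        (trace A > 0 \<longrightarrow>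
           (\<exists>C. control_set X Y \<Omega> C \<and> interior C \<noteq> {} \<and> open C \<and>
                (\<forall>D. control_set X Y \<Omega> D \<and> interior D \<noteq> {} \<longrightarrow> D = C) \<and>
                (\<mu> \<in> angular_speeds \<alpha> \<Omega> \<longrightarrow>
                   (\<mu> \<noteq> 0 \<longrightarrow>
                      (\<exists>P. periodic_orbit X Y \<Omega> P \<and> P \<subseteq> frontier C \<and> control_set X Y \<Omega> P)) \<and>
                   (\<mu> = 0 \<longrightarrow>
                      (\<forall>g. X g = 0 \<longrightarrow> control_set X Y \<Omega> {g} \<and> g \<in> frontier C))))))"
proof -
  have nondeg: "\<alpha> \<noteq> 0" "\<alpha> *\<^sub>R \<xi> + A *v \<eta> \<noteq> 0"
    using lie_rank_condition_nondegenerate[OF comm] larc unfolding X Y by blast+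
  interpret S: se2_system \<xi> \<eta> A \<alpha> lam \<mu> um up X Y \<Omega>
    by unfold_locales (use X Y \<Omega> A nondeg in auto)
  have det: "det A = lam\<^sup>2 + \<mu>\<^sup>2" unfolding A by (simp add: det_2 power2_eq_square)
  have trace: "trace A = 2 * lam" unfolding A by (simp add: trace_def sum_2)
  have a: "Re S.a = lam" "Im S.a = \<mu>" by (simp_all add: S.a_def)
  show ?thesis
  proof (cases "det A = 0")
    case True
    then have "lam = 0" "\<mu> = 0" by (simp_all add: det)
    then have "Re S.a = 0" "Im S.a = 0" unfolding a by blast+
    then have "S.a = 0" by (simp only: complex_eq_iff zero_complex.simps simp_thms)
    then have "infinite {D. control_set X Y \<Omega> D \<and> interior D = {}}"
      by (intro S.infinite_control_sets_with_empty_interior) (simp_all add: S.b_def)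
    then show ?thesis using True by blast
  next
    case False
    then have "S.a \<noteq> 0" by (auto simp: det S.a_def complex_eq_iff)
    then have "S.b = 0" by (simp add: S.b_def)
    interpret R: rotating_normal_form S.a S.sm S.sp X Y \<Omega> S.q
      unfolding rotating_normal_form_def rotating_system_def \<open>S.b = 0\<close>[symmetric]
      using S.normal_form_axioms S.turning_system_axioms by blast
    have 1: "controllable X Y \<Omega>" if "trace A = 0"
      by (rule R.controllable_if_rotation) (use that trace a in simp)
    have 2: "\<exists>C. control_set X Y \<Omega> C \<and> interior C \<noteq> {} \<and> compact C \<and>
        (\<forall>D. control_set X Y \<Omega> D \<and> interior D \<noteq> {} \<longrightarrow> D = C)" if "trace A < 0"
    proof -
      have "Re S.a < 0" using that trace a by simp
      from R.control_set_if_contracting[OF this] show ?thesis by blast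
    qed
    have 3: "\<exists>C. control_set X Y \<Omega> C \<and> interior C \<noteq> {} \<and> open C \<and>
        (\<forall>D. control_set X Y \<Omega> D \<and> interior D \<noteq> {} \<longrightarrow> D = C) \<and>
        (\<mu> \<in> angular_speeds \<alpha> \<Omega> \<longrightarrow>
           (\<mu> \<noteq> 0 \<longrightarrow> (\<exists>P. periodic_orbit X Y \<Omega> P \<and> P \<subseteq> frontier C \<and> control_set X Y \<Omega> P)) \<and>
           (\<mu> = 0 \<longrightarrow> (\<forall>g. X g = 0 \<longrightarrow> control_set X Y \<Omega> {g} \<and> g \<in> frontier C)))" if "trace A > 0"
    proof -
      have pos: "Re S.a > 0" using that trace a by simp
      obtain C where C: "control_set X Y \<Omega> C" "interior C \<noteq> {}" "open C"
        "\<forall>D. control_set X Y \<Omega> D \<and> interior D \<noteq> {} \<longrightarrow> D = C"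
        "\<mu> \<in> {S.sm..S.sp} \<longrightarrow> R.slab {R.equilibrium \<mu>} \<subseteq> frontier C"
        using R.control_set_if_expanding[OF pos] unfolding a by blast
      have periodic: "\<exists>P. periodic_orbit X Y \<Omega> P \<and> P \<subseteq> frontier C \<and> control_set X Y \<Omega> P"
        if "\<mu> \<in> angular_speeds \<alpha> \<Omega>" "\<mu> \<noteq> 0"
        using R.periodic_control_set_if_resonant[OF pos] that C(5) unfolding a S.angular_speeds_eq by blast
      have singular: "control_set X Y \<Omega> {g} \<and> g \<in> frontier C"
        if \<mu>: "\<mu> \<in> angular_speeds \<alpha> \<Omega>" "\<mu> = 0" and g: "X g = 0" for g
      proof -
        obtain p where p: "g = S.q p" using S.surj_q by blast
        have "S.a * snd p + cis (fst p) = 0"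
          using S.singularity_in_coordinates[of p] g p \<open>S.b = 0\<close> by simp
        then have "S.a * snd p = - cis (fst p)" by (simp add: eq_neg_iff_add_eq_0)
        then have "snd p = - cis (fst p) / S.a" using \<open>S.a \<noteq> 0\<close> by (simp add: field_simps)
        then have W: "R.W p = R.equilibrium 0"
          by (simp add: R.W_def R.equilibrium_def cis_mult)
        have "control_set X Y \<Omega> {S.q p}"
          by (rule R.singularity_control_set_if_resonant[OF pos _ W]) (rule trans[OF a(2) \<mu>(2)])
        moreover have "R.W p = R.equilibrium \<mu>" by (rule trans[OF W arg_cong[where f = R.equilibrium, OF \<mu>(2)[symmetric]]])
        then have "S.q p \<in> R.slab {R.equilibrium \<mu>}" by simp
        ultimately show ?thesis using C(5) \<mu>(1) p unfolding S.angular_speeds_eq by blast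
      qed
      show ?thesis using C(1-4) periodic singular by blast
    qed
    show ?thesis using False 1 2 3 by blast
  qed
qed

end
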